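(* $\mathsf{WKL}_0^-$ is $\Pi^1_1$ conservative over $\mathsf{RCA}_0^-$; that is, every $\Pi^1_1$ sentence of $L_2$ provable in $\mathsf{WKL}_0^-$ is provable in $\mathsf{RCA}_0^-$.
   Context: **Language $L_1$ and BASIC.** $L_1$ is the first-order language with constant $0$, unary function symbols $S,H,T$, binary function symbols $+,\cdot$, a binary pairing function symbol $(\cdot,\cdot)$, and a binary relation $<$. Write $1=S(0)$, $2=S(S(0))$, and $x\le y$ for $x<y\lor x=y$. Pairing associates to the right. BASIC consists of the universal closures of: $S(x)\neq 0$; $S(x)=S(y)\to x=y$; $x+0=x$; $x+S(y)=S(x+y)$; $x\cdot 0=0$; $x\cdot S(y)=x\cdot y+x$; $\lnot x<0$; $x<S(y)\leftrightarrow x<y\lor x=y$; $x<y\lor x=y\lor y<x$; $0<x\to\exists y<x\,S(y)=x$; $(x,y)=z\leftrightarrow 2\cdot z=(x+y)\cdot(x+y+1)+2\cdot x+2$; $(x,y)=(x',y')\to x=x'\land y=y'$; $z>0\to\exists x,y<z\,(x,y)=z$; $H((x,y))=x$; $H(0)=0$; $T((x,y))=y$; $T(0)=0$. **Language $L_2$.** $L_2$ is the two-sorted language extending $L_1$ with set variables and atomic formulas $t\in X$. $\Delta^0_0$ formulas are the $L_2$-formulas all of whose quantifiers are bounded number quantifiers (free set variables allowed). A $\Pi^1_1$ sentence has the form $\forall X\,\varphi(X)$ with $\varphi$ without set quantifiers. **$\mathsf{RCA}_0^-$.** $\mathrm{C}\Delta^0_0$ consists of BASIC, the induction axiom $\mathrm{IND}$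 (universal closure of $0\in X\land\forall x(x\in X\to S(x)\in X)\to x\in X$), and $\mathrm{C}[\Delta^0_0]$, the universal closures of $\exists X\forall x(x\in X\leftrightarrow\varphi(x))$ for $\varphi\in\Delta^0_0$ ($X$ not free in $\varphi$; other parameters allowed). For a set $f$, $f\in\mathcal F$ abbreviates $\forall x\exists y\,(x,y)\in f\land\forall x,y,y'((x,y)\in f\land(x,y')\in f\to y=y')\land 0\notin f$; $f(x)=y$ abbreviates $(x,y)\in f$. The axiom $\circ$ is $\forall g,h\in\mathcal F\;\exists f\in\mathcal F\;\forall x,y,z\,(h(x)=z\land g(z)=y\to f(x)=y)$. $\mathsf{RCA}_0^-:=\mathrm{C}\Delta^0_0+\circ$. **Trees and WKL.** $2^x\doteq y$ denotes a $\Delta_0$ formula defining the graph of exponentiation (with the usual recurrences provable by bounded induction). A finite $0$–$1$ sequence $\langle x_0,\dots,x_{n-1}\rangle$ is coded by the number with binary representation $1x_0\ldots x_{n-1}$, so every nonzero number codes a sequence and $1$ codes the empty one. For $\sigma,\tau>0$, $\sigma\preceq\tau$ ($\sigma$ is an initial segment of $\tau$) means $\exists p,y\le\tau\,\exists x<p\,(2^y\doteq p\land\tau=\sigma\cdot p+x)$; $\sigma\prec\tau$ means $\sigma\preceq\tau$ and $\sigma<\tau$. A set $T$ is a (binary) tree if $0\notin T$ and $\forall\tau\in T\,\forall\sigma\prec\tau\,(\sigma\in T)$. A tree is infinite if it is unbounded (no $b$ satisfies $\forall x\in T\,x<b$). A branch is a tree linearly ordered by $\preceq$. $\mathsf{WKL}$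 is the sentence: for every infinite tree $T$ there is an infinite tree $P$ such that $P$ is a branch and $P\subseteq T$. $\mathsf{WKL}_0^-:=\mathsf{RCA}_0^-+\mathsf{WKL}$. *)

theory Defs
  imports Main
begin

section \<open>Two-sorted language\<close>

text \<open>
  Both sorts use de Bruijn indices, each with its own index space: a number quantifier shifts
  the number variables only, a set quantifier the set variables only. Equality is between
  numbers; the only atomic formulas that contain set variables are membership atoms.
\<close>

datatype tm =
    Var nat
  | Zero                                        ("\<^bold>0")
  | Succ tm
  | Head tm
  | Tail tm
  | Add tm tm                                   (infixl "\<^bold>+" 75)
  | Mul tm tm                                   (infixl "\<^bold>*" 80)
  | Pair tm tm                                  ("\<^bold>\<langle>_,/ _\<^bold>\<rangle>")

datatype fm =
    Eq tm tm                                    (infix "\<^bold>=" 60)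
  | Less tm tm                                  (infix "\<^bold><" 60)
  | Mem tm nat                                  (infix "\<^bold>\<in>" 60)
  | Falsum                                      ("\<^bold>\<bottom>")
  | Imp fm fm                                   (infixr "\<^bold>\<longrightarrow>" 45)
  | And fm fm                                   (infixr "\<^bold>\<and>" 55)
  | Or fm fm                                    (infixr "\<^bold>\<or>" 50)
  | AllN fm
  | ExN fm
  | AllS fm
  | ExS fm

abbreviation Neg :: "fm \<Rightarrow> fm" ("\<^bold>\<not> _" [58] 58) where
  "\<^bold>\<not> \<phi> \<equiv> \<phi> \<^bold>\<longrightarrow> \<^bold>\<bottom>"

abbreviation Iff :: "fm \<Rightarrow> fm \<Rightarrow> fm" (infix "\<^bold>\<longleftrightarrow>" 44) where
  "\<phi> \<^bold>\<longleftrightarrow> \<psi> \<equiv> (\<phi> \<^bold>\<longrightarrow> \<psi>) \<^bold>\<and> (\<psi> \<^bold>\<longrightarrow> \<phi>)"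

abbreviation Le :: "tm \<Rightarrow> tm \<Rightarrow> fm" (infix "\<^bold>\<le>" 60) where
  "s \<^bold>\<le> t \<equiv> s \<^bold>< t \<^bold>\<or> s \<^bold>= t"

abbreviation One :: tm ("\<^bold>1") where "\<^bold>1 \<equiv> Succ \<^bold>0"
abbreviation Two :: tm ("\<^bold>2") where "\<^bold>2 \<equiv> Succ (Succ \<^bold>0)"


subsection \<open>Substitution\<close>

primrec tsubst :: "(nat \<Rightarrow> tm) \<Rightarrow> tm \<Rightarrow> tm" where
  "tsubst \<sigma> (Var i) = \<sigma> i"
| "tsubst \<sigma> \<^bold>0 = \<^bold>0"
| "tsubst \<sigma> (Succ t) = Succ (tsubst \<sigma> t)"
| "tsubst \<sigma> (Head t) = Head (tsubst \<sigma> t)"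
| "tsubst \<sigma> (Tail t) = Tail (tsubst \<sigma> t)"
| "tsubst \<sigma> (s \<^bold>+ t) = tsubst \<sigma> s \<^bold>+ tsubst \<sigma> t"
| "tsubst \<sigma> (s \<^bold>* t) = tsubst \<sigma> s \<^bold>* tsubst \<sigma> t"
| "tsubst \<sigma> \<^bold>\<langle>s, t\<^bold>\<rangle> = \<^bold>\<langle>tsubst \<sigma> s, tsubst \<sigma> t\<^bold>\<rangle>"

definition tlift :: "tm \<Rightarrow> tm" where
  "tlift = tsubst (\<lambda>i. Var (Suc i))"

text \<open>
  Simultaneous capture-avoiding substitution: terms \<open>\<sigma>\<close> for the number variables and set
  variables \<open>\<rho>\<close> for the set variables.
\<close>

primrec subst :: "(nat \<Rightarrow> tm) \<Rightarrow> (nat \<Rightarrow> nat) \<Rightarrow> fm \<Rightarrow> fm" where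
  "subst \<sigma> \<rho> (s \<^bold>= t) = (tsubst \<sigma> s \<^bold>= tsubst \<sigma> t)"
| "subst \<sigma> \<rho> (s \<^bold>< t) = (tsubst \<sigma> s \<^bold>< tsubst \<sigma> t)"
| "subst \<sigma> \<rho> (t \<^bold>\<in> X) = (tsubst \<sigma> t \<^bold>\<in> \<rho> X)"
| "subst \<sigma> \<rho> \<^bold>\<bottom> = \<^bold>\<bottom>"
| "subst \<sigma> \<rho> (\<phi> \<^bold>\<longrightarrow> \<psi>) = (subst \<sigma> \<rho> \<phi> \<^bold>\<longrightarrow> subst \<sigma> \<rho> \<psi>)"
| "subst \<sigma> \<rho> (\<phi> \<^bold>\<and> \<psi>) = (subst \<sigma> \<rho> \<phi> \<^bold>\<and> subst \<sigma> \<rho> \<psi>)"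
| "subst \<sigma> \<rho> (\<phi> \<^bold>\<or> \<psi>) = (subst \<sigma> \<rho> \<phi> \<^bold>\<or> subst \<sigma> \<rho> \<psi>)"
| "subst \<sigma> \<rho> (AllN \<phi>) = AllN (subst (case_nat (Var 0) (\<lambda>i. tlift (\<sigma> i))) \<rho> \<phi>)"
| "subst \<sigma> \<rho> (ExN \<phi>) = ExN (subst (case_nat (Var 0) (\<lambda>i. tlift (\<sigma> i))) \<rho> \<phi>)"
| "subst \<sigma> \<rho> (AllS \<phi>) = AllS (subst \<sigma> (case_nat 0 (\<lambda>i. Suc (\<rho> i))) \<phi>)"
| "subst \<sigma> \<rho> (ExS \<phi>) = ExS (subst \<sigma> (case_nat 0 (\<lambda>i. Suc (\<rho> i))) \<phi>)"

definition liftN :: "fm \<Rightarrow> fm" where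
  "liftN = subst (\<lambda>i. Var (Suc i)) id"

definition liftS :: "fm \<Rightarrow> fm" where
  "liftS = subst Var Suc"

definition instN :: "tm \<Rightarrow> fm \<Rightarrow> fm" where
  "instN t = subst (case_nat t Var) id"

definition instS :: "nat \<Rightarrow> fm \<Rightarrow> fm" where
  "instS X = subst Var (case_nat X id)"


subsection \<open>Closed formulas and universal closure\<close>

text \<open>
  \<open>nbound \<phi>\<close> and \<open>sbound \<phi>\<close> are the least \<open>n\<close> such that all free number (respectively set)
  variables of \<open>\<phi>\<close> have index below \<open>n\<close>.
\<close>

primrec tbound :: "tm \<Rightarrow> nat" where
  "tbound (Var i) = Suc i"
| "tbound \<^bold>0 = 0"
| "tbound (Succ t) = tbound t"
| "tbound (Head t) = tbound t"
| "tbound (Tail t) = tbound t"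
| "tbound (s \<^bold>+ t) = max (tbound s) (tbound t)"
| "tbound (s \<^bold>* t) = max (tbound s) (tbound t)"
| "tbound \<^bold>\<langle>s, t\<^bold>\<rangle> = max (tbound s) (tbound t)"

primrec nbound :: "fm \<Rightarrow> nat" where
  "nbound (s \<^bold>= t) = max (tbound s) (tbound t)"
| "nbound (s \<^bold>< t) = max (tbound s) (tbound t)"
| "nbound (t \<^bold>\<in> X) = tbound t"
| "nbound \<^bold>\<bottom> = 0"
| "nbound (\<phi> \<^bold>\<longrightarrow> \<psi>) = max (nbound \<phi>) (nbound \<psi>)"
| "nbound (\<phi> \<^bold>\<and> \<psi>) = max (nbound \<phi>) (nbound \<psi>)"
| "nbound (\<phi> \<^bold>\<or> \<psi>) = max (nbound \<phi>) (nbound \<psi>)"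
| "nbound (AllN \<phi>) = nbound \<phi> - 1"
| "nbound (ExN \<phi>) = nbound \<phi> - 1"
| "nbound (AllS \<phi>) = nbound \<phi>"
| "nbound (ExS \<phi>) = nbound \<phi>"

primrec sbound :: "fm \<Rightarrow> nat" where
  "sbound (s \<^bold>= t) = 0"
| "sbound (s \<^bold>< t) = 0"
| "sbound (t \<^bold>\<in> X) = Suc X"
| "sbound \<^bold>\<bottom> = 0"
| "sbound (\<phi> \<^bold>\<longrightarrow> \<psi>) = max (sbound \<phi>) (sbound \<psi>)"
| "sbound (\<phi> \<^bold>\<and> \<psi>) = max (sbound \<phi>) (sbound \<psi>)"
| "sbound (\<phi> \<^bold>\<or> \<psi>) = max (sbound \<phi>) (sbound \<psi>)"
| "sbound (AllN \<phi>) = sbound \<phi>"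
| "sbound (ExN \<phi>) = sbound \<phi>"
| "sbound (AllS \<phi>) = sbound \<phi> - 1"
| "sbound (ExS \<phi>) = sbound \<phi> - 1"

definition sentence :: "fm \<Rightarrow> bool" where
  "sentence \<phi> \<longleftrightarrow> nbound \<phi> = 0 \<and> sbound \<phi> = 0"

definition ucl :: "fm \<Rightarrow> fm" where
  "ucl \<phi> = (AllS ^^ sbound \<phi>) ((AllN ^^ nbound \<phi>) \<phi>)"


section \<open>Provability\<close>

text \<open>
  Classical natural deduction for two-sorted first-order logic with equality. In the
  eigenvariable rules the fresh variable is index 0, obtained by lifting all assumptions.
\<close>

inductive proves :: "fm set \<Rightarrow> fm \<Rightarrow> bool" (infix "\<turnstile>" 40) where
  Assm: "\<phi> \<in> \<Gamma> \<Longrightarrow> \<Gamma> \<turnstile> \<phi>"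
| ImpI: "insert \<phi> \<Gamma> \<turnstile> \<psi> \<Longrightarrow> \<Gamma> \<turnstile> \<phi> \<^bold>\<longrightarrow> \<psi>"
| ImpE: "\<Gamma> \<turnstile> \<phi> \<^bold>\<longrightarrow> \<psi> \<Longrightarrow> \<Gamma> \<turnstile> \<phi> \<Longrightarrow> \<Gamma> \<turnstile> \<psi>"
| Contr: "insert (\<^bold>\<not> \<phi>) \<Gamma> \<turnstile> \<^bold>\<bottom> \<Longrightarrow> \<Gamma> \<turnstile> \<phi>"
| AndI: "\<Gamma> \<turnstile> \<phi> \<Longrightarrow> \<Gamma> \<turnstile> \<psi> \<Longrightarrow> \<Gamma> \<turnstile> \<phi> \<^bold>\<and> \<psi>"
| AndE1: "\<Gamma> \<turnstile> \<phi> \<^bold>\<and> \<psi> \<Longrightarrow> \<Gamma> \<turnstile> \<phi>"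
| AndE2: "\<Gamma> \<turnstile> \<phi> \<^bold>\<and> \<psi> \<Longrightarrow> \<Gamma> \<turnstile> \<psi>"
| OrI1: "\<Gamma> \<turnstile> \<phi> \<Longrightarrow> \<Gamma> \<turnstile> \<phi> \<^bold>\<or> \<psi>"
| OrI2: "\<Gamma> \<turnstile> \<psi> \<Longrightarrow> \<Gamma> \<turnstile> \<phi> \<^bold>\<or> \<psi>"
| OrE: "\<Gamma> \<turnstile> \<phi> \<^bold>\<or> \<psi> \<Longrightarrow> insert \<phi> \<Gamma> \<turnstile> \<chi> \<Longrightarrow> insert \<psi> \<Gamma> \<turnstile> \<chi> \<Longrightarrow> \<Gamma> \<turnstile> \<chi>"
| AllNI: "liftN ` \<Gamma> \<turnstile> \<phi> \<Longrightarrow> \<Gamma> \<turnstile> AllN \<phi>"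
| AllNE: "\<Gamma> \<turnstile> AllN \<phi> \<Longrightarrow> \<Gamma> \<turnstile> instN t \<phi>"
| ExNI: "\<Gamma> \<turnstile> instN t \<phi> \<Longrightarrow> \<Gamma> \<turnstile> ExN \<phi>"
| ExNE: "\<Gamma> \<turnstile> ExN \<phi> \<Longrightarrow> insert \<phi> (liftN ` \<Gamma>) \<turnstile> liftN \<chi> \<Longrightarrow> \<Gamma> \<turnstile> \<chi>"
| AllSI: "liftS ` \<Gamma> \<turnstile> \<phi> \<Longrightarrow> \<Gamma> \<turnstile> AllS \<phi>"
| AllSE: "\<Gamma> \<turnstile> AllS \<phi> \<Longrightarrow> \<Gamma> \<turnstile> instS X \<phi>"
| ExSI: "\<Gamma> \<turnstile> instS X \<phi> \<Longrightarrow> \<Gamma> \<turnstile> ExS \<phi>"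
| ExSE: "\<Gamma> \<turnstile> ExS \<phi> \<Longrightarrow> insert \<phi> (liftS ` \<Gamma>) \<turnstile> liftS \<chi> \<Longrightarrow> \<Gamma> \<turnstile> \<chi>"
| EqRefl: "\<Gamma> \<turnstile> t \<^bold>= t"
| EqSubst: "\<Gamma> \<turnstile> s \<^bold>= t \<Longrightarrow> \<Gamma> \<turnstile> instN s \<phi> \<Longrightarrow> \<Gamma> \<turnstile> instN t \<phi>"


section \<open>Formula classes\<close>

text \<open>The bound \<open>t\<close> is evaluated outside the quantifier, hence the lifting.\<close>

abbreviation AllLess :: "tm \<Rightarrow> fm \<Rightarrow> fm" where
  "AllLess t \<phi> \<equiv> AllN (Var 0 \<^bold>< tlift t \<^bold>\<longrightarrow> \<phi>)"
abbreviation ExLess :: "tm \<Rightarrow> fm \<Rightarrow> fm" where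
  "ExLess t \<phi> \<equiv> ExN (Var 0 \<^bold>< tlift t \<^bold>\<and> \<phi>)"
abbreviation AllLe :: "tm \<Rightarrow> fm \<Rightarrow> fm" where
  "AllLe t \<phi> \<equiv> AllN (Var 0 \<^bold>\<le> tlift t \<^bold>\<longrightarrow> \<phi>)"
abbreviation ExLe :: "tm \<Rightarrow> fm \<Rightarrow> fm" where
  "ExLe t \<phi> \<equiv> ExN (Var 0 \<^bold>\<le> tlift t \<^bold>\<and> \<phi>)"

inductive delta00 :: "fm \<Rightarrow> bool" where
  "delta00 (s \<^bold>= t)"
| "delta00 (s \<^bold>< t)"
| "delta00 (t \<^bold>\<in> X)"
| "delta00 \<^bold>\<bottom>"
| "delta00 \<phi> \<Longrightarrow> delta00 \<psi> \<Longrightarrow> delta00 (\<phi> \<^bold>\<longrightarrow> \<psi>)"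
| "delta00 \<phi> \<Longrightarrow> delta00 \<psi> \<Longrightarrow> delta00 (\<phi> \<^bold>\<and> \<psi>)"
| "delta00 \<phi> \<Longrightarrow> delta00 \<psi> \<Longrightarrow> delta00 (\<phi> \<^bold>\<or> \<psi>)"
| "delta00 \<phi> \<Longrightarrow> delta00 (AllLess t \<phi>)"
| "delta00 \<phi> \<Longrightarrow> delta00 (ExLess t \<phi>)"
| "delta00 \<phi> \<Longrightarrow> delta00 (AllLe t \<phi>)"
| "delta00 \<phi> \<Longrightarrow> delta00 (ExLe t \<phi>)"

primrec no_set_quant :: "fm \<Rightarrow> bool" where
  "no_set_quant (s \<^bold>= t) \<longleftrightarrow> True"
| "no_set_quant (s \<^bold>< t) \<longleftrightarrow> True"
| "no_set_quant (t \<^bold>\<in> X) \<longleftrightarrow> True"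
| "no_set_quant \<^bold>\<bottom> \<longleftrightarrow> True"
| "no_set_quant (\<phi> \<^bold>\<longrightarrow> \<psi>) \<longleftrightarrow> no_set_quant \<phi> \<and> no_set_quant \<psi>"
| "no_set_quant (\<phi> \<^bold>\<and> \<psi>) \<longleftrightarrow> no_set_quant \<phi> \<and> no_set_quant \<psi>"
| "no_set_quant (\<phi> \<^bold>\<or> \<psi>) \<longleftrightarrow> no_set_quant \<phi> \<and> no_set_quant \<psi>"
| "no_set_quant (AllN \<phi>) \<longleftrightarrow> no_set_quant \<phi>"
| "no_set_quant (ExN \<phi>) \<longleftrightarrow> no_set_quant \<phi>"
| "no_set_quant (AllS \<phi>) \<longleftrightarrow> False"
| "no_set_quant (ExS \<phi>) \<longleftrightarrow> False"

definition Pi11_sentence :: "fm \<Rightarrow> bool" where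
  "Pi11_sentence \<psi> \<longleftrightarrow> sentence \<psi> \<and> (\<exists>\<phi>. no_set_quant \<phi> \<and> \<psi> = AllS \<phi>)"


section \<open>The theory \<open>RCA\<^sub>0\<^sup>-\<close>\<close>

text \<open>
  In the axioms \<open>x, y, z\<close> of the usual presentation are \<open>Var 0, Var 1, Var 2\<close>; in the
  injectivity axiom for pairing \<open>x', y'\<close> are \<open>Var 2, Var 3\<close>.
\<close>

definition BASIC_matrices :: "fm set" where
  "BASIC_matrices =
   {\<^bold>\<not> Succ (Var 0) \<^bold>= \<^bold>0,
    Succ (Var 0) \<^bold>= Succ (Var 1) \<^bold>\<longrightarrow> Var 0 \<^bold>= Var 1,
    Var 0 \<^bold>+ \<^bold>0 \<^bold>= Var 0,
    Var 0 \<^bold>+ Succ (Var 1) \<^bold>= Succ (Var 0 \<^bold>+ Var 1),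
    Var 0 \<^bold>* \<^bold>0 \<^bold>= \<^bold>0,
    Var 0 \<^bold>* Succ (Var 1) \<^bold>= Var 0 \<^bold>* Var 1 \<^bold>+ Var 0,
    \<^bold>\<not> Var 0 \<^bold>< \<^bold>0,
    Var 0 \<^bold>< Succ (Var 1) \<^bold>\<longleftrightarrow> Var 0 \<^bold>< Var 1 \<^bold>\<or> Var 0 \<^bold>= Var 1,
    Var 0 \<^bold>< Var 1 \<^bold>\<or> Var 0 \<^bold>= Var 1 \<^bold>\<or> Var 1 \<^bold>< Var 0,
    \<^bold>0 \<^bold>< Var 0 \<^bold>\<longrightarrow> ExLess (Var 0) (Succ (Var 0) \<^bold>= Var 1),
    \<^bold>\<langle>Var 0, Var 1\<^bold>\<rangle> \<^bold>= Var 2 \<^bold>\<longleftrightarrow>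
      \<^bold>2 \<^bold>* Var 2 \<^bold>= (Var 0 \<^bold>+ Var 1) \<^bold>* (Var 0 \<^bold>+ Var 1 \<^bold>+ \<^bold>1) \<^bold>+ \<^bold>2 \<^bold>* Var 0 \<^bold>+ \<^bold>2,
    \<^bold>\<langle>Var 0, Var 1\<^bold>\<rangle> \<^bold>= \<^bold>\<langle>Var 2, Var 3\<^bold>\<rangle> \<^bold>\<longrightarrow> Var 0 \<^bold>= Var 2 \<^bold>\<and> Var 1 \<^bold>= Var 3,
    \<comment> \<open>under the two quantifiers \<open>z\<close> is \<open>Var 2\<close>, \<open>x\<close> is \<open>Var 1\<close> and \<open>y\<close> is \<open>Var 0\<close>\<close>
    \<^bold>0 \<^bold>< Var 0 \<^bold>\<longrightarrow> ExLess (Var 0) (ExLess (Var 1) (\<^bold>\<langle>Var 1, Var 0\<^bold>\<rangle> \<^bold>= Var 2)),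
    Head \<^bold>\<langle>Var 0, Var 1\<^bold>\<rangle> \<^bold>= Var 0,
    Head \<^bold>0 \<^bold>= \<^bold>0,
    Tail \<^bold>\<langle>Var 0, Var 1\<^bold>\<rangle> \<^bold>= Var 1,
    Tail \<^bold>0 \<^bold>= \<^bold>0}"

definition BASIC :: "fm set" where
  "BASIC = ucl ` BASIC_matrices"

definition IND :: fm where
  "IND = ucl (\<^bold>0 \<^bold>\<in> 0 \<^bold>\<and> AllN (Var 0 \<^bold>\<in> 0 \<^bold>\<longrightarrow> Succ (Var 0) \<^bold>\<in> 0) \<^bold>\<longrightarrow> Var 0 \<^bold>\<in> 0)"

text \<open>
  In the comprehension scheme the element variable \<open>x\<close> is number variable 0 of \<open>\<phi>\<close>; lifting the
  set variables of \<open>\<phi>\<close> expresses that the new set is not free in it.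
\<close>

definition Compr :: "fm \<Rightarrow> fm" where
  "Compr \<phi> = ucl (ExS (AllN (Var 0 \<^bold>\<in> 0 \<^bold>\<longleftrightarrow> liftS \<phi>)))"

definition CDelta00 :: "fm set" where
  "CDelta00 = BASIC \<union> {IND} \<union> Compr ` {\<phi>. delta00 \<phi>}"

definition is_fun :: "nat \<Rightarrow> fm" where
  "is_fun f =
     AllN (ExN (\<^bold>\<langle>Var 1, Var 0\<^bold>\<rangle> \<^bold>\<in> f)) \<^bold>\<and>
     AllN (AllN (AllN (\<^bold>\<langle>Var 2, Var 1\<^bold>\<rangle> \<^bold>\<in> f \<^bold>\<and> \<^bold>\<langle>Var 2, Var 0\<^bold>\<rangle> \<^bold>\<in> f \<^bold>\<longrightarrow> Var 1 \<^bold>= Var 0))) \<^bold>\<and>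
     \<^bold>\<not> \<^bold>0 \<^bold>\<in> f"

text \<open>
  Innermost, the sets \<open>g, h, f\<close> are set variables 2, 1, 0 and \<open>x, y, z\<close> are number variables
  2, 1, 0.
\<close>

definition Comp_ax :: fm where
  "Comp_ax = AllS (AllS (is_fun 1 \<^bold>\<and> is_fun 0 \<^bold>\<longrightarrow> ExS (is_fun 0 \<^bold>\<and>
     AllN (AllN (AllN (\<^bold>\<langle>Var 2, Var 0\<^bold>\<rangle> \<^bold>\<in> 1 \<^bold>\<and> \<^bold>\<langle>Var 0, Var 1\<^bold>\<rangle> \<^bold>\<in> 2 \<^bold>\<longrightarrow>
       \<^bold>\<langle>Var 2, Var 1\<^bold>\<rangle> \<^bold>\<in> 0))))))"

definition RCA0m :: "fm set" where
  "RCA0m = CDelta00 \<union> {Comp_ax}"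


section \<open>Exponentiation, trees and \<open>WKL\<^sub>0\<^sup>-\<close>\<close>

text \<open>
  A formula \<open>E\<close> with number variables 0 and 1 (for \<open>x\<close> and \<open>y\<close>) serves as \<open>2\<^sup>x \<doteq> y\<close>;
  \<open>expf E s t\<close> is its instance \<open>2\<^sup>s \<doteq> t\<close>.
\<close>

definition expf :: "fm \<Rightarrow> tm \<Rightarrow> tm \<Rightarrow> fm" where
  "expf E s t = subst (case_nat s (\<lambda>_. t)) id E"

text \<open>
  \<open>E\<close> is a bounded formula without set variables for which the recurrences
  \<open>2\<^sup>0 \<doteq> y \<leftrightarrow> y = 1\<close> and \<open>2\<^sup>S\<^sup>(\<^sup>x\<^sup>) \<doteq> y \<leftrightarrow> \<exists>z \<le> y (2\<^sup>x \<doteq> z \<and> y = 2 \<cdot> z)\<close> are provable by bounded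
  induction, i.e. from \<open>CDelta00\<close>. Such a formula defines the graph of exponentiation in the
  standard model, and bounded induction proves any two of them equivalent.
\<close>

definition exp_formula :: "fm \<Rightarrow> bool" where
  "exp_formula E \<longleftrightarrow>
     delta00 E \<and> sbound E = 0 \<and> nbound E \<le> 2 \<and>
     (CDelta00 \<turnstile> AllN (expf E \<^bold>0 (Var 0) \<^bold>\<longleftrightarrow> Var 0 \<^bold>= \<^bold>1)) \<and>
     (CDelta00 \<turnstile> AllN (AllN (expf E (Succ (Var 1)) (Var 0) \<^bold>\<longleftrightarrow>
        ExLe (Var 0) (expf E (Var 2) (Var 0) \<^bold>\<and> Var 1 \<^bold>= \<^bold>2 \<^bold>* Var 0))))"

text \<open>
  \<open>init_seg E s t\<close> is \<open>\<exists>p \<le> t \<exists>y \<le> t \<exists>x < p (2\<^sup>y \<doteq> p \<and> t = s \<cdot> p + x)\<close>; innermost, \<open>p, y, x\<close> are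
  number variables 2, 1, 0. It needs no side condition \<open>s, t > 0\<close>: from
  \<open>s \<cdot> p + x = t \<ge> p > x\<close> it follows that \<open>s\<close> and \<open>t\<close> are positive.
\<close>

definition init_seg :: "fm \<Rightarrow> tm \<Rightarrow> tm \<Rightarrow> fm" where
  "init_seg E s t =
     ExLe t (ExLe (tlift t) (ExLess (Var 1)
       (expf E (Var 1) (Var 2) \<^bold>\<and>
        tlift (tlift (tlift t)) \<^bold>= tlift (tlift (tlift s)) \<^bold>* Var 2 \<^bold>+ Var 0)))"

definition proper_init_seg :: "fm \<Rightarrow> tm \<Rightarrow> tm \<Rightarrow> fm" where
  "proper_init_seg E s t = (init_seg E s t \<^bold>\<and> s \<^bold>< t)"

definition is_tree :: "fm \<Rightarrow> nat \<Rightarrow> fm" where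
  "is_tree E T =
     (\<^bold>\<not> \<^bold>0 \<^bold>\<in> T \<^bold>\<and>
      AllN (Var 0 \<^bold>\<in> T \<^bold>\<longrightarrow> AllN (proper_init_seg E (Var 0) (Var 1) \<^bold>\<longrightarrow> Var 0 \<^bold>\<in> T)))"

definition unbounded :: "nat \<Rightarrow> fm" where
  "unbounded T = \<^bold>\<not> ExN (AllN (Var 0 \<^bold>\<in> T \<^bold>\<longrightarrow> Var 0 \<^bold>< Var 1))"

definition is_branch :: "fm \<Rightarrow> nat \<Rightarrow> fm" where
  "is_branch E P =
     (is_tree E P \<^bold>\<and>
      AllN (AllN (Var 1 \<^bold>\<in> P \<^bold>\<and> Var 0 \<^bold>\<in> P \<^bold>\<longrightarrow>
        init_seg E (Var 1) (Var 0) \<^bold>\<or> init_seg E (Var 0) (Var 1))))"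

definition subset_fm :: "nat \<Rightarrow> nat \<Rightarrow> fm" where
  "subset_fm P T = AllN (Var 0 \<^bold>\<in> P \<^bold>\<longrightarrow> Var 0 \<^bold>\<in> T)"

definition WKL :: "fm \<Rightarrow> fm" where
  "WKL E = AllS (is_tree E 0 \<^bold>\<and> unbounded 0 \<^bold>\<longrightarrow>
     ExS (is_tree E 0 \<^bold>\<and> unbounded 0 \<^bold>\<and> is_branch E 0 \<^bold>\<and> subset_fm 0 1))"

definition WKL0m :: "fm \<Rightarrow> fm set" where
  "WKL0m E = RCA0m \<union> {WKL E}"


section \<open>Conservativity\<close>

definition Pi11_conservative :: "fm set \<Rightarrow> fm set \<Rightarrow> bool" where
  "Pi11_conservative T' T \<longleftrightarrow> (\<forall>\<psi>. Pi11_sentence \<psi> \<longrightarrow> T' \<turnstile> \<psi> \<longrightarrow> T \<turnstile> \<psi>)"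

end

theory Submission
  imports Defs "HOL-Library.Countable_Set"
begin

text \<open>
  If \<open>RCA\<^sub>0\<^sup>-\<close> does not prove \<open>\<forall>X \<phi>(X)\<close>, the completeness theorem gives a countable
  model \<open>(M, S)\<close> of \<open>RCA\<^sub>0\<^sup>-\<close> with some \<open>X \<in> S\<close> that violates \<open>\<phi>\<close>. As \<open>\<phi>\<close> has no set
  quantifiers, it suffices to enlarge \<open>S\<close> to a model of \<open>WKL\<^sub>0\<^sup>-\<close> with the same numbers, and
  iterating \<open>\<omega> \<cdot> \<omega>\<close> times reduces this to adding a branch to one unbounded tree. The composition
  axiom yields \<open>\<Delta>\<^sup>0\<^sub>1\<close> comprehension and with it the bounding principle. A branch \<open>G\<close> generic for
  forcing with unbounded trees in \<open>S\<close> has the property that every function computed from \<open>G\<close> is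
  bounded by a function in \<open>S\<close>. Since a bounded formula about \<open>G\<close> depends only on one, sufficiently
  long initial segment of \<open>G\<close>, which is an element of \<open>M\<close>, the sets
  \<open>{x. (x, G \<restriction> f(x)) \<in> A}\<close> with \<open>f, A \<in> S\<close> again form a model of \<open>RCA\<^sub>0\<^sup>-\<close>. Exponentiation
  need not be total, because the initial segments of a branch are already coded by numbers.
\<close>


section \<open>Substitution\<close>

text \<open>Two obstacles shape the construction. First, induction is available only for sets in
  \<open>S\<close>, so no search along the branch may be left without a bound from the ground model.
  Each set therefore undergoes a dichotomy: either, for some \<open>x\<close>, the nodes without a
  witness for \<open>x\<close> still form an unbounded tree, to which one may pass; or for every
  \<open>x\<close> that subtree is bounded, and then a level by which all nodes have met a witness
  can be chosen by minimisation, as a function \<open>u\<close> of the ground model. This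
  \<open>u\<close> bounds the search along the branch, in particular the search for the intermediate
  value of a composition. Second, lengths of sequences may fill only an initial part of the model
  when exponentiation is not total, so they cannot serve as bounds. Nodes are compared with an
  arbitrary number \<open>v\<close> instead: the interval from \<open>v + 1\<close> to
  \<open>2 v + 1\<close> meets each longer sequence in exactly one initial segment and exists for
  every \<open>v\<close>, and the bounding principle applies to it.\<close>

lemma tsubst_tsubst: "tsubst \<sigma> (tsubst \<tau> t) = tsubst (\<lambda>i. tsubst \<sigma> (\<tau> i)) t"
  by (induction t) auto

lemma tsubst_Var [simp]: "tsubst Var t = t"
  by (induction t) auto

lemma tsubst_tlift: "tsubst \<sigma> (tlift t) = tsubst (\<lambda>i. \<sigma> (Suc i)) t"
  by (simp add: tlift_def tsubst_tsubst)

lemma tlift_tsubst: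
  "tsubst (case_nat (Var 0) (\<lambda>i. tlift (\<sigma> i))) (tlift t) = tlift (tsubst \<sigma> t)"
  by (simp add: tlift_def tsubst_tsubst)

lemma tsubst_inst_tlift [simp]: "tsubst (case_nat u Var) (tlift t) = t"
  by (simp add: tsubst_tlift)

lemma tlift_simps [simp]:
  "tlift (Var i) = Var (Suc i)" "tlift \<^bold>0 = \<^bold>0" "tlift (Succ t) = Succ (tlift t)"
  "tlift (Head t) = Head (tlift t)" "tlift (Tail t) = Tail (tlift t)"
  "tlift (t \<^bold>+ u) = tlift t \<^bold>+ tlift u" "tlift (t \<^bold>* u) = tlift t \<^bold>* tlift u"
  "tlift \<^bold>\<langle>t, u\<^bold>\<rangle> = \<^bold>\<langle>tlift t, tlift u\<^bold>\<rangle>"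
  by (simp_all add: tlift_def)

lemma subst_subst:
  "subst \<sigma> \<rho> (subst \<tau> \<rho>' \<phi>) = subst (\<lambda>i. tsubst \<sigma> (\<tau> i)) (\<lambda>i. \<rho> (\<rho>' i)) \<phi>"
proof (induction \<phi> arbitrary: \<sigma> \<rho> \<tau> \<rho>')
  case (AllN \<phi>)
  have "(\<lambda>i. tsubst (case_nat (Var 0) (\<lambda>i. tlift (\<sigma> i)))
          (case i of 0 \<Rightarrow> Var 0 | Suc i \<Rightarrow> tlift (\<tau> i))) =
        case_nat (Var 0) (\<lambda>i. tlift (tsubst \<sigma> (\<tau> i)))"
    by (auto simp: fun_eq_iff tlift_tsubst split: nat.split)
  then show ?case using AllN by simp
next
  case (ExN \<phi>)
  have "(\<lambda>i. tsubst (case_nat (Var 0) (\<lambda>i. tlift (\<sigma> i)))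
          (case i of 0 \<Rightarrow> Var 0 | Suc i \<Rightarrow> tlift (\<tau> i))) =
        case_nat (Var 0) (\<lambda>i. tlift (tsubst \<sigma> (\<tau> i)))"
    by (auto simp: fun_eq_iff tlift_tsubst split: nat.split)
  then show ?case using ExN by simp
next
  case (AllS \<phi>)
  have "(\<lambda>i. case_nat 0 (\<lambda>i. Suc (\<rho> i)) (case i of 0 \<Rightarrow> 0 | Suc i \<Rightarrow> Suc (\<rho>' i))) =
        case_nat 0 (\<lambda>i. Suc (\<rho> (\<rho>' i)))"
    by (auto simp: fun_eq_iff split: nat.split)
  then show ?case using AllS by simp
next
  case (ExS \<phi>)
  have "(\<lambda>i. case_nat 0 (\<lambda>i. Suc (\<rho> i)) (case i of 0 \<Rightarrow> 0 | Suc i \<Rightarrow> Suc (\<rho>' i))) =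
        case_nat 0 (\<lambda>i. Suc (\<rho> (\<rho>' i)))"
    by (auto simp: fun_eq_iff split: nat.split)
  then show ?case using ExS by simp
qed (simp_all add: tsubst_tsubst)

lemma tsubst_cong: "(\<And>i. i < tbound t \<Longrightarrow> \<sigma> i = \<tau> i) \<Longrightarrow> tsubst \<sigma> t = tsubst \<tau> t"
  by (induction t) auto

lemma subst_cong:
  assumes "\<And>i. i < nbound \<phi> \<Longrightarrow> \<sigma> i = \<tau> i" "\<And>i. i < sbound \<phi> \<Longrightarrow> \<rho> i = \<rho>' i"
  shows "subst \<sigma> \<rho> \<phi> = subst \<tau> \<rho>' \<phi>"
  using assms
proof (induction \<phi> arbitrary: \<sigma> \<tau> \<rho> \<rho>')
  case (AllN \<phi>)
  show ?case
    using AllN.prems by (auto intro!: AllN.IH split: nat.split)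
next
  case (ExN \<phi>)
  show ?case
    using ExN.prems by (auto intro!: ExN.IH split: nat.split)
next
  case (AllS \<phi>)
  show ?case
    using AllS.prems by (auto intro!: AllS.IH split: nat.split)
next
  case (ExS \<phi>)
  show ?case
    using ExS.prems by (auto intro!: ExS.IH split: nat.split)
next
  case (Imp \<phi> \<psi>)
  show ?case unfolding subst.simps
    using Imp.prems by (intro arg_cong2[where f = Imp] Imp.IH) auto
next
  case (And \<phi> \<psi>)
  show ?case unfolding subst.simps
    using And.prems by (intro arg_cong2[where f = And] And.IH) auto
next
  case (Or \<phi> \<psi>)
  show ?case unfolding subst.simps
    using Or.prems by (intro arg_cong2[where f = Or] Or.IH) auto
qed (auto intro: tsubst_cong)

lemma subst_Var [simp]: "subst Var id \<phi> = \<phi>" "subst Var (\<lambda>i. i) \<phi> = \<phi>"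
proof -
  have "case_nat (Var 0) (\<lambda>i. Var (Suc i)) = Var" "case_nat 0 Suc = id"
    by (auto simp: fun_eq_iff split: nat.split)
  then show "subst Var id \<phi> = \<phi>" by (induction \<phi>) auto
  then show "subst Var (\<lambda>i. i) \<phi> = \<phi>" by (simp add: id_def)
qed

lemma subst_liftN:
  "subst (case_nat (Var 0) (\<lambda>i. tlift (\<sigma> i))) \<rho> (liftN \<phi>) = liftN (subst \<sigma> \<rho> \<phi>)"
  by (simp add: liftN_def subst_subst tlift_def)

lemma subst_liftS:
  "subst \<sigma> (case_nat 0 (\<lambda>i. Suc (\<rho> i))) (liftS \<phi>) = liftS (subst \<sigma> \<rho> \<phi>)"
  by (simp add: liftS_def subst_subst)

lemma subst_instN:
  "subst \<sigma> \<rho> (instN t \<phi>) =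
   instN (tsubst \<sigma> t) (subst (case_nat (Var 0) (\<lambda>i. tlift (\<sigma> i))) \<rho> \<phi>)"
proof -
  have "(\<lambda>i. tsubst \<sigma> (case i of 0 \<Rightarrow> t | Suc x \<Rightarrow> Var x)) =
    (\<lambda>i. tsubst (case_nat (tsubst \<sigma> t) Var) (case i of 0 \<Rightarrow> Var 0 | Suc i \<Rightarrow> tlift (\<sigma> i)))"
    by (auto simp: fun_eq_iff split: nat.split)
  then show ?thesis by (simp add: instN_def subst_subst)
qed

lemma subst_instS:
  "subst \<sigma> \<rho> (instS X \<phi>) = instS (\<rho> X) (subst \<sigma> (case_nat 0 (\<lambda>i. Suc (\<rho> i))) \<phi>)"
proof -
  have "(\<lambda>i. \<rho> (case i of 0 \<Rightarrow> X | Suc x \<Rightarrow> id x)) =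
    (\<lambda>i. case case i of 0 \<Rightarrow> 0 | Suc i \<Rightarrow> Suc (\<rho> i) of 0 \<Rightarrow> \<rho> X | Suc x \<Rightarrow> id x)"
    by (auto simp: fun_eq_iff split: nat.split)
  then show ?thesis by (simp add: instS_def subst_subst)
qed

lemma delta00_subst: "delta00 \<phi> \<Longrightarrow> delta00 (subst \<sigma> \<rho> \<phi>)"
  by (induction arbitrary: \<sigma> \<rho> rule: delta00.induct)
    (auto simp: tlift_tsubst intro: delta00.intros)

section \<open>Structural properties of derivability\<close>

lemma proves_subst: "\<Gamma> \<turnstile> \<phi> \<Longrightarrow> subst \<sigma> \<rho> ` \<Gamma> \<turnstile> subst \<sigma> \<rho> \<phi>"
proof (induction arbitrary: \<sigma> \<rho> rule: proves.induct)
  case (AllNI \<Gamma> \<phi>)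
  from AllNI.IH[of "case_nat (Var 0) (\<lambda>i. tlift (\<sigma> i))" \<rho>]
  show ?case by (auto intro: proves.AllNI simp: image_image subst_liftN)
next
  case (ExNE \<Gamma> \<phi> \<chi>)
  from ExNE.IH(2)[of "case_nat (Var 0) (\<lambda>i. tlift (\<sigma> i))" \<rho>] ExNE.IH(1)[of \<sigma> \<rho>]
  show ?case
    by (auto intro!: proves.ExNE[where \<chi> = "subst \<sigma> \<rho> \<chi>"] simp: image_image subst_liftN)
next
  case (AllSI \<Gamma> \<phi>)
  from AllSI.IH[of \<sigma> "case_nat 0 (\<lambda>i. Suc (\<rho> i))"]
  show ?case by (auto intro: proves.AllSI simp: image_image subst_liftS)
next
  case (ExSE \<Gamma> \<phi> \<chi>)
  from ExSE.IH(2)[of \<sigma> "case_nat 0 (\<lambda>i. Suc (\<rho> i))"] ExSE.IH(1)[of \<sigma> \<rho>]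
  show ?case
    by (auto intro!: proves.ExSE[where \<chi> = "subst \<sigma> \<rho> \<chi>"] simp: image_image subst_liftS)
next
  case (ExNI \<Gamma> t \<phi>)
  then show ?case by (auto simp: subst_instN intro: proves.ExNI)
next
  case (ExSI \<Gamma> t \<phi>)
  then show ?case by (auto simp: subst_instS intro: proves.ExSI)
next
  case (AllNE \<Gamma> \<phi> t)
  then show ?case by (auto simp: subst_instN intro: proves.AllNE)
next
  case (AllSE \<Gamma> \<phi> t)
  then show ?case by (auto simp: subst_instS intro: proves.AllSE)
next
  case (EqSubst \<Gamma> s t \<phi>)
  show ?case
    using proves.EqSubst[OF EqSubst.IH(1)[unfolded subst.simps] EqSubst.IH(2)[unfolded subst_instN]]
    by (simp add: subst_instN)
next
  case (OrE \<Gamma> \<phi> \<psi> \<chi>)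
  show ?case
    using proves.OrE[OF OrE.IH(1)[unfolded subst.simps] OrE.IH(2,3)[unfolded image_insert]] .
next
  case (ImpE \<Gamma> \<phi> \<psi>)
  show ?case using proves.ImpE[OF ImpE.IH(1)[unfolded subst.simps] ImpE.IH(2)] .
qed (auto intro: proves.intros)

lemma proves_weaken: "\<Gamma> \<turnstile> \<phi> \<Longrightarrow> \<Gamma> \<subseteq> \<Delta> \<Longrightarrow> \<Delta> \<turnstile> \<phi>"
proof (induction arbitrary: \<Delta> rule: proves.induct)
  case (Assm \<phi> \<Gamma>)
  then show ?case by (meson proves.Assm subsetD)
next
  case (ImpI \<phi> \<Gamma> \<psi>)
  then show ?case by (meson insert_mono proves.ImpI)
next
  case (Contr \<phi> \<Gamma>)
  then show ?case by (meson insert_mono proves.Contr)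
next
  case (OrE \<Gamma> \<phi> \<psi> \<chi>)
  then show ?case by (meson insert_mono proves.OrE)
next
  case (AllNI \<Gamma> \<phi>)
  then show ?case by (meson image_mono proves.AllNI)
next
  case (AllSI \<Gamma> \<phi>)
  then show ?case by (meson image_mono proves.AllSI)
next
  case (ExNE \<Gamma> \<phi> \<chi>)
  then show ?case by (meson image_mono insert_mono proves.ExNE)
next
  case (ExSE \<Gamma> \<phi> \<chi>)
  then show ?case by (meson image_mono insert_mono proves.ExSE)
next
  case (ImpE \<Gamma> \<phi> \<psi>)
  then show ?case by (meson proves.ImpE)
next
  case (AndI \<Gamma> \<phi> \<psi>)
  then show ?case by (meson proves.AndI)
next
  case (AndE1 \<Gamma> \<phi> \<psi>)
  then show ?case by (meson proves.AndE1)
next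
  case (AndE2 \<Gamma> \<phi> \<psi>)
  then show ?case by (meson proves.AndE2)
next
  case (OrI1 \<Gamma> \<phi> \<psi>)
  then show ?case by (meson proves.OrI1)
next
  case (OrI2 \<Gamma> \<psi> \<phi>)
  then show ?case by (meson proves.OrI2)
next
  case (AllNE \<Gamma> \<phi> t)
  then show ?case by (meson proves.AllNE)
next
  case (AllSE \<Gamma> \<phi> X)
  then show ?case by (meson proves.AllSE)
next
  case (ExNI \<Gamma> t \<phi>)
  then show ?case by (meson proves.ExNI)
next
  case (ExSI \<Gamma> X \<phi>)
  then show ?case by (meson proves.ExSI)
next
  case (EqRefl \<Gamma> t)
  then show ?case by (meson proves.EqRefl)
next
  case (EqSubst \<Gamma> s t \<phi>)
  then show ?case by (meson proves.EqSubst)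
qed

lemma finite_subset_insert_split:
  assumes "finite A" "A \<subseteq> insert x B"
  shows "\<exists>C. finite C \<and> C \<subseteq> B \<and> A \<subseteq> insert x C"
  using assms by (intro exI[of _ "A - {x}"]) auto

text \<open>Every rule has finitely many premises, so the finitely many assumptions used in each can
  be united. This pulls a contradiction in the union of the Henkin chain back to a single
  stage.\<close>

lemma proves_finite: "\<Gamma> \<turnstile> \<phi> \<Longrightarrow> \<exists>\<Delta>. finite \<Delta> \<and> \<Delta> \<subseteq> \<Gamma> \<and> \<Delta> \<turnstile> \<phi>"
proof (induction rule: proves.induct)
  case (Assm \<phi> \<Gamma>)
  then show ?case by (intro exI[of _ "{\<phi>}"]) (auto intro: proves.Assm)
next
  case (ImpI \<phi> \<Gamma> \<psi>)
  then obtain \<Delta> where "finite \<Delta>" "\<Delta> \<subseteq> insert \<phi> \<Gamma>" "\<Delta> \<turnstile> \<psi>" by auto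
  moreover from finite_subset_insert_split[OF this(1,2)] obtain C where "finite C" "C \<subseteq> \<Gamma>" "\<Delta> \<subseteq> insert \<phi> C"
    by blast
  ultimately show ?case by (meson proves.ImpI proves_weaken)
next
  case (Contr \<phi> \<Gamma>)
  then obtain \<Delta> where "finite \<Delta>" "\<Delta> \<subseteq> insert (\<^bold>\<not> \<phi>) \<Gamma>" "\<Delta> \<turnstile> \<^bold>\<bottom>" by auto
  moreover from finite_subset_insert_split[OF this(1,2)] obtain C where "finite C" "C \<subseteq> \<Gamma>" "\<Delta> \<subseteq> insert (\<^bold>\<not> \<phi>) C"
    by blast
  ultimately show ?case by (meson proves.Contr proves_weaken)
next
  case (ImpE \<Gamma> \<phi> \<psi>)
  then obtain A B where "finite A" "A \<subseteq> \<Gamma>" "A \<turnstile> \<phi> \<^bold>\<longrightarrow> \<psi>" "finite B" "B \<subseteq> \<Gamma>" "B \<turnstile> \<phi>" by auto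
  then show ?case
    by (intro exI[of _ "A \<union> B"]) (auto intro: proves.ImpE elim: proves_weaken)
next
  case (AndI \<Gamma> \<phi> \<psi>)
  then obtain A B where "finite A" "A \<subseteq> \<Gamma>" "A \<turnstile> \<phi>" "finite B" "B \<subseteq> \<Gamma>" "B \<turnstile> \<psi>" by auto
  then show ?case
    by (intro exI[of _ "A \<union> B"]) (auto intro!: proves.AndI elim: proves_weaken)
next
  case (OrE \<Gamma> \<phi> \<psi> \<chi>)
  then obtain A B C where *: "finite A" "A \<subseteq> \<Gamma>" "A \<turnstile> \<phi> \<^bold>\<or> \<psi>"
    "finite B" "B \<subseteq> insert \<phi> \<Gamma>" "B \<turnstile> \<chi>" "finite C" "C \<subseteq> insert \<psi> \<Gamma>" "C \<turnstile> \<chi>" by auto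
  obtain B' where B': "finite B'" "B' \<subseteq> \<Gamma>" "B \<subseteq> insert \<phi> B'"
    using finite_subset_insert_split[OF *(4,5)] by blast
  obtain C' where C': "finite C'" "C' \<subseteq> \<Gamma>" "C \<subseteq> insert \<psi> C'"
    using finite_subset_insert_split[OF *(7,8)] by blast
  have "A \<union> B' \<union> C' \<turnstile> \<chi>"
  proof (rule proves.OrE)
    show "A \<union> B' \<union> C' \<turnstile> \<phi> \<^bold>\<or> \<psi>" using *(3) by (rule proves_weaken) auto
    show "insert \<phi> (A \<union> B' \<union> C') \<turnstile> \<chi>" using *(6) by (rule proves_weaken) (use B' in auto)
    show "insert \<psi> (A \<union> B' \<union> C') \<turnstile> \<chi>" using *(9) by (rule proves_weaken) (use C' in auto)
  qed
  then show ?case using * B' C' by (intro exI[of _ "A \<union> B' \<union> C'"]) auto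
next
  case (AllNI \<Gamma> \<phi>)
  then obtain \<Delta> where "finite \<Delta>" "\<Delta> \<subseteq> liftN ` \<Gamma>" "\<Delta> \<turnstile> \<phi>" by blast
  moreover from finite_subset_image[OF this(1,2)] obtain C
    where "C \<subseteq> \<Gamma>" "finite C" "\<Delta> = liftN ` C" by blast
  ultimately show ?case by (auto intro: proves.AllNI)
next
  case (AllSI \<Gamma> \<phi>)
  then obtain \<Delta> where "finite \<Delta>" "\<Delta> \<subseteq> liftS ` \<Gamma>" "\<Delta> \<turnstile> \<phi>" by blast
  moreover from finite_subset_image[OF this(1,2)] obtain C
    where "C \<subseteq> \<Gamma>" "finite C" "\<Delta> = liftS ` C" by blast
  ultimately show ?case by (auto intro: proves.AllSI)
next
  case (ExNE \<Gamma> \<phi> \<chi>)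
  then obtain A B where *: "finite A" "A \<subseteq> \<Gamma>" "A \<turnstile> ExN \<phi>"
    "finite B" "B \<subseteq> insert \<phi> (liftN ` \<Gamma>)" "B \<turnstile> liftN \<chi>" by auto
  obtain B' where B': "finite B'" "B' \<subseteq> liftN ` \<Gamma>" "B \<subseteq> insert \<phi> B'"
    using finite_subset_insert_split[OF *(4,5)] by blast
  then obtain C where C: "finite C" "C \<subseteq> \<Gamma>" "B' = liftN ` C"
    by (meson finite_subset_image)
  have "A \<union> C \<turnstile> \<chi>"
  proof (rule proves.ExNE)
    show "A \<union> C \<turnstile> ExN \<phi>" using *(3) by (rule proves_weaken) auto
    show "insert \<phi> (liftN ` (A \<union> C)) \<turnstile> liftN \<chi>"
      using *(6) by (rule proves_weaken) (use B' C in auto)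
  qed
  then show ?case using * C by (intro exI[of _ "A \<union> C"]) auto
next
  case (ExSE \<Gamma> \<phi> \<chi>)
  then obtain A B where *: "finite A" "A \<subseteq> \<Gamma>" "A \<turnstile> ExS \<phi>"
    "finite B" "B \<subseteq> insert \<phi> (liftS ` \<Gamma>)" "B \<turnstile> liftS \<chi>" by auto
  obtain B' where B': "finite B'" "B' \<subseteq> liftS ` \<Gamma>" "B \<subseteq> insert \<phi> B'"
    using finite_subset_insert_split[OF *(4,5)] by blast
  then obtain C where C: "finite C" "C \<subseteq> \<Gamma>" "B' = liftS ` C"
    by (meson finite_subset_image)
  have "A \<union> C \<turnstile> \<chi>"
  proof (rule proves.ExSE)
    show "A \<union> C \<turnstile> ExS \<phi>" using *(3) by (rule proves_weaken) auto
    show "insert \<phi> (liftS ` (A \<union> C)) \<turnstile> liftS \<chi>"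
      using *(6) by (rule proves_weaken) (use B' C in auto)
  qed
  then show ?case using * C by (intro exI[of _ "A \<union> C"]) auto
next
  case (EqSubst \<Gamma> s t \<phi>)
  then obtain A B where "finite A" "A \<subseteq> \<Gamma>" "A \<turnstile> s \<^bold>= t" "finite B" "B \<subseteq> \<Gamma>" "B \<turnstile> instN s \<phi>" by auto
  then show ?case
    by (intro exI[of _ "A \<union> B"]) (auto intro: proves.EqSubst elim: proves_weaken)
next
  case (EqRefl \<Gamma> t)
  then show ?case using proves.EqRefl by blast
qed (use proves.intros in meson)+


section \<open>Semantics\<close>

text \<open>There is no carrier: the numbers of a structure are all of \<open>'m\<close>. This
  spares relativised quantifiers, at the price that the term model has to be moved onto
  \<open>nat\<close> by a bijection.\<close>

record 'm interp =
  iZ :: 'm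
  iS :: "'m \<Rightarrow> 'm"
  iH :: "'m \<Rightarrow> 'm"
  iT :: "'m \<Rightarrow> 'm"
  iA :: "'m \<Rightarrow> 'm \<Rightarrow> 'm"
  iM :: "'m \<Rightarrow> 'm \<Rightarrow> 'm"
  iP :: "'m \<Rightarrow> 'm \<Rightarrow> 'm"
  iL :: "'m \<Rightarrow> 'm \<Rightarrow> bool"

primrec tval :: "'m interp \<Rightarrow> (nat \<Rightarrow> 'm) \<Rightarrow> tm \<Rightarrow> 'm" where
  "tval M e (Var i) = e i"
| "tval M e \<^bold>0 = iZ M"
| "tval M e (Succ t) = iS M (tval M e t)"
| "tval M e (Head t) = iH M (tval M e t)"
| "tval M e (Tail t) = iT M (tval M e t)"
| "tval M e (s \<^bold>+ t) = iA M (tval M e s) (tval M e t)"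
| "tval M e (s \<^bold>* t) = iM M (tval M e s) (tval M e t)"
| "tval M e \<^bold>\<langle>s, t\<^bold>\<rangle> = iP M (tval M e s) (tval M e t)"

primrec sat :: "'m interp \<Rightarrow> 'm set set \<Rightarrow> (nat \<Rightarrow> 'm) \<Rightarrow> (nat \<Rightarrow> 'm set) \<Rightarrow> fm \<Rightarrow> bool" where
  "sat M S e s (t \<^bold>= u) \<longleftrightarrow> tval M e t = tval M e u"
| "sat M S e s (t \<^bold>< u) \<longleftrightarrow> iL M (tval M e t) (tval M e u)"
| "sat M S e s (t \<^bold>\<in> X) \<longleftrightarrow> tval M e t \<in> s X"
| "sat M S e s \<^bold>\<bottom> \<longleftrightarrow> False"
| "sat M S e s (\<phi> \<^bold>\<longrightarrow> \<psi>) \<longleftrightarrow> (sat M S e s \<phi> \<longrightarrow> sat M S e s \<psi>)"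
| "sat M S e s (\<phi> \<^bold>\<and> \<psi>) \<longleftrightarrow> (sat M S e s \<phi> \<and> sat M S e s \<psi>)"
| "sat M S e s (\<phi> \<^bold>\<or> \<psi>) \<longleftrightarrow> (sat M S e s \<phi> \<or> sat M S e s \<psi>)"
| "sat M S e s (AllN \<phi>) \<longleftrightarrow> (\<forall>x. sat M S (case_nat x e) s \<phi>)"
| "sat M S e s (ExN \<phi>) \<longleftrightarrow> (\<exists>x. sat M S (case_nat x e) s \<phi>)"
| "sat M S e s (AllS \<phi>) \<longleftrightarrow> (\<forall>X\<in>S. sat M S e (case_nat X s) \<phi>)"
| "sat M S e s (ExS \<phi>) \<longleftrightarrow> (\<exists>X\<in>S. sat M S e (case_nat X s) \<phi>)"

definition valid :: "'m interp \<Rightarrow> 'm set set \<Rightarrow> fm \<Rightarrow> bool" where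
  "valid M S \<phi> \<longleftrightarrow> (\<forall>e s. range s \<subseteq> S \<longrightarrow> sat M S e s \<phi>)"

lemma tval_tsubst: "tval M e (tsubst \<sigma> t) = tval M (\<lambda>i. tval M e (\<sigma> i)) t"
  by (induction t) auto

lemma tval_tlift [simp]: "tval M e (tlift t) = tval M (\<lambda>i. e (Suc i)) t"
  by (simp add: tlift_def tval_tsubst)

lemma sat_subst:
  "sat M S e s (subst \<sigma> \<rho> \<phi>) \<longleftrightarrow> sat M S (\<lambda>i. tval M e (\<sigma> i)) (\<lambda>i. s (\<rho> i)) \<phi>"
proof (induction \<phi> arbitrary: e s \<sigma> \<rho>)
  case (AllN \<phi>)
  have "(\<lambda>i. tval M (case_nat x e) (case i of 0 \<Rightarrow> Var 0 | Suc i \<Rightarrow> tlift (\<sigma> i))) =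
      case_nat x (\<lambda>i. tval M e (\<sigma> i))" for x
    by (auto simp: fun_eq_iff split: nat.split)
  then show ?case using AllN by simp
next
  case (ExN \<phi>)
  have "(\<lambda>i. tval M (case_nat x e) (case i of 0 \<Rightarrow> Var 0 | Suc i \<Rightarrow> tlift (\<sigma> i))) =
      case_nat x (\<lambda>i. tval M e (\<sigma> i))" for x
    by (auto simp: fun_eq_iff split: nat.split)
  then show ?case using ExN by simp
next
  case (AllS \<phi>)
  have "(\<lambda>i. case_nat X s (case i of 0 \<Rightarrow> 0 | Suc i \<Rightarrow> Suc (\<rho> i))) =
      case_nat X (\<lambda>i. s (\<rho> i))" for X
    by (auto simp: fun_eq_iff split: nat.split)
  then show ?case using AllS by simp
next
  case (ExS \<phi>)
  have "(\<lambda>i. case_nat X s (case i of 0 \<Rightarrow> 0 | Suc i \<Rightarrow> Suc (\<rho> i))) =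
      case_nat X (\<lambda>i. s (\<rho> i))" for X
    by (auto simp: fun_eq_iff split: nat.split)
  then show ?case using ExS by simp
qed (simp_all add: tval_tsubst)

lemma sat_liftN [simp]: "sat M S e s (liftN \<phi>) \<longleftrightarrow> sat M S (\<lambda>i. e (Suc i)) s \<phi>"
  by (simp add: liftN_def sat_subst)

lemma sat_liftS [simp]: "sat M S e s (liftS \<phi>) \<longleftrightarrow> sat M S e (\<lambda>i. s (Suc i)) \<phi>"
  by (simp add: liftS_def sat_subst)

lemma sat_instN: "sat M S e s (instN t \<phi>) \<longleftrightarrow> sat M S (case_nat (tval M e t) e) s \<phi>"
proof -
  have "(\<lambda>i. tval M e (case i of 0 \<Rightarrow> t | Suc x \<Rightarrow> Var x)) = case_nat (tval M e t) e"
    by (auto simp: fun_eq_iff split: nat.split)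
  then show ?thesis by (simp add: instN_def sat_subst)
qed

lemma sat_instS: "sat M S e s (instS X \<phi>) \<longleftrightarrow> sat M S e (case_nat (s X) s) \<phi>"
proof -
  have "(\<lambda>i. s (case i of 0 \<Rightarrow> X | Suc x \<Rightarrow> id x)) = case_nat (s X) s"
    by (auto simp: fun_eq_iff split: nat.split)
  then show ?thesis by (simp add: instS_def sat_subst)
qed

lemma range_case_nat: "range (case_nat x f) \<subseteq> A \<longleftrightarrow> x \<in> A \<and> range f \<subseteq> A"
proof
  assume *: "range (case_nat x f) \<subseteq> A"
  have "case_nat x f 0 \<in> A" "case_nat x f (Suc i) \<in> A" for i using * by blast+
  then show "x \<in> A \<and> range f \<subseteq> A" by auto
next
  assume "x \<in> A \<and> range f \<subseteq> A"
  then have "case_nat x f i \<in> A" for i by (cases i) auto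
  then show "range (case_nat x f) \<subseteq> A" by blast
qed

theorem soundness:
  assumes "\<Gamma> \<turnstile> \<phi>" "range s \<subseteq> S" "\<And>\<gamma>. \<gamma> \<in> \<Gamma> \<Longrightarrow> sat M S e s \<gamma>"
  shows "sat M S e s \<phi>"
  using assms
proof (induction arbitrary: e s rule: proves.induct)
  case (AllSI \<Gamma> \<phi>)
  have "sat M S e (case_nat X s) \<phi>" if "X \<in> S" for X
    using AllSI.prems that by (intro AllSI.IH) (auto simp only: range_case_nat sat_liftS nat.case)
  then show ?case by simp
next
  case (ExSE \<Gamma> \<phi> \<chi>)
  have "sat M S e s (ExS \<phi>)" using ExSE.prems by (rule ExSE.IH(1))
  then obtain X where X: "X \<in> S" "sat M S e (case_nat X s) \<phi>" by auto
  have "sat M S e (case_nat X s) (liftS \<chi>)"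
    using ExSE.prems X by (intro ExSE.IH(2)) (auto simp only: range_case_nat sat_liftS nat.case)
  then show ?case by simp
next
  case (ExNE \<Gamma> \<phi> \<chi>)
  have "sat M S e s (ExN \<phi>)" using ExNE.prems by (rule ExNE.IH(1))
  then obtain x where x: "sat M S (case_nat x e) s \<phi>" by auto
  have "sat M S (case_nat x e) s (liftN \<chi>)"
    using ExNE.prems x by (intro ExNE.IH(2)) auto
  then show ?case by simp
next
  case (AllNE \<Gamma> \<phi> t)
  then show ?case by (auto simp: sat_instN)
next
  case (ExNI \<Gamma> t \<phi>)
  then show ?case by (auto simp: sat_instN)
next
  case (AllSE \<Gamma> \<phi> X)
  have "sat M S e s (AllS \<phi>)" using AllSE.prems by (rule AllSE.IH)
  moreover have "s X \<in> S" using AllSE.prems by blast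
  ultimately show ?case by (simp add: sat_instS)
next
  case (ExSI \<Gamma> X \<phi>)
  then have "sat M S e (case_nat (s X) s) \<phi>" by (simp add: sat_instS)
  then show ?case using ExSI.prems by auto
next
  case (EqSubst \<Gamma> t u \<phi>)
  then show ?case by (auto simp: sat_instN)
next
  case (OrE \<Gamma> \<phi> \<psi> \<chi>)
  have "sat M S e s \<phi> \<or> sat M S e s \<psi>" using OrE.IH(1) OrE.prems by auto
  then show ?case using OrE.IH(2,3) OrE.prems by blast
next
  case (Contr \<phi> \<Gamma>)
  show ?case
  proof (rule ccontr)
    assume "\<not> sat M S e s \<phi>"
    then have "sat M S e s \<^bold>\<bottom>" using Contr.prems by (intro Contr.IH) auto
    then show False by simp
  qed
next
  case (ImpI \<phi> \<Gamma> \<psi>)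
  have "sat M S e s \<psi>" if "sat M S e s \<phi>"
    using ImpI.prems that by (intro ImpI.IH) auto
  then show ?case by simp
next
  case (AllNI \<Gamma> \<phi>)
  have "sat M S (case_nat x e) s \<phi>" for x
    using AllNI.prems by (intro AllNI.IH) auto
  then show ?case by simp
qed auto

lemma tval_cong: "(\<And>i. i < tbound t \<Longrightarrow> e i = e' i) \<Longrightarrow> tval M e t = tval M e' t"
  by (induction t) auto

lemma sat_cong:
  assumes "\<And>i. i < nbound \<phi> \<Longrightarrow> e i = e' i" "\<And>i. i < sbound \<phi> \<Longrightarrow> s i = s' i"
  shows "sat M S e s \<phi> \<longleftrightarrow> sat M S e' s' \<phi>"
  using assms
proof (induction \<phi> arbitrary: e s e' s')
  case (Eq t u)
  then show ?case using tval_cong[of t e e' M] tval_cong[of u e e' M] by simp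
next
  case (Less t u)
  then show ?case using tval_cong[of t e e' M] tval_cong[of u e e' M] by simp
next
  case (Mem t X)
  then show ?case using tval_cong[of t e e' M] by simp
next
  case (Imp \<phi> \<psi>)
  have "sat M S e s \<phi> \<longleftrightarrow> sat M S e' s' \<phi>" "sat M S e s \<psi> \<longleftrightarrow> sat M S e' s' \<psi>"
    using Imp.prems by (auto intro!: Imp.IH)
  then show ?case by simp
next
  case (And \<phi> \<psi>)
  have "sat M S e s \<phi> \<longleftrightarrow> sat M S e' s' \<phi>" "sat M S e s \<psi> \<longleftrightarrow> sat M S e' s' \<psi>"
    using And.prems by (auto intro!: And.IH)
  then show ?case by simp
next
  case (Or \<phi> \<psi>)
  have "sat M S e s \<phi> \<longleftrightarrow> sat M S e' s' \<phi>" "sat M S e s \<psi> \<longleftrightarrow> sat M S e' s' \<psi>"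
    using Or.prems by (auto intro!: Or.IH)
  then show ?case by simp
next
  case (AllN \<phi>)
  have "sat M S (case_nat x e) s \<phi> \<longleftrightarrow> sat M S (case_nat x e') s' \<phi>" for x
    using AllN.prems by (intro AllN.IH) (auto split: nat.split)
  then show ?case by simp
next
  case (ExN \<phi>)
  have "sat M S (case_nat x e) s \<phi> \<longleftrightarrow> sat M S (case_nat x e') s' \<phi>" for x
    using ExN.prems by (intro ExN.IH) (auto split: nat.split)
  then show ?case by simp
next
  case (AllS \<phi>)
  have "sat M S e (case_nat X s) \<phi> \<longleftrightarrow> sat M S e' (case_nat X s') \<phi>" for X
    using AllS.prems by (intro AllS.IH) (auto split: nat.split)
  then show ?case by simp
next
  case (ExS \<phi>)
  have "sat M S e (case_nat X s) \<phi> \<longleftrightarrow> sat M S e' (case_nat X s') \<phi>" for X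
    using ExS.prems by (intro ExS.IH) (auto split: nat.split)
  then show ?case by simp
qed simp

lemma valid_sentence:
  assumes "sentence \<phi>" "range s \<subseteq> S"
  shows "valid M S \<phi> \<longleftrightarrow> sat M S e s \<phi>"
proof -
  have "sat M S e' s' \<phi> \<longleftrightarrow> sat M S e s \<phi>" for e' s'
    using assms(1) by (intro sat_cong) (auto simp: sentence_def)
  then show ?thesis using assms(2) unfolding valid_def by blast
qed

lemma valid_AllN [simp]: "valid M S (AllN \<phi>) \<longleftrightarrow> valid M S \<phi>"
proof -
  have "sat M S e s \<phi>" if "\<forall>e s. range s \<subseteq> S \<longrightarrow> (\<forall>x. sat M S (case_nat x e) s \<phi>)"
    "range s \<subseteq> S" for e s
  proof -
    have "case_nat (e 0) (\<lambda>i. e (Suc i)) = e" by (auto simp: fun_eq_iff split: nat.split)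
    then show ?thesis using that by metis
  qed
  then show ?thesis by (auto simp: valid_def)
qed

lemma valid_AllS [simp]: "valid M S (AllS \<phi>) \<longleftrightarrow> valid M S \<phi>"
proof -
  have "sat M S e s \<phi>" if *: "\<forall>e s. range s \<subseteq> S \<longrightarrow> (\<forall>X\<in>S. sat M S e (case_nat X s) \<phi>)"
    "range s \<subseteq> S" for e s
  proof -
    have "case_nat (s 0) (\<lambda>i. s (Suc i)) = s" by (auto simp: fun_eq_iff split: nat.split)
    moreover have "range (\<lambda>i. s (Suc i)) \<subseteq> S" "s 0 \<in> S" using that(2) by auto
    ultimately show ?thesis using *(1) by metis
  qed
  then show ?thesis by (auto simp: valid_def range_case_nat)
qed

lemma valid_ucl [simp]: "valid M S (ucl \<phi>) \<longleftrightarrow> valid M S \<phi>"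
proof -
  have "valid M S ((AllN ^^ n) \<phi>) \<longleftrightarrow> valid M S \<phi>"
       "valid M S ((AllS ^^ n) \<phi>) \<longleftrightarrow> valid M S \<phi>" for n \<phi>
    by (induction n) auto
  then show ?thesis by (simp add: ucl_def)
qed

lemma sentence_ucl: "sentence (ucl \<phi>)"
proof -
  have "nbound ((AllN ^^ n) \<phi>) = nbound \<phi> - n" "sbound ((AllN ^^ n) \<phi>) = sbound \<phi>"
       "nbound ((AllS ^^ n) \<phi>) = nbound \<phi>" "sbound ((AllS ^^ n) \<phi>) = sbound \<phi> - n" for n \<phi>
    by (induction n) auto
  then show ?thesis by (simp add: ucl_def sentence_def)
qed

lemma sentence_RCA0m: "\<phi> \<in> RCA0m \<Longrightarrow> sentence \<phi>"
  by (auto simp: RCA0m_def CDelta00_def BASIC_def IND_def Compr_def sentence_ucl)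
    (simp add: sentence_def Comp_ax_def is_fun_def)

lemma soundness_valid:
  assumes "\<Gamma> \<turnstile> \<phi>" "\<And>\<gamma>. \<gamma> \<in> \<Gamma> \<Longrightarrow> valid M S \<gamma>"
  shows "valid M S \<phi>"
  unfolding valid_def
proof (intro allI impI)
  fix e and s :: "nat \<Rightarrow> 'a set" assume "range s \<subseteq> S"
  then show "sat M S e s \<phi>" using assms(2) by (intro soundness[OF assms(1)]) (auto simp: valid_def)
qed


section \<open>Completeness\<close>

instance tm :: countable by countable_datatype
instance fm :: countable by countable_datatype

text \<open>Witnesses are free variables instead of new constants. This requires a common bound on
  the variable indices in use, which persists because each stage of the chain adds at most two
  formulas.\<close>

definition fresh :: "nat \<Rightarrow> fm set \<Rightarrow> bool" where
  "fresh k \<Delta> \<longleftrightarrow> (\<forall>\<delta>\<in>\<Delta>. nbound \<delta> \<le> k \<and> sbound \<delta> \<le> k)"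

text \<open>Renaming \<open>Var k\<close> to \<open>Var 0\<close> and shifting all other variables
  acts as \<open>liftN\<close> on \<open>\<Delta>\<close> and sends the witness formula back to
  \<open>\<chi>\<close>. The given refutation thus becomes the minor premise of
  \<open>ExNE\<close>.\<close>

lemma fresh_witness_N:
  assumes "fresh k \<Delta>" "ExN \<chi> \<in> \<Delta>" "insert (instN (Var k) \<chi>) \<Delta> \<turnstile> \<^bold>\<bottom>"
  shows "\<Delta> \<turnstile> \<^bold>\<bottom>"
proof (rule proves.ExNE)
  show "\<Delta> \<turnstile> ExN \<chi>" using assms(2) by (rule proves.Assm)
  let ?\<sigma> = "\<lambda>i. if i = k then Var 0 else Var (Suc i)"
  have "subst ?\<sigma> id \<delta> = liftN \<delta>" if "\<delta> \<in> \<Delta>" for \<delta>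
    unfolding liftN_def using assms(1) that by (intro subst_cong) (auto simp: fresh_def)
  moreover have "subst ?\<sigma> id (instN (Var k) \<chi>) = \<chi>"
  proof -
    have "nbound \<chi> - 1 \<le> k" using assms(1,2) by (auto simp: fresh_def)
    then have "subst ?\<sigma> id (instN (Var k) \<chi>) = subst Var id \<chi>"
      unfolding instN_def subst_subst by (intro subst_cong) (auto split: nat.split)
    then show ?thesis by simp
  qed
  ultimately show "insert \<chi> (liftN ` \<Delta>) \<turnstile> liftN \<^bold>\<bottom>"
    using proves_subst[OF assms(3), of ?\<sigma> id] by (simp add: liftN_def cong: image_cong)
qed

lemma fresh_witness_S:
  assumes "fresh k \<Delta>" "ExS \<chi> \<in> \<Delta>" "insert (instS k \<chi>) \<Delta> \<turnstile> \<^bold>\<bottom>"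
  shows "\<Delta> \<turnstile> \<^bold>\<bottom>"
proof (rule proves.ExSE)
  show "\<Delta> \<turnstile> ExS \<chi>" using assms(2) by (rule proves.Assm)
  let ?\<rho> = "\<lambda>i. if i = k then 0 else Suc i"
  have "subst Var ?\<rho> \<delta> = liftS \<delta>" if "\<delta> \<in> \<Delta>" for \<delta>
    unfolding liftS_def using assms(1) that by (intro subst_cong) (auto simp: fresh_def)
  moreover have "subst Var ?\<rho> (instS k \<chi>) = \<chi>"
  proof -
    have "sbound \<chi> - 1 \<le> k" using assms(1,2) by (auto simp: fresh_def)
    then have "subst Var ?\<rho> (instS k \<chi>) = subst Var id \<chi>"
      unfolding instS_def subst_subst by (intro subst_cong) (auto split: nat.split)
    then show ?thesis by simp
  qed
  ultimately show "insert \<chi> (liftS ` \<Delta>) \<turnstile> liftS \<^bold>\<bottom>"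
    using proves_subst[OF assms(3), of Var ?\<rho>] by (simp add: liftS_def cong: image_cong)
qed

definition witness :: "fm set \<Rightarrow> fm \<Rightarrow> fm set" where
  "witness \<Delta> \<phi> = (let k = SOME k. fresh k \<Delta> in
     case \<phi> of ExN \<chi> \<Rightarrow> {instN (Var k) \<chi>} | ExS \<chi> \<Rightarrow> {instS k \<chi>} | _ \<Rightarrow> {})"

definition extend :: "fm \<Rightarrow> fm set \<Rightarrow> fm set" where
  "extend \<phi> \<Delta> = (if insert \<phi> \<Delta> \<turnstile> \<^bold>\<bottom> then \<Delta> else insert \<phi> \<Delta> \<union> witness (insert \<phi> \<Delta>) \<phi>)"

primrec henkin_chain :: "fm set \<Rightarrow> nat \<Rightarrow> fm set" where
  "henkin_chain \<Gamma> 0 = \<Gamma>"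
| "henkin_chain \<Gamma> (Suc n) = extend (from_nat n) (henkin_chain \<Gamma> n)"

lemma fresh_mono: "fresh k \<Delta> \<Longrightarrow> k \<le> l \<Longrightarrow> fresh l \<Delta>"
  by (fastforce simp: fresh_def)

lemma ex_fresh_Un:
  assumes "\<exists>k. fresh k A" "\<exists>k. fresh k B" shows "\<exists>k. fresh k (A \<union> B)"
proof -
  obtain k l where "fresh k A" "fresh l B" using assms by auto
  then have "fresh (max k l) A" "fresh (max k l) B" by (auto intro: fresh_mono)
  then have "fresh (max k l) (A \<union> B)" by (auto simp: fresh_def)
  then show ?thesis by blast
qed

lemma ex_fresh_insert:
  assumes "\<exists>k. fresh k A" shows "\<exists>k. fresh k (insert \<phi> A)"
proof -
  have "fresh (max (nbound \<phi>) (sbound \<phi>)) {\<phi>}" by (simp add: fresh_def)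
  then have "\<exists>k. fresh k ({\<phi>} \<union> A)" using assms by (intro ex_fresh_Un) blast
  then show ?thesis by simp
qed

lemma ex_fresh_extend: "\<exists>k. fresh k \<Delta> \<Longrightarrow> \<exists>k. fresh k (extend \<phi> \<Delta>)"
proof -
  assume *: "\<exists>k. fresh k \<Delta>"
  have "\<exists>k. fresh k (witness A \<phi>)" for A
  proof -
    have "fresh 0 {}" by (simp add: fresh_def)
    then show ?thesis
      by (auto simp: witness_def Let_def intro!: ex_fresh_insert split: fm.split)
  qed
  with * show ?thesis unfolding extend_def by (auto intro!: ex_fresh_Un ex_fresh_insert simp del: Un_insert_left)
qed

lemma extend_consistent:
  assumes "\<exists>k. fresh k \<Delta>" "\<not> \<Delta> \<turnstile> \<^bold>\<bottom>" shows "\<not> extend \<phi> \<Delta> \<turnstile> \<^bold>\<bottom>"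
proof (cases "insert \<phi> \<Delta> \<turnstile> \<^bold>\<bottom>")
  case True
  then show ?thesis using assms(2) by (simp add: extend_def)
next
  case False
  let ?k = "SOME k. fresh k (insert \<phi> \<Delta>)"
  have "fresh ?k (insert \<phi> \<Delta>)" using ex_fresh_insert[OF assms(1)] by (rule someI_ex)
  note fresh_witness_N[OF this] fresh_witness_S[OF this]
  then show ?thesis
    using False by (auto simp: extend_def witness_def Let_def insert_commute split: fm.split)
qed

lemma subset_UN_chain:
  fixes f :: "nat \<Rightarrow> 'a set"
  assumes "finite A" "A \<subseteq> (\<Union>n. f n)" "mono f" shows "\<exists>n. A \<subseteq> f n"
  using assms(1,2)
proof (induction rule: finite_induct)
  case (insert x A)
  then obtain n m where "A \<subseteq> f n" "x \<in> f m" by auto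
  moreover have "f n \<subseteq> f (max n m)" "f m \<subseteq> f (max n m)" using assms(3) by (auto simp: mono_def)
  ultimately show ?case by blast
qed simp

definition henkin :: "fm set \<Rightarrow> bool" where
  "henkin H \<longleftrightarrow> (\<forall>\<phi>. H \<turnstile> \<phi> \<longrightarrow> \<phi> \<in> H) \<and> (\<forall>\<phi>. (\<^bold>\<not> \<phi>) \<in> H \<longleftrightarrow> \<phi> \<notin> H) \<and>
     (\<forall>\<phi>. ExN \<phi> \<in> H \<longrightarrow> (\<exists>t. instN t \<phi> \<in> H)) \<and> (\<forall>\<phi>. ExS \<phi> \<in> H \<longrightarrow> (\<exists>X. instS X \<phi> \<in> H))"

lemma ex_henkin:
  assumes "\<not> \<Gamma> \<turnstile> \<^bold>\<bottom>" "\<exists>k. fresh k \<Gamma>"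
  shows "\<exists>H. \<Gamma> \<subseteq> H \<and> henkin H"
proof -
  let ?c = "henkin_chain \<Gamma>"
  define H where "H = (\<Union>n. ?c n)"
  have chain: "\<not> ?c n \<turnstile> \<^bold>\<bottom> \<and> (\<exists>k. fresh k (?c n))" for n
    by (induction n) (use assms in \<open>auto simp: extend_consistent ex_fresh_extend\<close>)
  have "mono ?c"
    by (auto simp: mono_iff_le_Suc extend_def)
  have consistent: "\<not> H \<turnstile> \<^bold>\<bottom>"
  proof
    assume "H \<turnstile> \<^bold>\<bottom>"
    then obtain \<Delta> where \<Delta>: "finite \<Delta>" "\<Delta> \<subseteq> H" "\<Delta> \<turnstile> \<^bold>\<bottom>" using proves_finite by blast
    then obtain n where "\<Delta> \<subseteq> ?c n" using subset_UN_chain[OF _ _ \<open>mono ?c\<close>] unfolding H_def by blast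
    then show False using \<Delta>(3) chain proves_weaken by blast
  qed
  \<comment> \<open>Stage \<open>to_nat \<phi>\<close> treats \<open>\<phi>\<close>, since
    \<open>from_nat\<close> inverts \<open>to_nat\<close>: the formula is added together with its
    witness, unless its negation is already derivable.\<close>
  have decide: "(\<phi> \<in> H \<and> witness (insert \<phi> (?c (to_nat \<phi>))) \<phi> \<subseteq> H) \<or> H \<turnstile> \<^bold>\<not> \<phi>" for \<phi>
  proof (cases "insert \<phi> (?c (to_nat \<phi>)) \<turnstile> \<^bold>\<bottom>")
    case True
    then have "?c (to_nat \<phi>) \<turnstile> \<^bold>\<not> \<phi>" by (rule proves.ImpI)
    then have "H \<turnstile> \<^bold>\<not> \<phi>" by (rule proves_weaken) (auto simp: H_def)
    then show ?thesis ..
  next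
    case False
    then have "insert \<phi> (witness (insert \<phi> (?c (to_nat \<phi>))) \<phi>) \<subseteq> ?c (Suc (to_nat \<phi>))"
      by (auto simp: extend_def)
    then show ?thesis unfolding H_def by blast
  qed
  have closed: "\<phi> \<in> H" if "H \<turnstile> \<phi>" for \<phi>
    using decide[of \<phi>] consistent that proves.ImpE by blast
  have "(\<^bold>\<not> \<phi>) \<in> H \<longleftrightarrow> \<phi> \<notin> H" for \<phi>
    using decide[of \<phi>] closed consistent proves.ImpE proves.Assm by metis
  moreover have "\<exists>t. instN t \<phi> \<in> H" if "ExN \<phi> \<in> H" for \<phi>
  proof -
    have "\<not> H \<turnstile> \<^bold>\<not> ExN \<phi>" using that consistent proves.ImpE proves.Assm by metis
    then show ?thesis using decide[of "ExN \<phi>"] by (auto simp: witness_def Let_def)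
  qed
  moreover have "\<exists>X. instS X \<phi> \<in> H" if "ExS \<phi> \<in> H" for \<phi>
  proof -
    have "\<not> H \<turnstile> \<^bold>\<not> ExS \<phi>" using that consistent proves.ImpE proves.Assm by metis
    then show ?thesis using decide[of "ExS \<phi>"] by (auto simp: witness_def Let_def)
  qed
  moreover have "\<Gamma> \<subseteq> H" unfolding H_def using henkin_chain.simps(1) by blast
  ultimately show ?thesis unfolding henkin_def using closed by blast
qed

text \<open>The truth lemma passes from a quantified formula to its instances, which are not
  subformulas. Counting only connectives and quantifiers makes the measure invariant under
  substitution.\<close>

primrec fsize :: "fm \<Rightarrow> nat" where
  "fsize (s \<^bold>= t) = 0"
| "fsize (s \<^bold>< t) = 0"
| "fsize (t \<^bold>\<in> X) = 0"
| "fsize \<^bold>\<bottom> = 0"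
| "fsize (\<phi> \<^bold>\<longrightarrow> \<psi>) = Suc (fsize \<phi> + fsize \<psi>)"
| "fsize (\<phi> \<^bold>\<and> \<psi>) = Suc (fsize \<phi> + fsize \<psi>)"
| "fsize (\<phi> \<^bold>\<or> \<psi>) = Suc (fsize \<phi> + fsize \<psi>)"
| "fsize (AllN \<phi>) = Suc (fsize \<phi>)"
| "fsize (ExN \<phi>) = Suc (fsize \<phi>)"
| "fsize (AllS \<phi>) = Suc (fsize \<phi>)"
| "fsize (ExS \<phi>) = Suc (fsize \<phi>)"

lemma fsize_subst [simp]: "fsize (subst \<sigma> \<rho> \<phi>) = fsize \<phi>"
  by (induction \<phi> arbitrary: \<sigma> \<rho>) auto

lemma fsize_inst [simp]: "fsize (instN t \<phi>) = fsize \<phi>" "fsize (instS X \<phi>) = fsize \<phi>"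
  by (simp_all add: instN_def instS_def)

section \<open>Truth conditions in a Henkin set and the term model\<close>

locale henkin_set =
  fixes H :: "fm set"
  assumes henkin: "henkin H"
begin

lemma closed: "H \<turnstile> \<phi> \<Longrightarrow> \<phi> \<in> H"
  using henkin by (auto simp: henkin_def)

lemma proves_contradiction: "\<phi> \<in> \<Delta> \<Longrightarrow> (\<^bold>\<not> \<phi>) \<in> \<Delta> \<Longrightarrow> \<Delta> \<turnstile> \<^bold>\<bottom>"
  by (rule proves.ImpE[OF proves.Assm proves.Assm])

lemma mem: "\<phi> \<in> H \<Longrightarrow> H \<turnstile> \<phi>"
  by (rule proves.Assm)

lemma Neg_iff [simp]: "(\<^bold>\<not> \<phi>) \<in> H \<longleftrightarrow> \<phi> \<notin> H"
  using henkin by (auto simp: henkin_def)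

lemma explode: "\<phi> \<in> H" if "H \<turnstile> \<^bold>\<bottom>"
  by (rule closed, rule proves.Contr, rule proves_weaken[OF that]) auto

lemma Falsum_iff [simp]: "\<^bold>\<bottom> \<notin> H"
  using explode[OF mem] Neg_iff by blast

lemma Imp_iff [simp]: "(\<phi> \<^bold>\<longrightarrow> \<psi>) \<in> H \<longleftrightarrow> (\<phi> \<in> H \<longrightarrow> \<psi> \<in> H)"
proof (intro iffI impI)
  assume "(\<phi> \<^bold>\<longrightarrow> \<psi>) \<in> H" "\<phi> \<in> H"
  then show "\<psi> \<in> H" by (meson closed mem proves.ImpE)
next
  assume *: "\<phi> \<in> H \<longrightarrow> \<psi> \<in> H"
  show "(\<phi> \<^bold>\<longrightarrow> \<psi>) \<in> H"
  proof (cases "\<phi> \<in> H")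
    case True
    then show ?thesis using * by (meson closed proves.ImpI proves.Assm insertI2)
  next
    case False
    then have "(\<^bold>\<not> \<phi>) \<in> H" by simp
    then have "insert (\<^bold>\<not> \<psi>) (insert \<phi> H) \<turnstile> \<^bold>\<bottom>"
      by (intro proves_contradiction[of \<phi>]) auto
    then show ?thesis by (rule closed[OF proves.ImpI[OF proves.Contr]])
  qed
qed

lemma And_iff [simp]: "(\<phi> \<^bold>\<and> \<psi>) \<in> H \<longleftrightarrow> \<phi> \<in> H \<and> \<psi> \<in> H"
proof
  assume "(\<phi> \<^bold>\<and> \<psi>) \<in> H"
  then show "\<phi> \<in> H \<and> \<psi> \<in> H"
    using closed[OF proves.AndE1[OF mem, of \<phi> \<psi>]] closed[OF proves.AndE2[OF mem, of \<phi> \<psi>]] by simp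
next
  assume "\<phi> \<in> H \<and> \<psi> \<in> H"
  then show "(\<phi> \<^bold>\<and> \<psi>) \<in> H" using closed[OF proves.AndI[OF mem mem, of \<phi> \<psi>]] by simp
qed

lemma Or_iff [simp]: "(\<phi> \<^bold>\<or> \<psi>) \<in> H \<longleftrightarrow> \<phi> \<in> H \<or> \<psi> \<in> H"
proof
  assume *: "(\<phi> \<^bold>\<or> \<psi>) \<in> H"
  show "\<phi> \<in> H \<or> \<psi> \<in> H"
  proof (rule ccontr)
    assume "\<not> (\<phi> \<in> H \<or> \<psi> \<in> H)"
    then have n: "(\<^bold>\<not> \<phi>) \<in> H" "(\<^bold>\<not> \<psi>) \<in> H" by auto
    have "H \<turnstile> \<^bold>\<bottom>"
    proof (rule proves.OrE)
      show "H \<turnstile> \<phi> \<^bold>\<or> \<psi>" using * by (rule mem)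
      show "insert \<phi> H \<turnstile> \<^bold>\<bottom>" using n by (intro proves_contradiction[of \<phi>]) auto
      show "insert \<psi> H \<turnstile> \<^bold>\<bottom>" using n by (intro proves_contradiction[of \<psi>]) auto
    qed
    then show False using closed Falsum_iff by blast
  qed
next
  assume "\<phi> \<in> H \<or> \<psi> \<in> H"
  then show "(\<phi> \<^bold>\<or> \<psi>) \<in> H"
    using closed[OF proves.OrI1[OF mem, of \<phi> \<psi>]] closed[OF proves.OrI2[OF mem, of \<psi> \<phi>]] by auto
qed

lemma ExN_iff: "ExN \<phi> \<in> H \<longleftrightarrow> (\<exists>t. instN t \<phi> \<in> H)"
  using henkin closed mem proves.ExNI unfolding henkin_def by blast

lemma ExS_iff: "ExS \<phi> \<in> H \<longleftrightarrow> (\<exists>X. instS X \<phi> \<in> H)"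
  using henkin closed mem proves.ExSI unfolding henkin_def by blast

text \<open>The Henkin property speaks about \<open>ExN\<close>, so the converse starts from the
  fact that \<open>H\<close> refutes the existence of a counterexample. Under the eigenvariable rule
  a counterexample would be \<open>Var 0\<close>, which contradicts the lifted refutation.\<close>

lemma AllN_iff: "AllN \<phi> \<in> H \<longleftrightarrow> (\<forall>t. instN t \<phi> \<in> H)"
proof
  assume "AllN \<phi> \<in> H"
  then show "\<forall>t. instN t \<phi> \<in> H" by (meson closed mem proves.AllNE)
next
  assume *: "\<forall>t. instN t \<phi> \<in> H"
  have inst_neg: "instN t (\<^bold>\<not> \<phi>) = (\<^bold>\<not> instN t \<phi>)" for t by (simp add: instN_def)
  have "ExN (\<^bold>\<not> \<phi>) \<notin> H" using * by (simp add: ExN_iff inst_neg)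
  then have n: "(\<^bold>\<not> ExN (\<^bold>\<not> \<phi>)) \<in> H" by simp
  have "insert (\<^bold>\<not> \<phi>) (liftN ` H) \<turnstile> \<^bold>\<bottom>"
  proof (rule proves.ImpE)
    have "liftN (\<^bold>\<not> ExN (\<^bold>\<not> \<phi>)) = (liftN (ExN (\<^bold>\<not> \<phi>)) \<^bold>\<longrightarrow> \<^bold>\<bottom>)"
      by (simp add: liftN_def)
    moreover have "liftN (\<^bold>\<not> ExN (\<^bold>\<not> \<phi>)) \<in> liftN ` H" using n by (rule imageI)
    ultimately show "insert (\<^bold>\<not> \<phi>) (liftN ` H) \<turnstile> liftN (ExN (\<^bold>\<not> \<phi>)) \<^bold>\<longrightarrow> \<^bold>\<bottom>"
      by (intro proves.Assm) simp
    let ?\<sigma> = "case_nat (Var 0) (\<lambda>i. tlift (Var (Suc i)))"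
    have *: "liftN (ExN (\<^bold>\<not> \<phi>)) = ExN (\<^bold>\<not> subst ?\<sigma> id \<phi>)"
      by (simp add: liftN_def del: tlift_simps)
    have "instN (Var 0) (\<^bold>\<not> subst ?\<sigma> id \<phi>) = (\<^bold>\<not> subst (\<lambda>i. tsubst (case_nat (Var 0) Var) (?\<sigma> i)) id \<phi>)"
      by (simp add: instN_def subst_subst id_def del: tlift_simps)
    also have "(\<lambda>i. tsubst (case_nat (Var 0) Var) (?\<sigma> i)) = Var"
      by (auto simp: fun_eq_iff split: nat.split)
    finally have "instN (Var 0) (\<^bold>\<not> subst ?\<sigma> id \<phi>) = (\<^bold>\<not> \<phi>)" by (simp only: subst_Var)
    then show "insert (\<^bold>\<not> \<phi>) (liftN ` H) \<turnstile> liftN (ExN (\<^bold>\<not> \<phi>))"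
      unfolding * by (intro proves.ExNI[where t = "Var 0"]) (auto intro: proves.Assm)
  qed
  then show "AllN \<phi> \<in> H" by (rule closed[OF proves.AllNI[OF proves.Contr]])
qed

lemma AllS_iff: "AllS \<phi> \<in> H \<longleftrightarrow> (\<forall>X. instS X \<phi> \<in> H)"
proof
  assume "AllS \<phi> \<in> H"
  then show "\<forall>X. instS X \<phi> \<in> H" by (meson closed mem proves.AllSE)
next
  assume *: "\<forall>X. instS X \<phi> \<in> H"
  have inst_neg: "instS X (\<^bold>\<not> \<phi>) = (\<^bold>\<not> instS X \<phi>)" for X by (simp add: instS_def)
  have "ExS (\<^bold>\<not> \<phi>) \<notin> H" using * by (simp add: ExS_iff inst_neg)
  then have n: "(\<^bold>\<not> ExS (\<^bold>\<not> \<phi>)) \<in> H" by simp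
  have "insert (\<^bold>\<not> \<phi>) (liftS ` H) \<turnstile> \<^bold>\<bottom>"
  proof (rule proves.ImpE)
    have "liftS (\<^bold>\<not> ExS (\<^bold>\<not> \<phi>)) = (liftS (ExS (\<^bold>\<not> \<phi>)) \<^bold>\<longrightarrow> \<^bold>\<bottom>)"
      by (simp add: liftS_def)
    moreover have "liftS (\<^bold>\<not> ExS (\<^bold>\<not> \<phi>)) \<in> liftS ` H" using n by (rule imageI)
    ultimately show "insert (\<^bold>\<not> \<phi>) (liftS ` H) \<turnstile> liftS (ExS (\<^bold>\<not> \<phi>)) \<^bold>\<longrightarrow> \<^bold>\<bottom>"
      by (intro proves.Assm) simp
    let ?\<rho> = "case_nat 0 (\<lambda>i. Suc (Suc i))"
    have *: "liftS (ExS (\<^bold>\<not> \<phi>)) = ExS (\<^bold>\<not> subst Var ?\<rho> \<phi>)" by (simp add: liftS_def)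
    have "instS 0 (\<^bold>\<not> subst Var ?\<rho> \<phi>) = (\<^bold>\<not> subst Var (\<lambda>i. case_nat 0 id (?\<rho> i)) \<phi>)"
      by (simp add: instS_def subst_subst)
    also have "(\<lambda>i. case_nat 0 id (?\<rho> i)) = id"
      by (auto simp: fun_eq_iff split: nat.split)
    finally have "instS 0 (\<^bold>\<not> subst Var ?\<rho> \<phi>) = (\<^bold>\<not> \<phi>)" by simp
    then show "insert (\<^bold>\<not> \<phi>) (liftS ` H) \<turnstile> liftS (ExS (\<^bold>\<not> \<phi>))"
      unfolding * by (intro proves.ExSI[where X = 0]) (auto intro: proves.Assm)
  qed
  then show "AllS \<phi> \<in> H" by (rule closed[OF proves.AllSI[OF proves.Contr]])
qed

lemma Eq_refl: "(t \<^bold>= t) \<in> H"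
  by (rule closed, rule proves.EqRefl)

lemma Eq_subst: "(t \<^bold>= u) \<in> H \<Longrightarrow> instN t \<phi> \<in> H \<Longrightarrow> instN u \<phi> \<in> H"
  by (meson closed mem proves.EqSubst)

lemma Eq_sym: "(t \<^bold>= u) \<in> H \<Longrightarrow> (u \<^bold>= t) \<in> H"
  using Eq_subst[of t u "Var 0 \<^bold>= tlift t"] Eq_refl by (simp add: instN_def)

lemma Eq_trans: "(t \<^bold>= u) \<in> H \<Longrightarrow> (u \<^bold>= v) \<in> H \<Longrightarrow> (t \<^bold>= v) \<in> H"
  using Eq_subst[of u v "tlift t \<^bold>= Var 0"] by (simp add: instN_def)

lemma Eq_cong1:
  assumes "(t \<^bold>= u) \<in> H"
  shows "(Succ t \<^bold>= Succ u) \<in> H" "(Head t \<^bold>= Head u) \<in> H" "(Tail t \<^bold>= Tail u) \<in> H"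
  using Eq_subst[OF assms, of "Succ (tlift t) \<^bold>= Succ (Var 0)"]
    Eq_subst[OF assms, of "Head (tlift t) \<^bold>= Head (Var 0)"]
    Eq_subst[OF assms, of "Tail (tlift t) \<^bold>= Tail (Var 0)"] Eq_refl
  by (simp_all add: instN_def)

lemma Eq_cong2:
  assumes "(t \<^bold>= u) \<in> H" "(t' \<^bold>= u') \<in> H"
  shows "(t \<^bold>+ t' \<^bold>= u \<^bold>+ u') \<in> H" "(t \<^bold>* t' \<^bold>= u \<^bold>* u') \<in> H"
    "(\<^bold>\<langle>t, t'\<^bold>\<rangle> \<^bold>= \<^bold>\<langle>u, u'\<^bold>\<rangle>) \<in> H" "(t \<^bold>< t') \<in> H \<Longrightarrow> (u \<^bold>< u') \<in> H"
proof -
  have "(t \<^bold>+ t' \<^bold>= u \<^bold>+ t') \<in> H" "(t \<^bold>* t' \<^bold>= u \<^bold>* t') \<in> H" "(\<^bold>\<langle>t, t'\<^bold>\<rangle> \<^bold>= \<^bold>\<langle>u, t'\<^bold>\<rangle>) \<in> H"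
    using Eq_subst[OF assms(1), of "tlift (t \<^bold>+ t') \<^bold>= Var 0 \<^bold>+ tlift t'"]
      Eq_subst[OF assms(1), of "tlift (t \<^bold>* t') \<^bold>= Var 0 \<^bold>* tlift t'"]
      Eq_subst[OF assms(1), of "tlift (\<^bold>\<langle>t, t'\<^bold>\<rangle>) \<^bold>= \<^bold>\<langle>Var 0, tlift t'\<^bold>\<rangle>"] Eq_refl
    by (simp_all add: instN_def)
  then show "(t \<^bold>+ t' \<^bold>= u \<^bold>+ u') \<in> H" "(t \<^bold>* t' \<^bold>= u \<^bold>* u') \<in> H" "(\<^bold>\<langle>t, t'\<^bold>\<rangle> \<^bold>= \<^bold>\<langle>u, u'\<^bold>\<rangle>) \<in> H"
    using Eq_subst[OF assms(2), of "tlift (t \<^bold>+ t') \<^bold>= tlift u \<^bold>+ Var 0"]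
      Eq_subst[OF assms(2), of "tlift (t \<^bold>* t') \<^bold>= tlift u \<^bold>* Var 0"]
      Eq_subst[OF assms(2), of "tlift (\<^bold>\<langle>t, t'\<^bold>\<rangle>) \<^bold>= \<^bold>\<langle>tlift u, Var 0\<^bold>\<rangle>"]
    by (simp_all add: instN_def)
  assume "(t \<^bold>< t') \<in> H"
  then have "(u \<^bold>< t') \<in> H"
    using Eq_subst[OF assms(1), of "Var 0 \<^bold>< tlift t'"] by (simp add: instN_def)
  then show "(u \<^bold>< u') \<in> H"
    using Eq_subst[OF assms(2), of "tlift u \<^bold>< Var 0"] by (simp add: instN_def)
qed

lemma Eq_Mem: "(t \<^bold>= u) \<in> H \<Longrightarrow> (t \<^bold>\<in> X) \<in> H \<Longrightarrow> (u \<^bold>\<in> X) \<in> H"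
  using Eq_subst[of t u "Var 0 \<^bold>\<in> X"] by (simp add: instN_def)

text \<open>Any quotient of the terms by provable equality carries the term model.\<close>

lemma term_model:
  fixes c :: "tm \<Rightarrow> 'm"
  assumes surj: "surj c" and c: "\<And>t u. c t = c u \<longleftrightarrow> (t \<^bold>= u) \<in> H"
  shows "\<exists>M S s. range s = S \<and> countable S \<and> (\<forall>\<phi>. sat M S (\<lambda>i. c (Var i)) s \<phi> \<longleftrightarrow> \<phi> \<in> H)"
proof -
  define r where "r = inv c"
  have cr: "c (r x) = x" for x using surj by (simp add: r_def surj_f_inv_f)
  have rc: "(r (c t) \<^bold>= t) \<in> H" for t using c[of "r (c t)" t] cr[of "c t"] by simp
  define M where "M = \<lparr>iZ = c \<^bold>0, iS = \<lambda>x. c (Succ (r x)), iH = \<lambda>x. c (Head (r x)),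
    iT = \<lambda>x. c (Tail (r x)), iA = \<lambda>x y. c (r x \<^bold>+ r y), iM = \<lambda>x y. c (r x \<^bold>* r y),
    iP = \<lambda>x y. c \<^bold>\<langle>r x, r y\<^bold>\<rangle>, iL = \<lambda>x y. (r x \<^bold>< r y) \<in> H\<rparr>"
  define s where "s X = {x. (r x \<^bold>\<in> X) \<in> H}" for X
  define e where "e = (\<lambda>i. c (Var i))"
  have tval: "tval M e t = c t" for t
    by (induction t) (simp_all add: M_def e_def c rc Eq_cong1 Eq_cong2)
  \<comment> \<open>Every number is \<open>c t\<close> for some term and every set is
    \<open>s X\<close> for some variable, so both kinds of quantifiers range over the instances
    controlled by the Henkin property. Different set variables may denote the same set, which is
    harmless because the language has no equality of sets.\<close>
  have "sat M (range s) e s \<phi> \<longleftrightarrow> \<phi> \<in> H" for \<phi>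
  proof (induction \<phi> rule: measure_induct_rule[where f = fsize])
    case (less \<phi>)
    have inst: "sat M (range s) (case_nat (c t) e) s \<psi> \<longleftrightarrow> instN t \<psi> \<in> H"
      if "fsize \<psi> < fsize \<phi>" for t \<psi>
      using less[of "instN t \<psi>"] that by (simp add: sat_instN tval)
    have allN: "(\<forall>x. P x) \<longleftrightarrow> (\<forall>t. P (c t))" "(\<exists>x. P x) \<longleftrightarrow> (\<exists>t. P (c t))" for P
      using cr by metis+
    have instS: "sat M (range s) e (case_nat (s X) s) \<psi> \<longleftrightarrow> instS X \<psi> \<in> H"
      if "fsize \<psi> < fsize \<phi>" for X \<psi>
      using less[of "instS X \<psi>"] that by (simp add: sat_instS)
    show ?case
    proof (cases \<phi>)
      case (Less t u)
      have "(r (c t) \<^bold>< r (c u)) \<in> H \<longleftrightarrow> (t \<^bold>< u) \<in> H"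
        using Eq_cong2(4)[OF rc rc] Eq_cong2(4)[OF Eq_sym[OF rc] Eq_sym[OF rc]] by blast
      moreover have "iL M x y \<longleftrightarrow> (r x \<^bold>< r y) \<in> H" for x y by (simp add: M_def)
      ultimately show ?thesis using Less by (simp add: tval)
    next
      case (Mem t X)
      have "(r (c t) \<^bold>\<in> X) \<in> H \<longleftrightarrow> (t \<^bold>\<in> X) \<in> H"
        using Eq_Mem[OF rc] Eq_Mem[OF Eq_sym[OF rc]] by blast
      then show ?thesis using Mem by (simp add: tval s_def)
    next
      case (AllN \<psi>)
      then show ?thesis by (simp add: allN inst AllN_iff)
    next
      case (ExN \<psi>)
      then show ?thesis by (simp add: allN inst ExN_iff)
    next
      case (AllS \<psi>)
      then show ?thesis by (simp add: instS AllS_iff)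
    next
      case (ExS \<psi>)
      then show ?thesis by (simp add: instS ExS_iff)
    qed (simp_all add: less tval c)
  qed
  then show ?thesis unfolding e_def by (intro exI[of _ M] exI[of _ "range s"] exI[of _ s]) auto
qed

text \<open>The numerals are pairwise different, so the term model can be placed on the type of natural numbers.\<close>

lemma ex_term_quotient:
  assumes "BASIC \<subseteq> H"
  shows "\<exists>c :: tm \<Rightarrow> nat. surj c \<and> (\<forall>t u. c t = c u \<longleftrightarrow> (t \<^bold>= u) \<in> H)"
proof -
  define R where "R = {(t, u). (t \<^bold>= u) \<in> H}"
  have R: "equiv UNIV R"
    by (rule equivI) (auto simp: R_def refl_on_def sym_def trans_def intro: Eq_refl Eq_sym Eq_trans)
  have "ucl (\<^bold>\<not> Succ (Var 0) \<^bold>= \<^bold>0) \<in> H"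
    using assms by (auto simp: BASIC_def BASIC_matrices_def)
  then have nz: "(Succ t \<^bold>= \<^bold>0) \<notin> H" for t
    by (simp add: ucl_def AllN_iff) (simp add: instN_def)
  have "ucl (Succ (Var 0) \<^bold>= Succ (Var 1) \<^bold>\<longrightarrow> Var 0 \<^bold>= Var 1) \<in> H"
    using assms by (auto simp: BASIC_def BASIC_matrices_def)
  then have "\<forall>u t. (Succ t \<^bold>= Succ u) \<in> H \<longrightarrow> (t \<^bold>= u) \<in> H"
    by (simp add: ucl_def AllN_iff numeral_2_eq_2 instN_def)
  then have inj: "(t \<^bold>= u) \<in> H" if "(Succ t \<^bold>= Succ u) \<in> H" for t u
    using that by blast
  define num where "num n = (Succ ^^ n) \<^bold>0" for n
  have "m = n" if "(num m \<^bold>= num n) \<in> H" for m n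
    using that
  proof (induction m arbitrary: n)
    case 0
    then show ?case using nz Eq_sym by (cases n) (auto simp: num_def)
  next
    case (Suc m)
    then show ?case using nz inj by (cases n) (auto simp: num_def)
  qed
  then have "inj (\<lambda>n. R `` {num n})"
    using eq_equiv_class_iff[OF R] by (simp add: inj_def R_def)
  moreover have "range (\<lambda>n. R `` {num n}) \<subseteq> UNIV // R" by (auto simp: quotient_def)
  ultimately have "infinite (UNIV // R)" using finite_subset range_inj_infinite by blast
  moreover have "countable (UNIV // R)" by (simp add: quotient_def)
  ultimately obtain f :: "tm set \<Rightarrow> nat" where f: "bij_betw f (UNIV // R) UNIV"
    using to_nat_on_infinite by blast
  define c where "c t = f (R `` {t})" for t
  have q: "R `` {t} \<in> UNIV // R" for t by (simp add: quotient_def) blast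
  have "c t = c u \<longleftrightarrow> (t \<^bold>= u) \<in> H" for t u
  proof -
    have "c t = c u \<longleftrightarrow> R `` {t} = R `` {u}"
      unfolding c_def using inj_on_eq_iff[OF bij_betw_imp_inj_on[OF f] q q] .
    also have "\<dots> \<longleftrightarrow> (t, u) \<in> R" using eq_equiv_class_iff[OF R] by simp
    finally show ?thesis by (simp add: R_def)
  qed
  moreover have "surj c"
  proof -
    have "x \<in> range c" for x
    proof -
      have "x \<in> f ` (UNIV // R)" using f by (simp add: bij_betw_def)
      then show ?thesis by (auto simp: c_def quotient_def)
    qed
    then show ?thesis by blast
  qed
  ultimately show ?thesis by blast
qed

end

text \<open>The model lives on \<open>nat\<close>, since the existence of a model on some
  unspecified type cannot be stated in HOL. The axioms in \<open>BASIC\<close> make the term model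
  infinite, so that it can be placed there.\<close>

theorem completeness:
  assumes "\<And>\<gamma>. \<gamma> \<in> \<Gamma> \<Longrightarrow> sentence \<gamma>" "BASIC \<subseteq> \<Gamma>" "sentence \<psi>" "\<not> \<Gamma> \<turnstile> \<psi>"
  shows "\<exists>(M :: nat interp) S. countable S \<and> S \<noteq> {} \<and> (\<forall>\<gamma>\<in>\<Gamma>. valid M S \<gamma>) \<and> \<not> valid M S \<psi>"
proof -
  let ?\<Gamma> = "insert (\<^bold>\<not> \<psi>) \<Gamma>"
  have sent: "sentence \<gamma>" if "\<gamma> \<in> ?\<Gamma>" for \<gamma>
    using that assms(1,3) by (auto simp: sentence_def)
  have "fresh 0 ?\<Gamma>" unfolding fresh_def
  proof
    fix \<gamma> assume "\<gamma> \<in> ?\<Gamma>"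
    then show "nbound \<gamma> \<le> 0 \<and> sbound \<gamma> \<le> 0" using sent[of \<gamma>] by (simp add: sentence_def)
  qed
  moreover have "\<not> ?\<Gamma> \<turnstile> \<^bold>\<bottom>" using assms(4) by (auto dest: proves.Contr)
  ultimately obtain H where H: "?\<Gamma> \<subseteq> H" "henkin H" using ex_henkin by blast
  interpret henkin_set H using H(2) by unfold_locales
  obtain c :: "tm \<Rightarrow> nat" where "surj c" "\<And>t u. c t = c u \<longleftrightarrow> (t \<^bold>= u) \<in> H"
    using ex_term_quotient H(1) assms(2) by blast
  from term_model[OF this] obtain M S s where M: "range s = S" "countable S"
    "\<And>\<phi>. sat M S (\<lambda>i. c (Var i)) s \<phi> \<longleftrightarrow> \<phi> \<in> H" by blast
  have valid: "valid M S \<gamma> \<longleftrightarrow> \<gamma> \<in> H" if "sentence \<gamma>" for \<gamma>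
    using valid_sentence[OF that, of s S M "\<lambda>i. c (Var i)"] M(1,3) by auto
  have "\<psi> \<notin> H" using H(1) Neg_iff[of \<psi>] by blast
  then have "\<not> valid M S \<psi>" using valid assms(3) by blast
  moreover have "\<forall>\<gamma>\<in>\<Gamma>. valid M S \<gamma>"
  proof
    fix \<gamma> assume "\<gamma> \<in> \<Gamma>"
    then show "valid M S \<gamma>" using valid assms(1) H(1) by blast
  qed
  moreover have "S \<noteq> {}" using M(1) by auto
  ultimately show ?thesis using M(2) by blast
qed


section \<open>Models of \<open>RCA\<^sub>0\<^sup>-\<close>\<close>

definition arith :: "'m interp \<Rightarrow> bool" where
  "arith M \<longleftrightarrow> (\<forall>x y z w.
     iS M x \<noteq> iZ M \<and> (iS M x = iS M y \<longrightarrow> x = y) \<and>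
     iA M x (iZ M) = x \<and> iA M x (iS M y) = iS M (iA M x y) \<and>
     iM M x (iZ M) = iZ M \<and> iM M x (iS M y) = iA M (iM M x y) x \<and>
     \<not> iL M x (iZ M) \<and> (iL M x (iS M y) \<longleftrightarrow> iL M x y \<or> x = y) \<and>
     (iL M x y \<or> x = y \<or> iL M y x) \<and> (iL M (iZ M) x \<longrightarrow> (\<exists>y. iL M y x \<and> iS M y = x)) \<and>
     (iP M x y = z \<longleftrightarrow> iM M (iS M (iS M (iZ M))) z =
       iA M (iA M (iM M (iA M x y) (iA M (iA M x y) (iS M (iZ M)))) (iM M (iS M (iS M (iZ M))) x))
         (iS M (iS M (iZ M)))) \<and>
     (iP M x y = iP M z w \<longrightarrow> x = z \<and> y = w) \<and>
     (iL M (iZ M) x \<longrightarrow> (\<exists>y. iL M y x \<and> (\<exists>z. iL M z x \<and> iP M y z = x))) \<and>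
     iH M (iP M x y) = x \<and> iH M (iZ M) = iZ M \<and> iT M (iP M x y) = y \<and> iT M (iZ M) = iZ M)"

definition func :: "'m interp \<Rightarrow> 'm set \<Rightarrow> bool" where
  "func M f \<longleftrightarrow> (\<forall>x. \<exists>y. iP M x y \<in> f) \<and> (\<forall>x y y'. iP M x y \<in> f \<and> iP M x y' \<in> f \<longrightarrow> y = y') \<and> iZ M \<notin> f"

lemma valid_BASIC:
  assumes "S \<noteq> {}"
  shows "(\<forall>\<phi>\<in>BASIC. valid M S \<phi>) \<longleftrightarrow> arith M"
proof
  assume *: "\<forall>\<phi>\<in>BASIC. valid M S \<phi>"
  obtain X where "X \<in> S" using assms by blast
  then have s: "range (\<lambda>_::nat. X) \<subseteq> S" by auto
  have "\<forall>\<phi>\<in>BASIC_matrices. sat M S e (\<lambda>_. X) \<phi>" for e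
    using * s by (simp add: BASIC_def) (auto simp: valid_def)
  note * = this[of "case_nat x (case_nat y (case_nat z (\<lambda>_. w)))" for x y z w]
  show "arith M"
    unfolding arith_def
  proof (intro allI, goal_cases)
    case (1 x y z w)
    show ?case
      using *[of x y z w] unfolding BASIC_matrices_def ball_simps
      by (simp add: numeral_2_eq_2 numeral_3_eq_3 iff_conv_conj_imp)
  qed
next
  assume *: "arith M"
  have "sat M S e s \<phi>" if "\<phi> \<in> BASIC_matrices" for e s \<phi>
  proof -
    have "\<forall>\<phi>\<in>BASIC_matrices. sat M S e s \<phi>"
      unfolding BASIC_matrices_def ball_simps
      using *[unfolded arith_def, rule_format, of "e 0" "e (Suc 0)" "e 2" "e 3"]
      by (simp add: numeral_2_eq_2 numeral_3_eq_3)
    then show ?thesis using that by blast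
  qed
  then have "\<forall>\<phi>\<in>BASIC_matrices. valid M S \<phi>" by (simp add: valid_def)
  then show "\<forall>\<phi>\<in>BASIC. valid M S \<phi>" by (simp add: BASIC_def)
qed

lemma valid_IND:
  "valid M S IND \<longleftrightarrow> (\<forall>X\<in>S. iZ M \<in> X \<and> (\<forall>x. x \<in> X \<longrightarrow> iS M x \<in> X) \<longrightarrow> (\<forall>x. x \<in> X))"
proof -
  have "(\<exists>s::nat \<Rightarrow> 'a set. range s \<subseteq> S \<and> s 0 = X) \<longleftrightarrow> X \<in> S" for X
    by (auto intro!: exI[of _ "\<lambda>_. X"])
  moreover have "\<exists>e::nat \<Rightarrow> 'a. e 0 = x" for x by (rule exI[of _ "\<lambda>_. x"]) simp
  ultimately show ?thesis unfolding IND_def valid_ucl by (simp add: valid_def) metis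
qed

lemma valid_Compr:
  "valid M S (Compr \<phi>) \<longleftrightarrow>
   (\<forall>e s. range s \<subseteq> S \<longrightarrow> {x. sat M S (case_nat x e) s \<phi>} \<in> S)"
proof -
  have "(\<exists>X\<in>S. \<forall>x. x \<in> X \<longleftrightarrow> P x) \<longleftrightarrow> {x. P x} \<in> S" for P :: "'a \<Rightarrow> bool"
  proof
    assume "\<exists>X\<in>S. \<forall>x. x \<in> X \<longleftrightarrow> P x"
    then obtain X where X: "X \<in> S" "\<forall>x. x \<in> X \<longleftrightarrow> P x" by blast
    then have "X = {x. P x}" by auto
    with X(1) show "{x. P x} \<in> S" by simp
  qed auto
  then show ?thesis
    unfolding Compr_def valid_ucl by (simp add: valid_def flip: iff_conv_conj_imp)
qed

lemma valid_Comp_ax: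
  "valid M S Comp_ax \<longleftrightarrow> (\<forall>g\<in>S. \<forall>h\<in>S. func M g \<and> func M h \<longrightarrow>
     (\<exists>f\<in>S. func M f \<and> (\<forall>x y z. iP M x z \<in> h \<and> iP M z y \<in> g \<longrightarrow> iP M x y \<in> f)))"
  if "S \<noteq> {}"
proof -
  have is_fun: "sat M S e s (is_fun i) \<longleftrightarrow> func M (s i)" for e s i
    by (simp add: is_fun_def func_def numeral_2_eq_2)
  obtain X where "X \<in> S" using \<open>S \<noteq> {}\<close> by blast
  then have s: "range (\<lambda>_::nat. X) \<subseteq> S" by auto
  have "sentence Comp_ax" by (intro sentence_RCA0m) (simp add: RCA0m_def)
  then have "valid M S Comp_ax \<longleftrightarrow> sat M S undefined (\<lambda>_. X) Comp_ax"
    using s by (rule valid_sentence)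
  also have "\<dots> \<longleftrightarrow> (\<forall>g\<in>S. \<forall>h\<in>S. func M g \<and> func M h \<longrightarrow>
     (\<exists>f\<in>S. func M f \<and> (\<forall>x y z. iP M x z \<in> h \<and> iP M z y \<in> g \<longrightarrow> iP M x y \<in> f)))"
    by (simp add: Comp_ax_def is_fun numeral_2_eq_2)
  finally show ?thesis .
qed

text \<open>The countable models of \<open>RCA0m\<close> in semantic terms, see
  \<open>rca_iff\<close>. Countability provides names for all parameters in \<open>D\<close> and the
  enumeration of requirements in \<open>ex_generic\<close>.\<close>

locale rca =
  fixes M :: "'m interp" and S :: "'m set set"
  assumes countable_M: "countable (UNIV :: 'm set)"
    and countable_S: "countable S"
    and nonempty: "S \<noteq> {}"
    and arith: "arith M"
    and set_induct: "\<lbrakk>X \<in> S; iZ M \<in> X; \<And>x. x \<in> X \<Longrightarrow> iS M x \<in> X\<rbrakk> \<Longrightarrow> x \<in> X"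
    and compr: "\<lbrakk>delta00 \<phi>; range s \<subseteq> S\<rbrakk> \<Longrightarrow> {x. sat M S (case_nat x e) s \<phi>} \<in> S"
    and comp: "\<lbrakk>g \<in> S; h \<in> S; func M g; func M h\<rbrakk> \<Longrightarrow>
      \<exists>f\<in>S. func M f \<and> (\<forall>x y z. iP M x z \<in> h \<and> iP M z y \<in> g \<longrightarrow> iP M x y \<in> f)"

lemma rca_iff:
  fixes M :: "'m interp"
  shows "rca M S \<longleftrightarrow> countable (UNIV :: 'm set) \<and> countable S \<and> S \<noteq> {} \<and> (\<forall>\<phi>\<in>RCA0m. valid M S \<phi>)"
    (is "_ \<longleftrightarrow> ?R")
proof
  assume "rca M S"
  then interpret rca M S .
  have "valid M S \<phi>" if "\<phi> \<in> RCA0m" for \<phi>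
  proof -
    have "valid M S IND" unfolding valid_IND using set_induct by blast
    moreover have "valid M S (Compr \<phi>)" if "delta00 \<phi>" for \<phi>
      unfolding valid_Compr using compr[OF that] by blast
    moreover have "valid M S Comp_ax" unfolding valid_Comp_ax[OF nonempty] using comp by blast
    moreover have "\<forall>\<phi>\<in>BASIC. valid M S \<phi>" using valid_BASIC nonempty arith by blast
    ultimately show ?thesis using that by (auto simp: RCA0m_def CDelta00_def)
  qed
  then show ?R using countable_M countable_S nonempty by blast
next
  assume *: ?R
  have v: "valid M S \<phi>" if "\<phi> \<in> RCA0m" for \<phi> using * that by blast
  have "\<forall>\<phi>\<in>BASIC. valid M S \<phi>" by (auto intro!: v simp: RCA0m_def CDelta00_def)
  then have "arith M" using valid_BASIC * by blast
  moreover have ind: "valid M S IND" and comp: "valid M S Comp_ax"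
    by (auto intro!: v simp: RCA0m_def CDelta00_def)
  moreover have compr: "valid M S (Compr \<phi>)" if "delta00 \<phi>" for \<phi>
    using that by (auto intro!: v simp: RCA0m_def CDelta00_def)
  moreover have ne: "S \<noteq> {}" using * by blast
  ultimately show "rca M S"
  proof (intro rca.intro)
    show "x \<in> X" if "X \<in> S" "iZ M \<in> X" "\<And>x. x \<in> X \<Longrightarrow> iS M x \<in> X" for X x
      using ind that unfolding valid_IND by blast
    show "{x. sat M S (case_nat x e) s \<phi>} \<in> S" if "delta00 \<phi>" "range s \<subseteq> S" for \<phi> s e
      using compr[OF that(1)] that(2) unfolding valid_Compr by blast
    show "\<exists>f\<in>S. func M f \<and> (\<forall>x y z. iP M x z \<in> h \<and> iP M z y \<in> g \<longrightarrow> iP M x y \<in> f)"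
      if "g \<in> S" "h \<in> S" "func M g" "func M h" for g h
      using comp that unfolding valid_Comp_ax[OF ne] by blast
  qed (use * in auto)
qed

context rca
begin

abbreviation zer ("\<zero>") where "\<zero> \<equiv> iZ M"
abbreviation suc where "suc \<equiv> iS M"
abbreviation head where "head \<equiv> iH M"
abbreviation tail where "tail \<equiv> iT M"
abbreviation add (infixl "\<oplus>" 65) where "x \<oplus> y \<equiv> iA M x y"
abbreviation mul (infixl "\<otimes>" 70) where "x \<otimes> y \<equiv> iM M x y"
abbreviation pr ("\<langle>_,/ _\<rangle>") where "\<langle>x, y\<rangle> \<equiv> iP M x y"
abbreviation ls (infix "\<lless>" 50) where "x \<lless> y \<equiv> iL M x y"
abbreviation lq (infix "\<lesssim>" 50) where "x \<lesssim> y \<equiv> x \<lless> y \<or> x = y"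

lemma basic [simp]:
  "suc x \<noteq> \<zero>" "\<zero> \<noteq> suc x" "suc x = suc y \<longleftrightarrow> x = y" "x \<oplus> \<zero> = x" "x \<oplus> suc y = suc (x \<oplus> y)"
  "x \<otimes> \<zero> = \<zero>" "x \<otimes> suc y = x \<otimes> y \<oplus> x" "\<not> x \<lless> \<zero>" "x \<lless> suc y \<longleftrightarrow> x \<lesssim> y"
  "\<langle>x, y\<rangle> = \<langle>z, w\<rangle> \<longleftrightarrow> x = z \<and> y = w"
  "head \<langle>x, y\<rangle> = x" "head \<zero> = \<zero>" "tail \<langle>x, y\<rangle> = y" "tail \<zero> = \<zero>"
  using arith unfolding arith_def by metis+

lemma linear: "x \<lless> y \<or> x = y \<or> y \<lless> x"
  using arith unfolding arith_def by metis

lemma pred_ex: "\<zero> \<lless> x \<Longrightarrow> \<exists>y. y \<lless> x \<and> suc y = x"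
  using arith unfolding arith_def by metis

lemma pair_ex: "\<zero> \<lless> x \<Longrightarrow> \<exists>y z. y \<lless> x \<and> z \<lless> x \<and> \<langle>y, z\<rangle> = x"
  using arith unfolding arith_def by metis

lemma pair_nonzero [simp]: "\<langle>x, y\<rangle> \<noteq> \<zero>" "\<zero> \<noteq> \<langle>x, y\<rangle>"
proof -
  have "\<langle>x, y\<rangle> = \<zero> \<longrightarrow> suc (suc \<zero>) \<otimes> \<zero> = (x \<oplus> y) \<otimes> (x \<oplus> y \<oplus> suc \<zero>) \<oplus> suc (suc \<zero>) \<otimes> x \<oplus> suc (suc \<zero>)"
    using arith unfolding arith_def by blast
  then show "\<langle>x, y\<rangle> \<noteq> \<zero>" by auto
  then show "\<zero> \<noteq> \<langle>x, y\<rangle>" by metis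
qed


subsection \<open>Definability\<close>

text \<open>
  Predicates and functions of an environment \<open>e\<close>. All elements and all sets of the countable
  model are available as parameters: the odd number variables enumerate the elements and the
  set variables enumerate \<open>S\<close>, while \<open>e i\<close> is the number variable \<open>2 * i\<close>.
\<close>

definition mix :: "(nat \<Rightarrow> 'm) \<Rightarrow> nat \<Rightarrow> 'm" where
  "mix e i = (if even i then e (i div 2) else from_nat_into UNIV (i div 2))"

definition D :: "((nat \<Rightarrow> 'm) \<Rightarrow> bool) \<Rightarrow> bool" where
  "D P \<longleftrightarrow> (\<exists>\<phi>. delta00 \<phi> \<and> (\<forall>e. sat M S (mix e) (from_nat_into S) \<phi> \<longleftrightarrow> P e))"

definition Tm :: "((nat \<Rightarrow> 'm) \<Rightarrow> 'm) \<Rightarrow> bool" where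
  "Tm f \<longleftrightarrow> (\<exists>t. \<forall>e. tval M (mix e) t = f e)"

lemma Tm_var: "Tm (\<lambda>e. e i)"
  unfolding Tm_def by (rule exI[of _ "Var (2 * i)"]) (simp add: mix_def)

lemma Tm_const: "Tm (\<lambda>e. a)"
proof -
  obtain n where "from_nat_into (UNIV :: 'm set) n = a"
    using from_nat_into_surj[OF countable_M] by blast
  then show ?thesis
    unfolding Tm_def by (intro exI[of _ "Var (Suc (2 * n))"]) (simp add: mix_def)
qed

lemma Tm_suc: "Tm f \<Longrightarrow> Tm (\<lambda>e. suc (f e))"
  unfolding Tm_def by (metis tval.simps(3))

lemma Tm_hd: "Tm f \<Longrightarrow> Tm (\<lambda>e. head (f e))"
  unfolding Tm_def by (metis tval.simps(4))

lemma Tm_tl: "Tm f \<Longrightarrow> Tm (\<lambda>e. tail (f e))"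
  unfolding Tm_def by (metis tval.simps(5))

lemma Tm_add: "Tm f \<Longrightarrow> Tm g \<Longrightarrow> Tm (\<lambda>e. f e \<oplus> g e)"
  unfolding Tm_def by (metis tval.simps(6))

lemma Tm_mul: "Tm f \<Longrightarrow> Tm g \<Longrightarrow> Tm (\<lambda>e. f e \<otimes> g e)"
  unfolding Tm_def by (metis tval.simps(7))

lemma Tm_pair: "Tm f \<Longrightarrow> Tm g \<Longrightarrow> Tm (\<lambda>e. \<langle>f e, g e\<rangle>)"
  unfolding Tm_def by (metis tval.simps(8))

lemmas Tm_rules = Tm_var Tm_const Tm_suc Tm_hd Tm_tl Tm_add Tm_mul Tm_pair

lemma Tm_case_nat: "Tm a \<Longrightarrow> (\<And>i. Tm (b i)) \<Longrightarrow> Tm (case_nat a b i)"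
  by (cases i) simp_all

lemma ex_mix_subst:
  assumes "\<And>i. Tm (u i)"
  shows "\<exists>\<sigma>. \<forall>e. (\<lambda>i. tval M (mix e) (\<sigma> i)) = mix (\<lambda>i. u i e)"
proof -
  obtain t where t: "\<And>i e. tval M (mix e) (t i) = u i e"
    using assms unfolding Tm_def by metis
  have "(\<lambda>i. tval M (mix e) (if even i then t (i div 2) else Var i)) = mix (\<lambda>i. u i e)" for e
    by (auto simp: fun_eq_iff t mix_def)
  then show ?thesis by (intro exI allI)
qed

lemma Tm_comp:
  assumes "Tm f" "\<And>i. Tm (u i)" shows "Tm (\<lambda>e. f (\<lambda>i. u i e))"
proof -
  obtain \<sigma> where \<sigma>: "\<And>e. (\<lambda>i. tval M (mix e) (\<sigma> i)) = mix (\<lambda>i. u i e)"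
    using ex_mix_subst[of u] assms(2) by blast
  obtain t where "\<And>e. tval M (mix e) t = f e" using assms(1) unfolding Tm_def by blast
  then have "tval M (mix e) (tsubst \<sigma> t) = f (\<lambda>i. u i e)" for e by (simp add: tval_tsubst \<sigma>)
  then show ?thesis unfolding Tm_def by blast
qed

lemma D_comp:
  assumes "D P" "\<And>i. Tm (u i)" shows "D (\<lambda>e. P (\<lambda>i. u i e))"
proof -
  obtain \<sigma> where \<sigma>: "\<And>e. (\<lambda>i. tval M (mix e) (\<sigma> i)) = mix (\<lambda>i. u i e)"
    using ex_mix_subst[of u] assms(2) by blast
  obtain \<phi> where "delta00 \<phi>" "\<And>e. sat M S (mix e) (from_nat_into S) \<phi> \<longleftrightarrow> P e"
    using assms(1) unfolding D_def by blast
  then have "sat M S (mix e) (from_nat_into S) (subst \<sigma> id \<phi>) \<longleftrightarrow> P (\<lambda>i. u i e)" for e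
    by (simp add: sat_subst \<sigma>)
  then show ?thesis unfolding D_def using delta00_subst[OF \<open>delta00 \<phi>\<close>] by blast
qed

lemma D_dep:
  assumes "D P" shows "\<exists>k. \<forall>e e'. (\<forall>i<k. e i = e' i) \<longrightarrow> P e = P e'"
proof -
  obtain \<phi> where \<phi>: "\<And>e. sat M S (mix e) (from_nat_into S) \<phi> \<longleftrightarrow> P e"
    using assms(1) unfolding D_def by blast
  have "P e = P e'" if "\<forall>i<nbound \<phi>. e i = e' i" for e e'
    unfolding \<phi>[symmetric] using that by (intro sat_cong) (auto simp: mix_def)
  then show ?thesis by blast
qed

lemma Tm_D_eq: "Tm f \<Longrightarrow> Tm g \<Longrightarrow> D (\<lambda>e. f e = g e)"
  unfolding D_def Tm_def using delta00.intros(1) sat.simps(1) by metis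

lemma Tm_D_less: "Tm f \<Longrightarrow> Tm g \<Longrightarrow> D (\<lambda>e. f e \<lless> g e)"
  unfolding D_def Tm_def using delta00.intros(2) sat.simps(2) by metis

lemma Tm_D_mem: "A \<in> S \<Longrightarrow> Tm f \<Longrightarrow> D (\<lambda>e. f e \<in> A)"
  unfolding D_def Tm_def using delta00.intros(3) sat.simps(3) from_nat_into_surj[OF countable_S]
  by metis

lemma D_imp: "D P \<Longrightarrow> D Q \<Longrightarrow> D (\<lambda>e. P e \<longrightarrow> Q e)"
  unfolding D_def using delta00.intros(5) sat.simps(5) by metis

lemma D_and: "D P \<Longrightarrow> D Q \<Longrightarrow> D (\<lambda>e. P e \<and> Q e)"
  unfolding D_def using delta00.intros(6) sat.simps(6) by metis

lemma D_or: "D P \<Longrightarrow> D Q \<Longrightarrow> D (\<lambda>e. P e \<or> Q e)"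
  unfolding D_def using delta00.intros(7) sat.simps(7) by metis

lemma D_bool: "D (\<lambda>e. b)"
proof (cases b)
  case True
  have "D (\<lambda>e. \<zero> = \<zero>)" by (intro Tm_D_eq Tm_rules)
  then show ?thesis using True by simp
next
  case False
  have "D (\<lambda>e. \<zero> = suc \<zero>)" by (intro Tm_D_eq Tm_rules)
  then show ?thesis using False by simp
qed

lemma D_not: "D P \<Longrightarrow> D (\<lambda>e. \<not> P e)"
  using D_imp[OF _ D_bool[of False]] by simp

lemma D_iff: "D P \<Longrightarrow> D Q \<Longrightarrow> D (\<lambda>e. P e \<longleftrightarrow> Q e)"
  unfolding iff_conv_conj_imp by (intro D_and D_imp)

text \<open>A binder shifts all indices by one and so exchanges odd and even ones. The renaming
  restores the convention: the bound variable becomes the first entry of the environment, and each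
  parameter keeps its meaning.\<close>

lemma ex_mix_shift:
  assumes "delta00 \<phi>" "\<And>e. sat M S (mix e) (from_nat_into S) \<phi> \<longleftrightarrow> P (\<lambda>i. e (Suc i)) (e 0)"
  shows "\<exists>\<psi>. delta00 \<psi> \<and> (\<forall>e y. sat M S (case_nat y (mix e)) (from_nat_into S) \<psi> \<longleftrightarrow> P e y)"
proof (intro exI conjI allI)
  let ?\<sigma> = "case_nat (Var 0) (\<lambda>i. Var (if even i then Suc (Suc i) else i))"
  show "delta00 (subst ?\<sigma> id \<phi>)" using assms(1) by (rule delta00_subst)
  fix e y
  have "(\<lambda>i. tval M (case_nat y (mix e)) (?\<sigma> i)) = mix (case_nat y e)"
  proof
    fix i
    show "tval M (case_nat y (mix e)) (?\<sigma> i) = mix (case_nat y e) i"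
    proof (cases i)
      case (Suc j)
      then show ?thesis by (cases j) (auto simp: mix_def elim!: oddE evenE)
    qed (simp add: mix_def)
  qed
  then show "sat M S (case_nat y (mix e)) (from_nat_into S) (subst ?\<sigma> id \<phi>) \<longleftrightarrow> P e y"
    by (simp add: sat_subst assms(2))
qed

lemma Tm_D_all:
  assumes "Tm f" "D (\<lambda>e. P (\<lambda>i. e (Suc i)) (e 0))"
  shows "D (\<lambda>e. \<forall>y. y \<lless> f e \<longrightarrow> P e y)"
proof -
  obtain \<psi> where \<psi>: "delta00 \<psi>" "\<And>e y. sat M S (case_nat y (mix e)) (from_nat_into S) \<psi> \<longleftrightarrow> P e y"
    using assms(2) ex_mix_shift[of _ P] unfolding D_def by blast
  obtain t where "\<And>e. tval M (mix e) t = f e" using assms(1) unfolding Tm_def by blast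
  then have "sat M S (mix e) (from_nat_into S) (AllLess t \<psi>) \<longleftrightarrow> (\<forall>y. y \<lless> f e \<longrightarrow> P e y)" for e
    by (simp add: \<psi>)
  then show ?thesis unfolding D_def using delta00.intros(8)[OF \<psi>(1)] by blast
qed

lemma set_if_D:
  assumes "D (\<lambda>e. P (e 0))" shows "{x. P x} \<in> S"
proof -
  obtain \<phi> where \<phi>: "delta00 \<phi>" "\<And>e. sat M S (mix e) (from_nat_into S) \<phi> \<longleftrightarrow> P (e 0)"
    using assms unfolding D_def by blast
  \<comment> \<open>The formula may mention further even variables; all of them are set to the
    element variable, while the parameters are moved past the new binder.\<close>
  let ?\<sigma> = "\<lambda>i. if even i then Var 0 else Var (Suc i)" and ?e = "mix (\<lambda>_. \<zero>)"
  have "(\<lambda>i. tval M (case_nat x ?e) (?\<sigma> i)) = mix (\<lambda>_. x)" for x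
    by (auto simp: mix_def fun_eq_iff)
  then have "sat M S (case_nat x ?e) (from_nat_into S) (subst ?\<sigma> id \<phi>) \<longleftrightarrow> P x" for x
    by (simp add: sat_subst \<phi>)
  moreover have "range (from_nat_into S) \<subseteq> S" using from_nat_into[OF nonempty] by blast
  ultimately show ?thesis
    using compr[OF delta00_subst[OF \<phi>(1)], of "from_nat_into S" ?e ?\<sigma> id] by simp
qed


subsection \<open>Functions of the model\<close>

text \<open>
  A function is available if its graph is definable. By the composition axiom such functions can
  be used like terms (lemma \<open>D_subst\<close>), which amounts to \<open>\<Delta>\<^sup>0\<^sub>1\<close> comprehension.
\<close>

definition FT :: "((nat \<Rightarrow> 'm) \<Rightarrow> 'm) \<Rightarrow> bool" where
  "FT f \<longleftrightarrow> D (\<lambda>e. e 0 = f (\<lambda>i. e (Suc i)))"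

text \<open>A definable predicate depends on a standard number \<open>k\<close> of variables, so
  iterated pairing suffices to code the relevant part of an environment, without sequence coding
  inside the model.\<close>

primrec code :: "nat \<Rightarrow> (nat \<Rightarrow> 'm) \<Rightarrow> 'm" where
  "code 0 e = \<zero>"
| "code (Suc k) e = \<langle>e 0, code k (\<lambda>i. e (Suc i))\<rangle>"

definition dec :: "'m \<Rightarrow> nat \<Rightarrow> 'm" where
  "dec x i = head ((tail ^^ i) x)"

lemma dec_code: "i < k \<Longrightarrow> dec (code k e) i = e i"
proof (induction k arbitrary: i e)
  case (Suc k)
  then show ?case by (cases i) (simp_all add: dec_def funpow_swap1[of tail])
qed simp

lemma Tm_code: "Tm (code k)"
proof (induction k)
  case (Suc k)
  show ?case unfolding code.simps by (intro Tm_rules Tm_comp[OF Suc])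
qed (simp add: Tm_const)

lemma Tm_dec: "Tm f \<Longrightarrow> Tm (\<lambda>e. dec (f e) i)"
proof -
  assume "Tm f"
  then have "Tm (\<lambda>e. (tail ^^ i) (f e))" by (induction i) (auto intro: Tm_tl)
  then show ?thesis unfolding dec_def by (rule Tm_hd)
qed

lemma FT_dep:
  assumes "FT f" shows "\<exists>k. \<forall>e e'. (\<forall>i<k. e i = e' i) \<longrightarrow> f e = f e'"
proof -
  obtain k where k: "\<And>e e'. \<forall>i<k. e i = e' i \<Longrightarrow>
      e 0 = f (\<lambda>i. e (Suc i)) \<longleftrightarrow> e' 0 = f (\<lambda>i. e' (Suc i))"
    using D_dep[OF assms[unfolded FT_def]] by blast
  have "f e = f e'" if "\<forall>i<k. e i = e' i" for e e'
    using k[of "case_nat (f e) e" "case_nat (f e) e'"] that by (simp split: nat.split)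
  then show ?thesis by blast
qed

text \<open>The composition axiom produces the characteristic function of the predicate:
  \<open>h\<close> sends \<open>x\<close> to the pair of \<open>x\<close> and
  \<open>f (dec x)\<close>, and \<open>g\<close> evaluates \<open>Q\<close> on such a pair.
  Membership of one pair in the composite \<open>F\<close> then replaces an unbounded quantifier
  over the value of \<open>f\<close>.\<close>

lemma D_subst_env:
  assumes "FT f" "D Q" shows "D (\<lambda>e. Q (case_nat (f e) e))"
proof -
  obtain k where k: "\<And>e e'. \<forall>i<k. e i = e' i \<Longrightarrow> f e = f e'" using FT_dep[OF assms(1)] by blast
  obtain l where l: "\<And>e e'. \<forall>i<l. e i = e' i \<Longrightarrow> Q e = Q e'" using D_dep[OF assms(2)] by blast
  \<comment> \<open>Since \<open>head \<zero>\<close> and \<open>tail \<zero>\<close> are zero, the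
    first two conjuncts ensure that \<open>w\<close> and its second component are genuine
    pairs.\<close>
  define h where "h = {w. w \<noteq> \<zero> \<and> tail w \<noteq> \<zero> \<and> head (tail w) = head w \<and> tail (tail w) = f (dec (head w))}"
  define g where "g = {w. w \<noteq> \<zero> \<and> (Q (case_nat (tail (head w)) (dec (head (head w)))) \<longrightarrow> tail w = suc \<zero>) \<and>
    (\<not> Q (case_nat (tail (head w)) (dec (head (head w)))) \<longrightarrow> tail w = \<zero>)}"
  have h_D: "D (\<lambda>e. tail (tail (e 0)) = f (dec (head (e 0))))"
  proof -
    let ?u = "case_nat (\<lambda>e. tail (tail (e 0))) (\<lambda>i e. dec (head (e 0)) i)"
    have "D (\<lambda>e. ?u 0 e = f (\<lambda>i. ?u (Suc i) e))"
      by (rule D_comp[OF assms(1)[unfolded FT_def], of ?u])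
        (intro Tm_case_nat Tm_rules Tm_dec)
    then show ?thesis by simp
  qed
  have "h \<in> S" unfolding h_def
    by (intro set_if_D D_and D_not; (rule h_D | (rule Tm_D_eq; intro Tm_rules)))
  have "D (\<lambda>e. Q (case_nat (tail (head (e 0))) (dec (head (head (e 0))))))"
  proof -
    let ?u = "case_nat (\<lambda>e. tail (head (e 0))) (\<lambda>i e. dec (head (head (e 0))) i)"
    have "D (\<lambda>e. Q (\<lambda>i. ?u i e))"
      by (rule D_comp[OF assms(2), of ?u]) (intro Tm_case_nat Tm_rules Tm_dec)
    moreover have "(\<lambda>i. ?u i e) = case_nat (tail (head (e 0))) (dec (head (head (e 0))))"
      for e :: "nat \<Rightarrow> 'm"
      by (auto split: nat.split)
    ultimately show ?thesis by (simp only:)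
  qed
  then have "g \<in> S" unfolding g_def
    by (intro set_if_D D_and D_not D_imp Tm_D_eq Tm_rules)
  have hI: "\<langle>x, \<langle>x, f (dec x)\<rangle>\<rangle> \<in> h" for x by (simp add: h_def)
  have "func M h" unfolding func_def
  proof (intro conjI allI impI)
    show "\<exists>y. \<langle>x, y\<rangle> \<in> h" for x using hI by blast
    have "y = \<langle>x, f (dec x)\<rangle>" if "\<langle>x, y\<rangle> \<in> h" for x y
    proof -
      have "y \<noteq> \<zero>" "head y = x" "tail y = f (dec x)" using that by (auto simp: h_def)
      moreover obtain a b where "y = \<langle>a, b\<rangle>"
        using pair_ex[of y] linear[of \<zero> y] \<open>y \<noteq> \<zero>\<close> basic(8) by metis
      ultimately show ?thesis by simp
    qed
    then show "y = y'" if "\<langle>x, y\<rangle> \<in> h \<and> \<langle>x, y'\<rangle> \<in> h" for x y y' using that by blast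
    show "\<zero> \<notin> h" by (simp add: h_def)
  qed
  have "func M g" unfolding func_def
  proof (intro conjI allI impI)
    show "\<exists>y. \<langle>x, y\<rangle> \<in> g" for x
      by (cases "Q (case_nat (tail x) (dec (head x)))") (auto simp: g_def)
    show "y = y'" if "\<langle>x, y\<rangle> \<in> g \<and> \<langle>x, y'\<rangle> \<in> g" for x y y'
      using that by (cases "Q (case_nat (tail x) (dec (head x)))") (auto simp: g_def)
    show "\<zero> \<notin> g" by (simp add: g_def)
  qed
  obtain F where F: "F \<in> S" "func M F" "\<And>x y z. \<langle>x, z\<rangle> \<in> h \<Longrightarrow> \<langle>z, y\<rangle> \<in> g \<Longrightarrow> \<langle>x, y\<rangle> \<in> F"
    using comp[OF \<open>g \<in> S\<close> \<open>h \<in> S\<close> \<open>func M g\<close> \<open>func M h\<close>] by blast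
  have F1: "\<langle>x, suc \<zero>\<rangle> \<in> F \<longleftrightarrow> Q (case_nat (f (dec x)) (dec x))" for x
  proof (cases "Q (case_nat (f (dec x)) (dec x))")
    case True
    then have "\<langle>\<langle>x, f (dec x)\<rangle>, suc \<zero>\<rangle> \<in> g" by (simp add: g_def)
    then show ?thesis using F(3) hI True by blast
  next
    case False
    then have "\<langle>\<langle>x, f (dec x)\<rangle>, \<zero>\<rangle> \<in> g" by (simp add: g_def)
    then have "\<langle>x, \<zero>\<rangle> \<in> F" using F(3) hI by blast
    then have "\<langle>x, suc \<zero>\<rangle> \<notin> F" using F(2) basic(1) unfolding func_def by metis
    then show ?thesis using False by blast
  qed
  \<comment> \<open>Both \<open>f\<close> and \<open>Q\<close> look at fewer than
    \<open>max k l\<close> entries of \<open>e\<close>, or exactly that many, so decoding the code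
    of \<open>e\<close> does not change their values.\<close>
  let ?c = "code (max k l)"
  have dec: "dec (?c e) i = e i" if "i < max k l" for e i using dec_code that by blast
  have "D (\<lambda>e. \<langle>?c e, suc \<zero>\<rangle> \<in> F)" by (intro Tm_D_mem F(1) Tm_rules Tm_code)
  moreover have "\<langle>?c e, suc \<zero>\<rangle> \<in> F \<longleftrightarrow> Q (case_nat (f e) e)" for e
  proof -
    have "f (dec (?c e)) = f e" by (rule k) (simp add: dec)
    moreover have "Q (case_nat (f e) (dec (?c e))) = Q (case_nat (f e) e)"
      by (rule l) (auto simp: dec split: nat.split)
    ultimately show ?thesis by (simp add: F1)
  qed
  ultimately show ?thesis by simp
qed

lemma D_subst:
  assumes "FT f" "D (\<lambda>e. P (\<lambda>i. e (Suc i)) (e 0))" shows "D (\<lambda>e. P e (f e))"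
  using D_subst_env[OF assms] by simp

lemma D_shift: "D P \<Longrightarrow> D (\<lambda>e. P (\<lambda>i. e (Suc i)))"
  by (erule D_comp[where u = "\<lambda>i e. e (Suc i)"]) (rule Tm_var)

lemma D_shift1: "D (\<lambda>e. P (\<lambda>i. e (Suc i)) (e 0)) \<Longrightarrow> D (\<lambda>e. P (\<lambda>i. e (Suc (Suc i))) (e 0))"
  using D_comp[of "\<lambda>e. P (\<lambda>i. e (Suc i)) (e 0)" "case_nat (\<lambda>e. e 0) (\<lambda>i e. e (Suc (Suc i)))"]
  by (simp add: Tm_case_nat Tm_var)

lemma FT_Tm: "Tm f \<Longrightarrow> FT f"
  unfolding FT_def by (rule Tm_D_eq[OF Tm_var Tm_comp]) (auto intro: Tm_var)

lemma FT_comp: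
  assumes "FT f" "\<And>i. Tm (u i)" shows "FT (\<lambda>e. f (\<lambda>i. u i e))"
proof -
  let ?u = "case_nat (\<lambda>e. e 0) (\<lambda>i e. u i (\<lambda>j. e (Suc j)))"
  have "D (\<lambda>e. ?u 0 e = f (\<lambda>i. ?u (Suc i) e))"
    by (rule D_comp[OF assms(1)[unfolded FT_def], of ?u])
      (intro Tm_case_nat Tm_var Tm_comp[OF assms(2), of "\<lambda>j e. e (Suc j)"])
  then show ?thesis unfolding FT_def by simp
qed

lemma FT_shift: "FT f \<Longrightarrow> FT (\<lambda>e. f (\<lambda>i. e (Suc i)))"
  by (erule FT_comp[where u = "\<lambda>i e. e (Suc i)"]) (rule Tm_var)

lemma FT_subst:
  assumes "FT f" "FT (\<lambda>e. g (\<lambda>i. e (Suc i)) (e 0))" shows "FT (\<lambda>e. g e (f e))"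
proof -
  let ?u = "case_nat (\<lambda>e. e (Suc 0)) (case_nat (\<lambda>e. e 0) (\<lambda>i e. e (Suc (Suc i))))"
  have "D (\<lambda>e. ?u 0 e = g (\<lambda>i. ?u (Suc (Suc i)) e) (?u (Suc 0) e))"
    by (rule D_comp[OF assms(2)[unfolded FT_def], of ?u]) (intro Tm_case_nat Tm_var)
  then have "D (\<lambda>e. e (Suc 0) = g (\<lambda>i. e (Suc (Suc i))) (e 0))" by simp
  then show ?thesis unfolding FT_def
    by (rule D_subst[OF FT_shift[OF assms(1)], where P = "\<lambda>e y. e 0 = g (\<lambda>i. e (Suc i)) y"])
qed

lemma FT_app1: "FT (\<lambda>e. g (e 0)) \<Longrightarrow> FT f \<Longrightarrow> FT (\<lambda>e. g (f e))"
  by (rule FT_subst[where g = "\<lambda>e. g"])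

lemma FT_app2:
  assumes "FT (\<lambda>e. h (e 0) (e (Suc 0)))" "FT f" "FT g" shows "FT (\<lambda>e. h (f e) (g e))"
proof (rule FT_subst[OF assms(2), where g = "\<lambda>e y. h y (g e)"])
  show "FT (\<lambda>e. h (e 0) (g (\<lambda>i. e (Suc i))))"
  proof (rule FT_subst[OF FT_shift[OF assms(3)], where g = "\<lambda>e y. h (e 0) y"])
    show "FT (\<lambda>e. h (e (Suc 0)) (e 0))"
      using FT_comp[OF assms(1), of "case_nat (\<lambda>e. e (Suc 0)) (\<lambda>i e. e 0)"]
      by (simp add: Tm_case_nat Tm_var)
  qed
qed

lemma D_app1: "D (\<lambda>e. P (e 0)) \<Longrightarrow> FT f \<Longrightarrow> D (\<lambda>e. P (f e))"
  by (rule D_subst[where P = "\<lambda>e. P"])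

lemma D_app2:
  assumes "D (\<lambda>e. R (e 0) (e (Suc 0)))" "FT f" "FT g" shows "D (\<lambda>e. R (f e) (g e))"
proof (rule D_subst[OF assms(2), where P = "\<lambda>e y. R y (g e)"])
  show "D (\<lambda>e. R (e 0) (g (\<lambda>i. e (Suc i))))"
  proof (rule D_subst[OF FT_shift[OF assms(3)], where P = "\<lambda>e y. R (e 0) y"])
    show "D (\<lambda>e. R (e (Suc 0)) (e 0))"
      using D_comp[OF assms(1), of "case_nat (\<lambda>e. e (Suc 0)) (\<lambda>i e. e 0)"]
      by (simp add: Tm_case_nat Tm_var)
  qed
qed

lemma D_mem: "A \<in> S \<Longrightarrow> FT f \<Longrightarrow> D (\<lambda>e. f e \<in> A)"
  by (rule D_app1) (intro Tm_D_mem Tm_rules)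

lemma D_eq: "FT f \<Longrightarrow> FT g \<Longrightarrow> D (\<lambda>e. f e = g e)"
  by (rule D_app2) (intro Tm_D_eq Tm_rules)

lemma D_less: "FT f \<Longrightarrow> FT g \<Longrightarrow> D (\<lambda>e. f e \<lless> g e)"
  by (rule D_app2) (intro Tm_D_less Tm_rules)

lemma D_all:
  assumes "FT f" "D (\<lambda>e. P (\<lambda>i. e (Suc i)) (e 0))"
  shows "D (\<lambda>e. \<forall>y. y \<lless> f e \<longrightarrow> P e y)"
proof (rule D_subst[OF assms(1), where P = "\<lambda>e z. \<forall>y. y \<lless> z \<longrightarrow> P e y"])
  show "D (\<lambda>e. \<forall>y. y \<lless> e 0 \<longrightarrow> P (\<lambda>i. e (Suc i)) y)"
    by (intro Tm_D_all Tm_rules D_shift1 assms(2))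
qed

lemma D_ex:
  assumes "FT f" "D (\<lambda>e. P (\<lambda>i. e (Suc i)) (e 0))"
  shows "D (\<lambda>e. \<exists>y. y \<lless> f e \<and> P e y)"
proof -
  have "D (\<lambda>e. \<not> (\<forall>y. y \<lless> f e \<longrightarrow> \<not> P e y))" by (intro D_not D_all assms)
  then show ?thesis by simp
qed

lemma D_all_le:
  assumes "FT f" "D (\<lambda>e. P (\<lambda>i. e (Suc i)) (e 0))"
  shows "D (\<lambda>e. \<forall>y. y \<lesssim> f e \<longrightarrow> P e y)"
proof -
  have "FT (\<lambda>e. suc (f e))" by (rule FT_app1[OF _ assms(1)]) (intro FT_Tm Tm_rules)
  from D_all[OF this assms(2)] show ?thesis by simp
qed

lemma D_ex_le:
  assumes "FT f" "D (\<lambda>e. P (\<lambda>i. e (Suc i)) (e 0))"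
  shows "D (\<lambda>e. \<exists>y. y \<lesssim> f e \<and> P e y)"
proof -
  have "FT (\<lambda>e. suc (f e))" by (rule FT_app1[OF _ assms(1)]) (intro FT_Tm Tm_rules)
  from D_ex[OF this assms(2)] show ?thesis by simp
qed

lemma FT_suc: "FT f \<Longrightarrow> FT (\<lambda>e. suc (f e))"
  by (rule FT_app1) (intro FT_Tm Tm_rules)

lemma FT_hd: "FT f \<Longrightarrow> FT (\<lambda>e. head (f e))"
  by (rule FT_app1) (intro FT_Tm Tm_rules)

lemma FT_tl: "FT f \<Longrightarrow> FT (\<lambda>e. tail (f e))"
  by (rule FT_app1) (intro FT_Tm Tm_rules)

lemma FT_add: "FT f \<Longrightarrow> FT g \<Longrightarrow> FT (\<lambda>e. f e \<oplus> g e)"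
  by (rule FT_app2) (intro FT_Tm Tm_rules)

lemma FT_mul: "FT f \<Longrightarrow> FT g \<Longrightarrow> FT (\<lambda>e. f e \<otimes> g e)"
  by (rule FT_app2) (intro FT_Tm Tm_rules)

lemma FT_pair: "FT f \<Longrightarrow> FT g \<Longrightarrow> FT (\<lambda>e. \<langle>f e, g e\<rangle>)"
  by (rule FT_app2) (intro FT_Tm Tm_rules)

lemmas FT_var = FT_Tm[OF Tm_var]
lemmas FT_const = FT_Tm[OF Tm_const]

lemmas D_rules = D_bool D_all D_ex D_all_le D_ex_le D_eq D_less D_mem D_not D_iff D_and D_or D_imp
  FT_var FT_const FT_suc FT_hd FT_tl FT_add FT_mul FT_pair

end


context rca
begin

subsection \<open>Arithmetic\<close>

lemma induct_D:
  assumes "D (\<lambda>e. P (e 0))" "P \<zero>" "\<And>x. P x \<Longrightarrow> P (suc x)"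
  shows "P x"
  using set_induct[OF set_if_D[OF assms(1)]] assms(2,3) by blast

lemma zero_add [simp]: "\<zero> \<oplus> x = x"
  by (rule induct_D[where P = "\<lambda>x. \<zero> \<oplus> x = x"], intro D_rules) auto

lemma suc_add [simp]: "suc x \<oplus> y = suc (x \<oplus> y)"
  by (rule induct_D[where P = "\<lambda>y. suc x \<oplus> y = suc (x \<oplus> y)"], intro D_rules) auto

lemma add_comm: "x \<oplus> y = y \<oplus> x"
  by (rule induct_D[where P = "\<lambda>y. x \<oplus> y = y \<oplus> x"], intro D_rules) auto

lemma add_assoc: "x \<oplus> y \<oplus> z = x \<oplus> (y \<oplus> z)"
  by (rule induct_D[where P = "\<lambda>z. x \<oplus> y \<oplus> z = x \<oplus> (y \<oplus> z)"], intro D_rules) auto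

lemma add_left_comm: "y \<oplus> (x \<oplus> z) = x \<oplus> (y \<oplus> z)"
  by (metis add_assoc add_comm)

lemmas add_ac = add_comm add_assoc add_left_comm

lemma zero_mul [simp]: "\<zero> \<otimes> x = \<zero>"
  by (rule induct_D[where P = "\<lambda>x. \<zero> \<otimes> x = \<zero>"], intro D_rules) auto

lemma suc_mul [simp]: "suc x \<otimes> y = x \<otimes> y \<oplus> y"
  by (rule induct_D[where P = "\<lambda>y. suc x \<otimes> y = x \<otimes> y \<oplus> y"], intro D_rules) (auto simp: add_ac)

lemma mul_add: "x \<otimes> (y \<oplus> z) = x \<otimes> y \<oplus> x \<otimes> z"
  by (rule induct_D[where P = "\<lambda>z. x \<otimes> (y \<oplus> z) = x \<otimes> y \<oplus> x \<otimes> z"], intro D_rules)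
    (auto simp: add_ac)

lemma suc_le: "x \<lless> y \<Longrightarrow> suc x \<lesssim> y"
proof -
  have "x \<lless> y \<longrightarrow> suc x \<lesssim> y"
    by (rule induct_D[where P = "\<lambda>y. x \<lless> y \<longrightarrow> suc x \<lesssim> y"], intro D_rules) auto
  then show "x \<lless> y \<Longrightarrow> suc x \<lesssim> y" by blast
qed

lemma suc_lessD: "suc x \<lless> y \<Longrightarrow> x \<lless> y"
proof -
  have "suc x \<lless> y \<longrightarrow> x \<lless> y"
    by (rule induct_D[where P = "\<lambda>y. suc x \<lless> y \<longrightarrow> x \<lless> y"], intro D_rules) auto
  then show "suc x \<lless> y \<Longrightarrow> x \<lless> y" by blast
qed

lemma suc_less_suc: "suc x \<lless> suc y \<longleftrightarrow> x \<lless> y"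
  using suc_lessD[of x y] suc_le[of x y] by auto

lemma irrefl [simp]: "\<not> x \<lless> x"
  by (rule induct_D[where P = "\<lambda>x. \<not> x \<lless> x"], intro D_rules)
    (auto simp del: basic(9) simp: suc_less_suc)

lemma less_trans: "x \<lless> y \<Longrightarrow> y \<lless> z \<Longrightarrow> x \<lless> z"
proof -
  have "x \<lless> y \<longrightarrow> y \<lless> z \<longrightarrow> x \<lless> z"
    by (rule induct_D[where P = "\<lambda>z. x \<lless> y \<longrightarrow> y \<lless> z \<longrightarrow> x \<lless> z"], intro D_rules) auto
  then show "x \<lless> y \<Longrightarrow> y \<lless> z \<Longrightarrow> x \<lless> z" by blast
qed

lemma zero_le: "\<zero> \<lesssim> x"
  using linear[of \<zero> x] by auto

lemma zero_less: "x \<noteq> \<zero> \<Longrightarrow> \<zero> \<lless> x"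
  using zero_le[of x] by auto

lemma not_less: "\<not> x \<lless> y \<longleftrightarrow> y \<lesssim> x"
  using linear[of x y] less_trans[of x y x] by auto

lemma le_less_trans: "x \<lesssim> y \<Longrightarrow> y \<lless> z \<Longrightarrow> x \<lless> z"
  using less_trans by auto

lemma less_le_trans: "x \<lless> y \<Longrightarrow> y \<lesssim> z \<Longrightarrow> x \<lless> z"
  using less_trans by auto

lemma le_trans: "x \<lesssim> y \<Longrightarrow> y \<lesssim> z \<Longrightarrow> x \<lesssim> z"
  using less_trans by auto

lemma add_less: "x \<oplus> z \<lless> y \<oplus> z \<longleftrightarrow> x \<lless> y"
  by (rule induct_D[where P = "\<lambda>z. x \<oplus> z \<lless> y \<oplus> z \<longleftrightarrow> x \<lless> y"], intro D_rules)
    (auto simp del: basic(9) simp: suc_less_suc)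

lemma add_mono: "x \<lesssim> y \<Longrightarrow> z \<lesssim> w \<Longrightarrow> x \<oplus> z \<lesssim> y \<oplus> w"
  using add_less[of x z y] add_less[of z y w] less_trans[of "x \<oplus> z" "y \<oplus> z" "y \<oplus> w"]
  by (auto simp: add_comm)

lemma le_add: "x \<lesssim> x \<oplus> y" "x \<lesssim> y \<oplus> x"
  using add_mono[of x x \<zero> y] zero_le[of y] by (auto simp: add_comm[of y])

lemma suc_exE:
  assumes "x \<noteq> \<zero>" obtains y where "x = suc y"
  using pred_ex[OF zero_less[OF assms]] by auto

lemma two_mul: "suc (suc \<zero>) \<otimes> x = x \<oplus> x"
  by simp

lemma less_double:
  assumes "x \<lless> y" shows "suc (x \<oplus> x) \<lless> y \<oplus> y"
proof -
  have "suc x \<oplus> suc x \<lesssim> y \<oplus> y" using suc_le[OF assms] by (intro add_mono) auto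
  then show ?thesis using less_le_trans[of "suc (x \<oplus> x)" "suc x \<oplus> suc x"] by simp
qed

lemma parity_unique:
  assumes "x \<oplus> x \<oplus> b = y \<oplus> y \<oplus> c" "b = \<zero> \<or> b = suc \<zero>" "c = \<zero> \<or> c = suc \<zero>"
  shows "x = y"
proof -
  have "\<not> x \<lless> y"
    if "x \<oplus> x \<oplus> b = y \<oplus> y \<oplus> c" "b = \<zero> \<or> b = suc \<zero>" "c = \<zero> \<or> c = suc \<zero>" for x y b c
  proof
    assume "x \<lless> y"
    then have "suc (x \<oplus> x) \<lless> y \<oplus> y" by (rule less_double)
    moreover have "y \<oplus> y \<lesssim> y \<oplus> y \<oplus> c" by (rule le_add)
    moreover have "x \<oplus> x \<oplus> b \<lesssim> suc (x \<oplus> x)" using that(2) by auto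
    ultimately show False using that(1) le_less_trans less_le_trans irrefl by metis
  qed
  from this[OF assms] this[OF assms(1)[symmetric] assms(3,2)] show ?thesis using linear by blast
qed

lemma parity_ex: "\<exists>h b. (b = \<zero> \<or> b = suc \<zero>) \<and> x = h \<oplus> h \<oplus> b \<and> h \<lesssim> x"
proof -
  have "\<exists>h. h \<lesssim> x \<and> (x = h \<oplus> h \<or> x = suc (h \<oplus> h))"
  proof (rule induct_D[where P = "\<lambda>x. \<exists>h. h \<lesssim> x \<and> (x = h \<oplus> h \<or> x = suc (h \<oplus> h))"], intro D_rules)
    fix x assume "\<exists>h. h \<lesssim> x \<and> (x = h \<oplus> h \<or> x = suc (h \<oplus> h))"
    then obtain h where h: "h \<lesssim> x" "x = h \<oplus> h \<or> x = suc (h \<oplus> h)" by blast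
    from h(2) show "\<exists>h. h \<lesssim> suc x \<and> (suc x = h \<oplus> h \<or> suc x = suc (h \<oplus> h))"
    proof
      assume "x = suc (h \<oplus> h)"
      then have "suc x = suc h \<oplus> suc h" by simp
      then show ?thesis using h(1) suc_less_suc[of h x] by blast
    qed (use h(1) in auto)
  qed simp
  then obtain h where "h \<lesssim> x" "x = h \<oplus> h \<oplus> \<zero> \<or> x = h \<oplus> h \<oplus> suc \<zero>" by auto
  then show ?thesis by blast
qed


subsection \<open>Least elements and bounds\<close>

lemma D_fix: "D (\<lambda>e. P (\<lambda>i. e (Suc i)) (e 0)) \<Longrightarrow> D (\<lambda>e'. P e (e' 0))"
  using D_comp[of "\<lambda>e. P (\<lambda>i. e (Suc i)) (e 0)" "case_nat (\<lambda>e'. e' 0) (\<lambda>i _. e i)"]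
  by (simp add: Tm_case_nat Tm_var Tm_const)

lemma FT_fix: "FT (\<lambda>e. f (\<lambda>i. e (Suc i)) (e 0)) \<Longrightarrow> FT (\<lambda>e'. f e (e' 0))"
  using FT_comp[of "\<lambda>e. f (\<lambda>i. e (Suc i)) (e 0)" "case_nat (\<lambda>e'. e' 0) (\<lambda>i _. e i)"]
  by (simp add: Tm_case_nat Tm_var Tm_const)

lemma least_ex:
  assumes "D (\<lambda>e. P (e 0))" "P a"
  shows "\<exists>x. P x \<and> (\<forall>y. y \<lless> x \<longrightarrow> \<not> P y)"
proof (rule ccontr)
  assume *: "\<not> ?thesis"
  have "\<forall>y. y \<lesssim> x \<longrightarrow> \<not> P y" for x
  proof (rule induct_D[where P = "\<lambda>x. \<forall>y. y \<lesssim> x \<longrightarrow> \<not> P y"])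
    show "D (\<lambda>e. \<forall>y. y \<lesssim> e 0 \<longrightarrow> \<not> P y)" by (intro D_rules assms(1))
    show "\<forall>y. y \<lesssim> \<zero> \<longrightarrow> \<not> P y" using * by auto
    show "\<forall>y. y \<lesssim> suc x \<longrightarrow> \<not> P y" if "\<forall>y. y \<lesssim> x \<longrightarrow> \<not> P y" for x
      using * that by (metis basic(9))
  qed
  then show False using assms(2) by blast
qed

lemma less_induct_D:
  assumes "D (\<lambda>e. P (e 0))" "\<And>x. (\<And>y. y \<lless> x \<Longrightarrow> P y) \<Longrightarrow> P x"
  shows "P x"
proof (rule ccontr)
  assume "\<not> P x"
  then obtain z where "\<not> P z" "\<forall>y. y \<lless> z \<longrightarrow> P y"
    using least_ex[of "\<lambda>x. \<not> P x" x, OF D_not[OF assms(1)]] by blast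
  then show False using assms(2) by blast
qed

definition lst :: "('m \<Rightarrow> bool) \<Rightarrow> 'm" where
  "lst P = (THE x. P x \<and> (\<forall>y. y \<lless> x \<longrightarrow> \<not> P y))"

lemma lst_eq:
  assumes "D (\<lambda>e. P (e 0))" "P a"
  shows "x = lst P \<longleftrightarrow> P x \<and> (\<forall>y. y \<lless> x \<longrightarrow> \<not> P y)"
proof -
  have "\<exists>!x. P x \<and> (\<forall>y. y \<lless> x \<longrightarrow> \<not> P y)"
    using least_ex[OF assms] linear by blast
  from theI'[OF this] the1_equality[OF this] show ?thesis unfolding lst_def by blast
qed

lemma lst:
  assumes "D (\<lambda>e. P (e 0))" "P a" shows "P (lst P)"
  using lst_eq[OF assms, of "lst P"] by blast

text \<open>Minimality is a bounded condition, so an unbounded search that always succeeds has a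
  definable graph. This is the source of functions that no term bounds.\<close>

lemma FT_lst:
  assumes "D (\<lambda>e. P (\<lambda>i. e (Suc i)) (e 0))" "\<And>e. \<exists>x. P e x"
  shows "FT (\<lambda>e. lst (P e))"
proof -
  have "e 0 = lst (P (\<lambda>i. e (Suc i))) \<longleftrightarrow>
      P (\<lambda>i. e (Suc i)) (e 0) \<and> (\<forall>y. y \<lless> e 0 \<longrightarrow> \<not> P (\<lambda>i. e (Suc i)) y)" for e
    using lst_eq[of "P (\<lambda>i. e (Suc i))"] D_fix[OF assms(1)] assms(2) by blast
  then show ?thesis unfolding FT_def by (simp, intro D_rules assms(1) D_shift1)
qed

text \<open>
  Bounding needs no separate collection axiom: \<open>g y \<lesssim> g z\<close> is a definable relation, so the
  existence of a maximum of \<open>g\<close> below \<open>n\<close> is a bounded statement and can be proved by induction.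
\<close>

lemma max_ex:
  assumes "FT (\<lambda>e. g (e 0))"
  shows "\<exists>z. z \<lesssim> n \<and> (\<forall>y. y \<lesssim> n \<longrightarrow> g y \<lesssim> g z)"
proof (rule induct_D[where P = "\<lambda>n. \<exists>z. z \<lesssim> n \<and> (\<forall>y. y \<lesssim> n \<longrightarrow> g y \<lesssim> g z)"])
  show "D (\<lambda>e. \<exists>z. z \<lesssim> e 0 \<and> (\<forall>y. y \<lesssim> e 0 \<longrightarrow> g y \<lesssim> g z))"
    by (intro D_rules FT_app1[OF assms])
next
  fix n assume "\<exists>z. z \<lesssim> n \<and> (\<forall>y. y \<lesssim> n \<longrightarrow> g y \<lesssim> g z)"
  then obtain z where z: "z \<lesssim> n" "\<And>y. y \<lesssim> n \<Longrightarrow> g y \<lesssim> g z" by blast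
  show "\<exists>z. z \<lesssim> suc n \<and> (\<forall>y. y \<lesssim> suc n \<longrightarrow> g y \<lesssim> g z)"
  proof (cases "g (suc n) \<lesssim> g z")
    case True
    then show ?thesis using z by (intro exI[of _ z]) auto
  next
    case False
    then have "g z \<lesssim> g (suc n)" using linear by blast
    then have "g y \<lesssim> g (suc n)" if "y \<lesssim> suc n" for y
      using that z(2)[of y] le_trans[of "g y" "g z" "g (suc n)"] by auto
    then show ?thesis by blast
  qed
qed auto

text \<open>Taking the least bound makes the bound a function of the parameters with a definable
  graph, see \<open>FT_bnd\<close>.\<close>

definition bnd :: "'m \<Rightarrow> ('m \<Rightarrow> 'm) \<Rightarrow> 'm" where
  "bnd n g = lst (\<lambda>b. \<forall>y. y \<lesssim> n \<longrightarrow> g y \<lesssim> b)"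

lemma le_bnd:
  assumes "FT (\<lambda>e. g (e 0))" "y \<lesssim> n" shows "g y \<lesssim> bnd n g"
proof -
  obtain z where "\<forall>y. y \<lesssim> n \<longrightarrow> g y \<lesssim> g z" using max_ex[OF assms(1)] by blast
  moreover have "D (\<lambda>e. \<forall>y. y \<lesssim> n \<longrightarrow> g y \<lesssim> e 0)" by (intro D_rules FT_app1[OF assms(1)])
  ultimately show ?thesis
    using lst[of "\<lambda>b. \<forall>y. y \<lesssim> n \<longrightarrow> g y \<lesssim> b" "g z"] assms(2) unfolding bnd_def by blast
qed

lemma FT_bnd:
  assumes "FT f" "FT (\<lambda>e. g (\<lambda>i. e (Suc i)) (e 0))" shows "FT (\<lambda>e. bnd (f e) (g e))"
  unfolding bnd_def
proof (rule FT_lst)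
  have "FT (\<lambda>e. g (\<lambda>i. e (Suc (Suc i))) (e 0))"
    using FT_comp[OF assms(2), of "case_nat (\<lambda>e. e 0) (\<lambda>i e. e (Suc (Suc i)))"]
    by (simp add: Tm_case_nat Tm_var)
  then show "D (\<lambda>e. \<forall>y. y \<lesssim> f (\<lambda>i. e (Suc i)) \<longrightarrow> g (\<lambda>i. e (Suc i)) y \<lesssim> e 0)"
    by (intro D_rules FT_shift[OF assms(1)])
  fix e
  show "\<exists>b. \<forall>y. y \<lesssim> f e \<longrightarrow> g e y \<lesssim> b"
    using max_ex[OF FT_fix[OF assms(2), of e], of "f e"] by blast
qed

end


section \<open>Initial segments\<close>

text \<open>Exponentiation enters as a relation whose graph is a set of the model, so it may occur
  in bounded definitions as a parameter. The locale assumptions survive every enlargement of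
  \<open>S\<close> that is again a model.\<close>

locale rca_exp = rca M S for M :: "'m interp" and S +
  fixes expo :: "'m \<Rightarrow> 'm \<Rightarrow> bool"
  assumes expo_set: "{w. expo (iH M w) (iT M w)} \<in> S"
    and expo_zero: "expo (iZ M) y \<longleftrightarrow> y = iS M (iZ M)"
    and expo_suc: "expo (iS M x) y \<longleftrightarrow> (\<exists>z. (iL M z y \<or> z = y) \<and> expo x z \<and> y = iM M (iS M (iS M (iZ M))) z)"
begin

definition pre :: "'m \<Rightarrow> 'm \<Rightarrow> bool" (infix "\<sqsubseteq>" 50) where
  "\<sigma> \<sqsubseteq> \<tau> \<longleftrightarrow> (\<exists>p. p \<lesssim> \<tau> \<and> (\<exists>y. y \<lesssim> \<tau> \<and> (\<exists>x. x \<lless> p \<and> expo y p \<and> \<tau> = \<sigma> \<otimes> p \<oplus> x)))"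

lemma D_expo: "FT f \<Longrightarrow> FT g \<Longrightarrow> D (\<lambda>e. expo (f e) (g e))"
proof (rule D_app2)
  have "D (\<lambda>e. \<langle>e 0, e (Suc 0)\<rangle> \<in> {w. expo (head w) (tail w)})"
    using expo_set by (intro D_rules)
  then show "D (\<lambda>e. expo (e 0) (e (Suc 0)))" by simp
qed

lemma D_pre: "FT f \<Longrightarrow> FT g \<Longrightarrow> D (\<lambda>e. f e \<sqsubseteq> g e)"
proof (rule D_app2)
  show "D (\<lambda>e. e 0 \<sqsubseteq> e (Suc 0))" unfolding pre_def by (intro D_rules D_expo)
qed

lemma expo_less: "expo y p \<Longrightarrow> y \<lless> p"
proof -
  \<comment> \<open>Here \<open>p\<close> acts only as a common bound for the values
    \<open>q\<close>, which keeps the induction statement bounded; the successor step passes to some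
    \<open>z \<lesssim> q\<close>, which stays below it.\<close>
  have "\<forall>q. q \<lesssim> p \<longrightarrow> expo y q \<longrightarrow> y \<lless> q"
  proof (rule induct_D[where P = "\<lambda>y. \<forall>q. q \<lesssim> p \<longrightarrow> expo y q \<longrightarrow> y \<lless> q"])
    show "D (\<lambda>e. \<forall>q. q \<lesssim> p \<longrightarrow> expo (e 0) q \<longrightarrow> e 0 \<lless> q)" by (intro D_rules D_expo)
    show "\<forall>q. q \<lesssim> p \<longrightarrow> expo \<zero> q \<longrightarrow> \<zero> \<lless> q" by (simp add: expo_zero)
  next
    fix y assume IH: "\<forall>q. q \<lesssim> p \<longrightarrow> expo y q \<longrightarrow> y \<lless> q"
    show "\<forall>q. q \<lesssim> p \<longrightarrow> expo (suc y) q \<longrightarrow> suc y \<lless> q"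
    proof (intro allI impI)
      fix q assume q: "q \<lesssim> p" "expo (suc y) q"
      then obtain z where z: "z \<lesssim> q" "expo y z" "q = z \<oplus> z" unfolding expo_suc two_mul by blast
      then have "y \<lless> z" using IH q(1) le_trans by blast
      then have "suc (y \<oplus> y) \<lless> q" unfolding z(3) by (rule less_double)
      moreover have "suc y \<lesssim> suc (y \<oplus> y)" using suc_less_suc le_add(1)[of y y] by auto
      ultimately show "suc y \<lless> q" using le_less_trans by blast
    qed
  qed
  then show "expo y p \<Longrightarrow> y \<lless> p" by blast
qed

lemma pre_zero [simp]: "\<not> \<sigma> \<sqsubseteq> \<zero>"
  by (auto simp: pre_def)

text \<open>All properties of initial segments follow from this recursion on the last digit.\<close>

lemma pre_double:
  assumes "t = h \<oplus> h \<oplus> b" "b = \<zero> \<or> b = suc \<zero>" "t \<noteq> \<zero>"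
  shows "s \<sqsubseteq> t \<longleftrightarrow> s = t \<or> s \<sqsubseteq> h"
proof
  assume "s \<sqsubseteq> t"
  then obtain p y x where p: "p \<lesssim> t" "x \<lless> p" "expo y p" "t = s \<otimes> p \<oplus> x"
    unfolding pre_def by blast
  show "s = t \<or> s \<sqsubseteq> h"
  proof (cases "y = \<zero>")
    case True
    then have "p = suc \<zero>" using p(3) expo_zero by blast
    then show ?thesis using p(2,4) by simp
  next
    case False
    then obtain y' where "y = suc y'" by (rule suc_exE)
    then have "expo (suc y') p" using p(3) by simp
    then obtain q where q: "expo y' q" "p = q \<oplus> q" unfolding expo_suc two_mul by blast
    \<comment> \<open>Since \<open>p\<close> is even, the last digits of \<open>t\<close> and of the
      remainder \<open>x\<close> are removed together; uniqueness of halves identifies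
      \<open>h\<close>.\<close>
    obtain x' c where x': "c = \<zero> \<or> c = suc \<zero>" "x = x' \<oplus> x' \<oplus> c" using parity_ex by blast
    have "h \<oplus> h \<oplus> b = (s \<otimes> q \<oplus> x') \<oplus> (s \<otimes> q \<oplus> x') \<oplus> c"
      using p(4) assms(1) q(2) x'(2) by (simp add: mul_add add_ac)
    then have h: "h = s \<otimes> q \<oplus> x'" using parity_unique assms(2) x'(1) by blast
    have "x' \<lless> q"
    proof (rule ccontr)
      assume "\<not> x' \<lless> q"
      then have "q \<oplus> q \<lesssim> x' \<oplus> x'" unfolding not_less by (rule add_mono) (simp add: \<open>\<not> x' \<lless> q\<close>[unfolded not_less])
      then have "p \<lesssim> x" using x'(2) q(2) le_add(1)[of "x' \<oplus> x'" c] le_trans by metis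
      then show False using p(2) not_less by blast
    qed
    \<comment> \<open>The definition of \<open>\<sqsubseteq>\<close> bounds the power by the longer
      sequence, so \<open>q \<lesssim> h\<close> has to be recovered; this follows from
      \<open>s\<close> being at least one.\<close>
    have "s \<noteq> \<zero>"
    proof
      assume "s = \<zero>"
      then have "t = x" using p(4) by simp
      then show False using p(1,2) not_less by blast
    qed
    then obtain s' where "s = suc s'" by (rule suc_exE)
    then have "q \<lesssim> s \<otimes> q" using le_add(2)[of q "s' \<otimes> q"] by simp
    then have "q \<lesssim> h" using h le_add(1)[of "s \<otimes> q" x'] le_trans by metis
    moreover have "y' \<lesssim> h" using expo_less[OF q(1)] \<open>q \<lesssim> h\<close> less_le_trans by blast
    ultimately show ?thesis using h q(1) \<open>x' \<lless> q\<close> unfolding pre_def by blast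
  qed
next
  assume "s = t \<or> s \<sqsubseteq> h"
  then show "s \<sqsubseteq> t"
  proof
    assume "s = t"
    moreover have "suc \<zero> \<lesssim> t" using suc_le zero_less assms(3) by blast
    moreover have "t = t \<otimes> suc \<zero> \<oplus> \<zero>" by simp
    ultimately show ?thesis unfolding pre_def using expo_zero zero_le[of t] basic(9)[of \<zero> \<zero>] by blast
  next
    assume "s \<sqsubseteq> h"
    then obtain p y x where p: "p \<lesssim> h" "x \<lless> p" "expo y p" "h = s \<otimes> p \<oplus> x"
      unfolding pre_def by blast
    have "expo (suc y) (p \<oplus> p)" unfolding expo_suc two_mul using p(3) le_add(1)[of p p] by blast
    moreover have "p \<oplus> p \<lesssim> h \<oplus> h" using p(1) by (intro add_mono)
    then have le: "p \<oplus> p \<lesssim> t" using assms(1) le_add(1)[of "h \<oplus> h" b] le_trans by metis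
    moreover have "suc y \<lesssim> p \<oplus> p" using suc_le[OF expo_less[OF p(3)]] le_add(1)[of p p] le_trans by blast
    then have "suc y \<lesssim> t" using le le_trans by blast
    moreover have "x \<oplus> x \<oplus> b \<lless> p \<oplus> p"
    proof -
      have "x \<oplus> x \<oplus> b \<lesssim> suc (x \<oplus> x)" using assms(2) by auto
      then show ?thesis using less_double[OF p(2)] le_less_trans by blast
    qed
    moreover have "t = s \<otimes> (p \<oplus> p) \<oplus> (x \<oplus> x \<oplus> b)"
      using assms(1) p(4) by (simp add: mul_add add_ac)
    ultimately show ?thesis unfolding pre_def by blast
  qed
qed

text \<open>Deleting the last digit leads to a smaller number, so \<open>pre_double\<close> can
  drive strong induction; the two estimates on \<open>h \<oplus> h\<close> are for comparing
  levels.\<close>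

lemma half_ex:
  assumes "t \<noteq> \<zero>"
  shows "\<exists>h. h \<lless> t \<and> h \<oplus> h \<lesssim> t \<and> t \<lesssim> suc (h \<oplus> h) \<and> (\<forall>s. s \<sqsubseteq> t \<longleftrightarrow> s = t \<or> s \<sqsubseteq> h)"
proof -
  obtain h b where h: "b = \<zero> \<or> b = suc \<zero>" "t = h \<oplus> h \<oplus> b" using parity_ex by blast
  have "h \<lless> t"
  proof (cases "h = \<zero>")
    case True
    then show ?thesis using assms zero_less by blast
  next
    case False
    then have "\<zero> \<oplus> h \<lless> h \<oplus> h" unfolding add_less by (rule zero_less)
    then show ?thesis using h(2) le_add(1)[of "h \<oplus> h" b] less_le_trans by simp
  qed
  moreover have "h \<oplus> h \<lesssim> t" "t \<lesssim> suc (h \<oplus> h)" using h by auto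
  ultimately show ?thesis using pre_double[OF h(2,1) assms] by blast
qed

lemma pre_refl: "t \<noteq> \<zero> \<Longrightarrow> t \<sqsubseteq> t"
  using half_ex by blast

lemma pre_le: "s \<sqsubseteq> t \<Longrightarrow> s \<lesssim> t"
proof -
  have "s \<sqsubseteq> t \<longrightarrow> s \<lesssim> t"
  proof (rule less_induct_D[where P = "\<lambda>t. s \<sqsubseteq> t \<longrightarrow> s \<lesssim> t"])
    show "D (\<lambda>e. s \<sqsubseteq> e 0 \<longrightarrow> s \<lesssim> e 0)" by (intro D_rules D_pre)
  next
    fix t assume "\<And>h. h \<lless> t \<Longrightarrow> s \<sqsubseteq> h \<longrightarrow> s \<lesssim> h"
    then show "s \<sqsubseteq> t \<longrightarrow> s \<lesssim> t"
      using half_ex[of t] le_less_trans[of s] by (cases "t = \<zero>") auto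
  qed
  then show "s \<sqsubseteq> t \<Longrightarrow> s \<lesssim> t" by blast
qed

lemma pre_trans:
  assumes "r \<sqsubseteq> s" "s \<sqsubseteq> t" shows "r \<sqsubseteq> t"
proof -
  have "s \<sqsubseteq> t \<longrightarrow> r \<sqsubseteq> t"
  proof (rule less_induct_D[where P = "\<lambda>t. s \<sqsubseteq> t \<longrightarrow> r \<sqsubseteq> t"])
    show "D (\<lambda>e. s \<sqsubseteq> e 0 \<longrightarrow> r \<sqsubseteq> e 0)" by (intro D_rules D_pre)
  next
    fix t assume IH: "\<And>h. h \<lless> t \<Longrightarrow> s \<sqsubseteq> h \<longrightarrow> r \<sqsubseteq> h"
    show "s \<sqsubseteq> t \<longrightarrow> r \<sqsubseteq> t"
      using half_ex[of t] IH assms(1) by (cases "t = \<zero>") auto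
  qed
  then show ?thesis using assms(2) by blast
qed

lemma pre_comparable:
  assumes "r \<sqsubseteq> t" "s \<sqsubseteq> t" shows "r \<sqsubseteq> s \<or> s \<sqsubseteq> r"
proof -
  have "r \<sqsubseteq> t \<longrightarrow> s \<sqsubseteq> t \<longrightarrow> r \<sqsubseteq> s \<or> s \<sqsubseteq> r"
  proof (rule less_induct_D[where P = "\<lambda>t. r \<sqsubseteq> t \<longrightarrow> s \<sqsubseteq> t \<longrightarrow> r \<sqsubseteq> s \<or> s \<sqsubseteq> r"])
    show "D (\<lambda>e. r \<sqsubseteq> e 0 \<longrightarrow> s \<sqsubseteq> e 0 \<longrightarrow> r \<sqsubseteq> s \<or> s \<sqsubseteq> r)" by (intro D_rules D_pre)
  next
    fix t assume IH: "\<And>h. h \<lless> t \<Longrightarrow> r \<sqsubseteq> h \<longrightarrow> s \<sqsubseteq> h \<longrightarrow> r \<sqsubseteq> s \<or> s \<sqsubseteq> r"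
    show "r \<sqsubseteq> t \<longrightarrow> s \<sqsubseteq> t \<longrightarrow> r \<sqsubseteq> s \<or> s \<sqsubseteq> r"
    proof (cases "t = \<zero>")
      case False
      then show ?thesis using half_ex[of t] IH by metis
    qed simp
  qed
  then show ?thesis using assms by blast
qed

text \<open>
  Levels avoid the lengths of sequences: every sequence above \<open>v\<close> has exactly one initial
  segment in the level of \<open>v\<close>.
\<close>

definition lev :: "'m \<Rightarrow> 'm \<Rightarrow> bool" where
  "lev v s \<longleftrightarrow> v \<lless> s \<and> s \<lesssim> suc (v \<oplus> v)"

lemma D_lev: "FT f \<Longrightarrow> FT g \<Longrightarrow> D (\<lambda>e. lev (f e) (g e))"
  unfolding lev_def by (intro D_rules)

text \<open>Deleting last digits cannot jump over the level: as long as \<open>t\<close> exceeds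
  \<open>2 v + 1\<close>, its half still exceeds \<open>v\<close>.\<close>

lemma lev_ex: "v \<lless> t \<Longrightarrow> \<exists>s. s \<sqsubseteq> t \<and> lev v s"
proof -
  have "v \<lless> t \<longrightarrow> (\<exists>s. s \<lesssim> t \<and> s \<sqsubseteq> t \<and> lev v s)"
  proof (rule less_induct_D[where P = "\<lambda>t. v \<lless> t \<longrightarrow> (\<exists>s. s \<lesssim> t \<and> s \<sqsubseteq> t \<and> lev v s)"])
    show "D (\<lambda>e. v \<lless> e 0 \<longrightarrow> (\<exists>s. s \<lesssim> e 0 \<and> s \<sqsubseteq> e 0 \<and> lev v s))"
      by (intro D_rules D_pre D_lev)
  next
    fix t assume IH: "\<And>h. h \<lless> t \<Longrightarrow> v \<lless> h \<longrightarrow> (\<exists>s. s \<lesssim> h \<and> s \<sqsubseteq> h \<and> lev v s)"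
    show "v \<lless> t \<longrightarrow> (\<exists>s. s \<lesssim> t \<and> s \<sqsubseteq> t \<and> lev v s)"
    proof
      assume v: "v \<lless> t"
      then have "t \<noteq> \<zero>" by auto
      show "\<exists>s. s \<lesssim> t \<and> s \<sqsubseteq> t \<and> lev v s"
      proof (cases "t \<lesssim> suc (v \<oplus> v)")
        case True
        then show ?thesis using v pre_refl[OF \<open>t \<noteq> \<zero>\<close>] unfolding lev_def by blast
      next
        case False
        then have t: "suc (v \<oplus> v) \<lless> t" using not_less by blast
        obtain h where h: "h \<lless> t" "t \<lesssim> suc (h \<oplus> h)" "\<forall>s. s \<sqsubseteq> t \<longleftrightarrow> s = t \<or> s \<sqsubseteq> h"
          using half_ex[OF \<open>t \<noteq> \<zero>\<close>] by blast
        have "v \<lless> h"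
        proof (rule ccontr)
          assume "\<not> v \<lless> h"
          then have "h \<oplus> h \<lesssim> v \<oplus> v" using not_less by (intro add_mono) auto
          then have "suc (h \<oplus> h) \<lesssim> suc (v \<oplus> v)" by (simp only: suc_less_suc basic(3))
          then have "t \<lesssim> suc (v \<oplus> v)" by (rule le_trans[OF h(2)])
          then show False using False by blast
        qed
        then obtain s where s: "s \<lesssim> h" "s \<sqsubseteq> h" "lev v s" using IH[OF h(1)] by blast
        then have "s \<lesssim> t" using le_less_trans[OF s(1) h(1)] by blast
        then show ?thesis using s h(3) by blast
      qed
    qed
  qed
  then show "v \<lless> t \<Longrightarrow> \<exists>s. s \<sqsubseteq> t \<and> lev v s" by blast
qed

text \<open>A proper initial segment of \<open>t\<close> is at most half of \<open>t\<close>; if it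
  exceeds \<open>v\<close>, then \<open>t\<close> exceeds \<open>2 v + 1\<close>.\<close>

lemma lev_unique:
  assumes "s \<sqsubseteq> t" "lev v s" "lev v t" shows "s = t"
proof (rule ccontr)
  assume "s \<noteq> t"
  have "t \<noteq> \<zero>" using assms(3) basic(8) unfolding lev_def by blast
  then obtain h where h: "h \<oplus> h \<lesssim> t" "\<forall>s. s \<sqsubseteq> t \<longleftrightarrow> s = t \<or> s \<sqsubseteq> h" using half_ex by blast
  then have "s \<lesssim> h" using assms(1) \<open>s \<noteq> t\<close> pre_le by blast
  then have "v \<lless> h" using assms(2) less_le_trans unfolding lev_def by blast
  then have "suc (v \<oplus> v) \<lless> t" using less_double h(1) less_le_trans by blast
  then show False using assms(3) not_less unfolding lev_def by blast
qed

text \<open>\<open>cut t v\<close> is the initial segment of \<open>t\<close> in the level of \<open>v\<close>; the case \<open>t \<lesssim> v\<close> is irrelevant.\<close>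

definition cut :: "'m \<Rightarrow> 'm \<Rightarrow> 'm" where
  "cut t v = lst (\<lambda>s. v \<lless> t \<longrightarrow> s \<sqsubseteq> t \<and> lev v s)"

lemma cut: "v \<lless> t \<Longrightarrow> cut t v \<sqsubseteq> t \<and> lev v (cut t v)"
proof -
  assume "v \<lless> t"
  then obtain s where "s \<sqsubseteq> t \<and> lev v s" using lev_ex by blast
  moreover have "D (\<lambda>e. v \<lless> t \<longrightarrow> e 0 \<sqsubseteq> t \<and> lev v (e 0))" by (intro D_rules D_pre D_lev)
  ultimately show ?thesis
    using lst[of "\<lambda>s. v \<lless> t \<longrightarrow> s \<sqsubseteq> t \<and> lev v s" s] \<open>v \<lless> t\<close> unfolding cut_def by blast
qed

lemma FT_cut: "FT f \<Longrightarrow> FT g \<Longrightarrow> FT (\<lambda>e. cut (f e) (g e))"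
proof (rule FT_app2[of cut])
  show "FT (\<lambda>e. cut (e 0) (e (Suc 0)))" unfolding cut_def
  proof (rule FT_lst)
    show "D (\<lambda>e. e (Suc (Suc 0)) \<lless> e (Suc 0) \<longrightarrow> e 0 \<sqsubseteq> e (Suc 0) \<and> lev (e (Suc (Suc 0))) (e 0))"
      by (intro D_rules D_pre D_lev)
    show "\<exists>s. e (Suc 0) \<lless> e 0 \<longrightarrow> s \<sqsubseteq> e 0 \<and> lev (e (Suc 0)) s" for e using lev_ex by blast
  qed
qed


section \<open>Forcing with unbounded trees\<close>

text \<open>Unboundedness is included, so the forcing conditions are exactly the sets in
  \<open>S\<close> with this property, and an infinite branch is such a tree that is also a
  \<open>chain\<close>.\<close>

definition tree :: "'m set \<Rightarrow> bool" where
  "tree T \<longleftrightarrow> \<zero> \<notin> T \<and> (\<forall>t\<in>T. \<forall>s. s \<sqsubseteq> t \<longrightarrow> s \<in> T) \<and> (\<forall>b. \<exists>t\<in>T. b \<lless> t)"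

text \<open>For a single \<open>x\<close>, the nodes without an initial segment in
  \<open>R x\<close> form a subtree. If this is unbounded for some \<open>x\<close>, it is the new
  condition. Otherwise every \<open>x\<close> has a level at which all nodes of \<open>T\<close>
  have already met \<open>R x\<close>, and minimisation chooses it as a function of
  \<open>x\<close>.\<close>

lemma ex_tree_forcing:
  assumes "T \<in> S" "tree T" "D (\<lambda>e. R (e 0) (e (Suc 0)))"
  shows "\<exists>T'. T' \<in> S \<and> tree T' \<and> T' \<subseteq> T \<and>
    ((\<exists>x. \<forall>t\<in>T'. \<not> R x t) \<or>
     (\<exists>u. FT (\<lambda>e. u (e 0)) \<and> (\<forall>x. \<forall>t\<in>T'. lev (u x) t \<longrightarrow> (\<exists>s. s \<sqsubseteq> t \<and> R x s))))"
proof (cases "\<exists>x. tree {t \<in> T. \<forall>s. s \<sqsubseteq> t \<longrightarrow> \<not> R x s}")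
  case True
  then obtain x where x: "tree {t \<in> T. \<forall>s. s \<sqsubseteq> t \<longrightarrow> \<not> R x s}" (is "tree ?T") by blast
  \<comment> \<open>Initial segments are numerically smaller, so the quantifier over
    \<open>s\<close> can be bounded by \<open>t\<close> and the subtree belongs to
    \<open>S\<close>.\<close>
  have T': "?T = {t. t \<in> T \<and> (\<forall>s. s \<lesssim> t \<longrightarrow> s \<sqsubseteq> t \<longrightarrow> \<not> R x s)}" using pre_le by blast
  have "?T \<in> S" unfolding T' by (intro set_if_D D_rules D_pre D_app2[OF assms(3)] assms(1))
  moreover have "\<not> R x t" if "t \<in> ?T" for t
    using that pre_refl[of t] assms(2) unfolding tree_def by blast
  ultimately show ?thesis using x by blast
next
  case False
  \<comment> \<open>Testing only the nodes in the level of \<open>b\<close>, instead of all nodes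
    above \<open>b\<close>, makes the condition bounded, as the least-number search
    requires.\<close>
  let ?P = "\<lambda>x b. \<forall>t. t \<lesssim> suc (b \<oplus> b) \<longrightarrow> t \<in> T \<longrightarrow> b \<lless> t \<longrightarrow> (\<exists>s. s \<lesssim> t \<and> s \<sqsubseteq> t \<and> R x s)"
  define u where "u x = lst (?P x)" for x
  have D: "D (\<lambda>e. ?P (e (Suc 0)) (e 0))"
    by (intro D_rules D_pre D_app2[OF assms(3)] assms(1))
  have ex: "\<exists>b. ?P x b" for x
  proof -
    have "\<zero> \<notin> {t \<in> T. \<forall>s. s \<sqsubseteq> t \<longrightarrow> \<not> R x s}" using assms(2) unfolding tree_def by blast
    moreover have "r \<in> {t \<in> T. \<forall>s. s \<sqsubseteq> t \<longrightarrow> \<not> R x s}"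
      if "t \<in> {t \<in> T. \<forall>s. s \<sqsubseteq> t \<longrightarrow> \<not> R x s}" "r \<sqsubseteq> t" for r t
      using that assms(2) pre_trans unfolding tree_def by blast
    ultimately obtain b where "\<forall>t\<in>{t \<in> T. \<forall>s. s \<sqsubseteq> t \<longrightarrow> \<not> R x s}. \<not> b \<lless> t"
      using False unfolding tree_def by blast
    then have "?P x b" using pre_le by blast
    then show ?thesis by blast
  qed
  have "FT (\<lambda>e. u (e 0))" unfolding u_def by (rule FT_lst[OF D ex])
  moreover have "?P x (u x)" for x
  proof -
    obtain b where "?P x b" using ex by blast
    moreover have "D (\<lambda>e. ?P x (e 0))"
      by (intro D_rules D_pre D_app2[OF assms(3)] assms(1))
    ultimately show ?thesis unfolding u_def using lst[of "?P x" b] by blast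
  qed
  then have "\<forall>x. \<forall>t\<in>T. lev (u x) t \<longrightarrow> (\<exists>s. s \<sqsubseteq> t \<and> R x s)" unfolding lev_def by blast
  ultimately show ?thesis using assms(1,2) by blast
qed

text \<open>A pigeonhole argument on one level: if the subtree through each node in the level of
  \<open>b\<close> were bounded, the bounding principle would give a common bound, contradicting the
  unboundedness of \<open>T\<close>.\<close>

lemma ex_tree_stem:
  assumes "T \<in> S" "tree T"
  shows "\<exists>T' s. T' \<in> S \<and> tree T' \<and> T' \<subseteq> T \<and> lev b s \<and> (\<forall>t\<in>T'. s \<sqsubseteq> t \<or> t \<sqsubseteq> s)"
proof -
  let ?T = "\<lambda>s. {t \<in> T. s \<sqsubseteq> t \<or> t \<sqsubseteq> s}"
  have "\<exists>s. lev b s \<and> tree (?T s)"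
  proof (rule ccontr)
    assume *: "\<nexists>s. lev b s \<and> tree (?T s)"
    let ?m = "suc (b \<oplus> b)"
    \<comment> \<open>The clause \<open>?m \<lesssim> v\<close> puts the level of \<open>v\<close>
      above all nodes in the level of \<open>b\<close>, so a comparable node there must extend
      \<open>s\<close>. For \<open>s\<close> outside that level only this clause remains, which
      keeps \<open>f\<close> total.\<close>
    let ?P = "\<lambda>s v. ?m \<lesssim> v \<and> (lev b s \<longrightarrow> (\<forall>t. t \<lesssim> suc (v \<oplus> v) \<longrightarrow> t \<in> T \<and> lev v t \<longrightarrow> \<not> s \<sqsubseteq> t))"
    define f where "f s = lst (?P s)" for s
    have D: "D (\<lambda>e. ?P (e (Suc 0)) (e 0))" by (intro D_rules D_pre D_lev assms(1))
    have ex: "\<exists>v. ?P s v" for s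
    proof (cases "lev b s")
      case True
      then have "\<not> tree (?T s)" using * by blast
      moreover have "\<zero> \<notin> ?T s" using assms(2) unfolding tree_def by blast
      moreover have "r \<in> ?T s" if "t \<in> ?T s" "r \<sqsubseteq> t" for r t
        using that assms(2) pre_trans pre_comparable unfolding tree_def by blast
      ultimately obtain c where c: "\<forall>t\<in>?T s. \<not> c \<lless> t" unfolding tree_def by blast
      have "?P s (c \<oplus> ?m)"
      proof (intro conjI impI allI notI le_add)
        fix t assume t: "t \<in> T \<and> lev (c \<oplus> ?m) t" "s \<sqsubseteq> t"
        have "c \<lless> t" using t(1) le_add(1)[of c ?m] le_less_trans unfolding lev_def by blast
        then show False using c t by blast
      qed
      then show ?thesis by blast
    qed blast
    have f: "FT (\<lambda>e. f (e 0))" unfolding f_def by (rule FT_lst[OF D ex])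
    have fP: "?P s (f s)" for s
    proof -
      obtain v where "?P s v" using ex by blast
      moreover have "D (\<lambda>e. ?P s (e 0))" by (intro D_rules D_pre D_lev assms(1))
      ultimately show ?thesis unfolding f_def using lst[of "?P s" v] by blast
    qed
    define V where "V = bnd ?m f"
    \<comment> \<open>Adding \<open>b\<close> places \<open>t\<close> above both \<open>V\<close>
      and \<open>b\<close>, so that \<open>t\<close> has an initial segment \<open>s\<close> in the
      level of \<open>b\<close> and another one in the level of \<open>f s\<close>.\<close>
    obtain t where t: "t \<in> T" "V \<oplus> b \<lless> t" using assms(2) unfolding tree_def by blast
    have "b \<lless> t" using t(2) le_add(2)[of b V] le_less_trans by blast
    then obtain s where s: "s \<sqsubseteq> t" "lev b s" using lev_ex by blast
    have "f s \<lesssim> V" unfolding V_def using s(2) by (intro le_bnd f) (simp add: lev_def)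
    then have "f s \<lless> t" using t(2) le_add(1)[of V b] le_less_trans le_trans by metis
    then obtain r where r: "r \<sqsubseteq> t" "lev (f s) r" using lev_ex by blast
    have "r \<in> T" using assms(2) t(1) r(1) unfolding tree_def by blast
    then have "\<not> s \<sqsubseteq> r" using fP[of s] s(2) r(2) unfolding lev_def by blast
    then have "r \<sqsubseteq> s" using pre_comparable[OF r(1) s(1)] by blast
    then have "r \<lesssim> ?m" using pre_le s(2) le_trans unfolding lev_def by blast
    moreover have "?m \<lesssim> f s" using fP by blast
    ultimately have "r \<lesssim> f s" using le_trans by blast
    then show False using r(2) not_less unfolding lev_def by blast
  qed
  then obtain s where "lev b s" "tree (?T s)" by blast
  moreover have "?T s \<in> S" by (intro set_if_D D_rules D_pre assms(1))
  ultimately show ?thesis by (intro exI[of _ "?T s"] exI[of _ s]) blast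
qed

end


section \<open>Generic branches\<close>

context rca_exp
begin

definition chain :: "'m set \<Rightarrow> bool" where
  "chain G \<longleftrightarrow> (\<forall>s\<in>G. \<forall>t\<in>G. s \<sqsubseteq> t \<or> t \<sqsubseteq> s)"

text \<open>The second alternative bounds in the model, uniformly in \<open>x\<close>, a witness found along the branch.\<close>

definition decides :: "'m set \<Rightarrow> 'm set \<Rightarrow> bool" where
  "decides G A \<longleftrightarrow> (\<exists>x. \<forall>s\<in>G. \<langle>x, s\<rangle> \<notin> A) \<or>
     (\<exists>u. FT (\<lambda>e. u (e 0)) \<and> (\<forall>x. \<exists>s\<in>G. s \<lesssim> suc (u x \<oplus> u x) \<and> \<langle>x, s\<rangle> \<in> A))"

text \<open>Stage \<open>n\<close> decides the \<open>n\<close>-th set and then fixes a node in the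
  level of the \<open>n\<close>-th number, through which the rest of the construction must pass. The
  branch is the intersection of all conditions.\<close>

lemma ex_generic:
  assumes "T \<in> S" "tree T"
  shows "\<exists>G. G \<subseteq> T \<and> tree G \<and> chain G \<and> (\<forall>A\<in>S. decides G A)"
proof -
  let ?A = "from_nat_into S" and ?b = "from_nat_into (UNIV :: 'm set)"
  define dec where "dec n T \<longleftrightarrow> (\<exists>x. \<forall>t\<in>T. \<langle>x, t\<rangle> \<notin> ?A n) \<or>
    (\<exists>u. FT (\<lambda>e. u (e 0)) \<and> (\<forall>x. \<forall>t\<in>T. lev (u x) t \<longrightarrow> (\<exists>s. s \<sqsubseteq> t \<and> \<langle>x, s\<rangle> \<in> ?A n)))" for n T
  define stem where "stem n T \<longleftrightarrow> (\<exists>s. lev (?b n) s \<and> (\<forall>t\<in>T. s \<sqsubseteq> t \<or> t \<sqsubseteq> s))" for n T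
  have "\<exists>f. \<forall>n. (f n \<in> S \<and> tree (f n) \<and> f n \<subseteq> T) \<and> (f (Suc n) \<subseteq> f n \<and> dec n (f (Suc n)) \<and> stem n (f (Suc n)))"
  proof (rule dependent_nat_choice)
    show "\<exists>X. X \<in> S \<and> tree X \<and> X \<subseteq> T" using assms by blast
    fix X n assume X: "X \<in> S \<and> tree X \<and> X \<subseteq> T"
    have "?A n \<in> S" using from_nat_into[OF nonempty] .
    then have "D (\<lambda>e. \<langle>e 0, e (Suc 0)\<rangle> \<in> ?A n)" by (intro D_rules)
    from ex_tree_forcing[OF conjunct1[OF X] conjunct1[OF conjunct2[OF X]], of "\<lambda>x t. \<langle>x, t\<rangle> \<in> ?A n", OF this]
    obtain Y where Y: "Y \<in> S" "tree Y" "Y \<subseteq> X" "dec n Y" unfolding dec_def by blast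
    obtain Z where Z: "Z \<in> S" "tree Z" "Z \<subseteq> Y" "stem n Z"
      using ex_tree_stem[OF Y(1,2), of "?b n"] unfolding stem_def by blast
    have "dec n Z" using Y(4) Z(3) unfolding dec_def by blast
    then show "\<exists>Z. (Z \<in> S \<and> tree Z \<and> Z \<subseteq> T) \<and> (Z \<subseteq> X \<and> dec n Z \<and> stem n Z)"
      using X Y(3) Z by blast
  qed
  then obtain f where f: "\<And>n. f n \<in> S" "\<And>n. tree (f n)" "\<And>n. f n \<subseteq> T"
    "\<And>n. f (Suc n) \<subseteq> f n" "\<And>n. dec n (f (Suc n))" "\<And>n. stem n (f (Suc n))"
    by blast
  have anti: "f m \<subseteq> f n" if "n \<le> m" for n m
    using that by (rule lift_Suc_antimono_le[of f, OF f(4)])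
  define G where "G = (\<Inter>n. f n)"
  have closed: "s \<in> G" if "t \<in> G" "s \<sqsubseteq> t" for s t
    using that f(2) unfolding G_def tree_def by blast
  have stem: "\<exists>s\<in>G. lev b s \<and> (\<forall>t\<in>G. s \<sqsubseteq> t \<or> t \<sqsubseteq> s)" for b
  proof -
    obtain n where "?b n = b" using from_nat_into_surj[OF countable_M] by blast
    then obtain s where s: "lev b s" "\<And>t. t \<in> f (Suc n) \<Longrightarrow> s \<sqsubseteq> t \<or> t \<sqsubseteq> s"
      using f(6)[of n] unfolding stem_def by blast
    \<comment> \<open>A sufficiently late condition has a node numerically above \<open>s\<close>;
      it is comparable with the stem \<open>s\<close>, hence extends it, and downward closure
      returns \<open>s\<close>. This is why the intersection remains unbounded.\<close>
    have "s \<in> f m" for m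
    proof -
      let ?k = "max m (Suc n)"
      obtain t where t: "t \<in> f ?k" "s \<lless> t" using f(2) unfolding tree_def by blast
      have "\<not> t \<sqsubseteq> s" using pre_le[of t s] t(2) not_less by blast
      moreover have "t \<in> f (Suc n)" using t(1) anti[of "Suc n" ?k] by auto
      ultimately have "s \<sqsubseteq> t" using s(2) by blast
      then have "s \<in> f ?k" using t(1) f(2) unfolding tree_def by blast
      then show ?thesis using anti[of m ?k] by auto
    qed
    then have "s \<in> G" unfolding G_def by blast
    moreover have "\<forall>t\<in>G. s \<sqsubseteq> t \<or> t \<sqsubseteq> s" using s(2) unfolding G_def by blast
    ultimately show ?thesis using s(1) by blast
  qed
  have "chain G" unfolding chain_def
  proof (intro ballI)
    fix s t assume st: "s \<in> G" "t \<in> G"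
    \<comment> \<open>A stem in the level of \<open>s \<oplus> t\<close> is numerically above both
      nodes, so both are initial segments of it.\<close>
    obtain r where r: "lev (s \<oplus> t) r" "\<And>t. t \<in> G \<Longrightarrow> r \<sqsubseteq> t \<or> t \<sqsubseteq> r" using stem by blast
    have "s \<lless> r" "t \<lless> r"
      using r(1) le_less_trans[OF le_add(1)[of s t]] le_less_trans[OF le_add(2)[of t s]]
      unfolding lev_def by blast+
    then have "\<not> r \<sqsubseteq> s" "\<not> r \<sqsubseteq> t" using pre_le not_less by blast+
    then show "s \<sqsubseteq> t \<or> t \<sqsubseteq> s" using r(2) st pre_comparable by blast
  qed
  moreover have G: "tree G" unfolding tree_def
  proof (intro conjI allI ballI impI)
    show "\<zero> \<notin> G" using f(2) unfolding G_def tree_def by blast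
    show "\<exists>t\<in>G. b \<lless> t" for b using stem unfolding lev_def by blast
  qed (use closed in blast)
  moreover have "G \<subseteq> T" using f(3) unfolding G_def by blast
  moreover have "decides G A" if A: "A \<in> S" for A
  proof -
    obtain n where n: "?A n = A" using from_nat_into_surj[OF countable_S A] by blast
    have sub: "G \<subseteq> f (Suc n)" unfolding G_def by blast
    from f(5)[of n, unfolded dec_def n] show ?thesis
    proof
      assume "\<exists>x. \<forall>t\<in>f (Suc n). \<langle>x, t\<rangle> \<notin> A"
      then show ?thesis unfolding decides_def using sub by blast
    next
      assume "\<exists>u. FT (\<lambda>e. u (e 0)) \<and> (\<forall>x. \<forall>t\<in>f (Suc n). lev (u x) t \<longrightarrow> (\<exists>s. s \<sqsubseteq> t \<and> \<langle>x, s\<rangle> \<in> A))"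
      then obtain u where u: "FT (\<lambda>e. u (e 0))"
        "\<And>x t. t \<in> f (Suc n) \<Longrightarrow> lev (u x) t \<Longrightarrow> \<exists>s. s \<sqsubseteq> t \<and> \<langle>x, s\<rangle> \<in> A" by blast
      have "\<exists>s\<in>G. s \<lesssim> suc (u x \<oplus> u x) \<and> \<langle>x, s\<rangle> \<in> A" for x
      proof -
        obtain t where t: "t \<in> G" "lev (u x) t" using stem by blast
        then obtain s where s: "s \<sqsubseteq> t" "\<langle>x, s\<rangle> \<in> A" using u(2) sub by blast
        have "s \<lesssim> suc (u x \<oplus> u x)"
          using le_trans[OF pre_le[OF s(1)]] t(2) unfolding lev_def by blast
        then show ?thesis using s(2) closed[OF t(1) s(1)] by blast
      qed
      then show ?thesis unfolding decides_def using u(1) by blast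
    qed
  qed
  ultimately show ?thesis by blast
qed

end

section \<open>Adjoining a generic branch\<close>

locale generic = rca_exp M S expo for M :: "'m interp" and S expo +
  fixes G :: "'m set"
  assumes tree_G: "tree G" and chain_G: "chain G" and decides_G: "A \<in> S \<Longrightarrow> decides G A"
begin

text \<open>This plays the role of the restriction of \<open>G\<close> to \<open>v\<close>; indexing
  by levels instead of lengths makes it total on the numbers of the model.\<close>

definition gam :: "'m \<Rightarrow> 'm" where
  "gam v = (THE s. s \<in> G \<and> lev v s)"

lemma gam_unique:
  assumes "s \<in> G" "lev v s" shows "gam v = s"
  unfolding gam_def
proof (rule the_equality)
  fix t assume "t \<in> G \<and> lev v t"
  then show "t = s" using assms chain_G lev_unique unfolding chain_def by metis
qed (use assms in blast)

lemma gam: "gam v \<in> G \<and> lev v (gam v)"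
proof -
  obtain t where t: "t \<in> G" "v \<lless> t" using tree_G unfolding tree_def by blast
  obtain s where s: "s \<sqsubseteq> t" "lev v s" using lev_ex[OF t(2)] by blast
  have "s \<in> G" using s(1) t(1) tree_G unfolding tree_def by blast
  then show ?thesis using gam_unique[of s v] s(2) by simp
qed

lemma cut_G: "s \<in> G \<Longrightarrow> v \<lless> s \<Longrightarrow> cut s v = gam v"
  using cut[of v s] gam_unique[of "cut s v" v] tree_G unfolding tree_def by metis

lemma cut_gam: "v \<lesssim> w \<Longrightarrow> cut (gam w) v = gam v"
  using cut_G[of "gam w" v] gam[of w] le_less_trans[of v w] unfolding lev_def by blast

text \<open>One segment, at an index given by \<open>s\<close> itself, settles membership; this is
  what places \<open>G\<close> in \<open>ext\<close>.\<close>

lemma mem_G: "s \<in> G \<longleftrightarrow> s \<sqsubseteq> gam s"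
proof
  assume "s \<in> G"
  moreover have "\<not> gam s \<sqsubseteq> s" using pre_le[of "gam s" s] gam[of s] not_less unfolding lev_def by blast
  ultimately show "s \<sqsubseteq> gam s" using chain_G gam unfolding chain_def by blast
qed (use gam tree_G in \<open>unfold tree_def, blast\<close>)

text \<open>
  The sets of the extension are decided by an initial segment of \<open>G\<close> whose size is bounded by a
  function of the ground model; \<open>DG\<close> is the corresponding notion of definability.
\<close>

definition ext :: "'m set set" where
  "ext = {B. \<exists>f A. FT (\<lambda>e. f (e 0)) \<and> A \<in> S \<and> B = {x. \<langle>x, gam (f x)\<rangle> \<in> A}}"

definition DG :: "((nat \<Rightarrow> 'm) \<Rightarrow> bool) \<Rightarrow> bool" where
  "DG P \<longleftrightarrow> (\<exists>F Q. FT F \<and> D (\<lambda>e. Q (\<lambda>i. e (Suc i)) (e 0)) \<and> (\<forall>e. P e \<longleftrightarrow> Q e (gam (F e))))"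

section \<open>Closure properties of definability from the branch\<close>

lemma DG_D: "D P \<Longrightarrow> DG P"
  unfolding DG_def by (intro exI[of _ "\<lambda>e. \<zero>"] exI[of _ "\<lambda>e y. P e"] conjI FT_const D_shift) auto

lemma DG_mem:
  assumes "B \<in> ext" "FT f" shows "DG (\<lambda>e. f e \<in> B)"
proof -
  obtain g A where *: "FT (\<lambda>e. g (e 0))" "A \<in> S" "B = {x. \<langle>x, gam (g x)\<rangle> \<in> A}"
    using assms(1) unfolding ext_def by blast
  show ?thesis unfolding DG_def
  proof (intro exI[of _ "\<lambda>e. g (f e)"] exI[of _ "\<lambda>e y. \<langle>f e, y\<rangle> \<in> A"] conjI)
    show "FT (\<lambda>e. g (f e))" using *(1) assms(2) by (rule FT_app1)
    show "D (\<lambda>e. \<langle>f (\<lambda>i. e (Suc i)), e 0\<rangle> \<in> A)" by (intro D_rules *(2) FT_shift assms(2))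
  qed (simp add: *(3))
qed

lemma DG_not: "DG P \<Longrightarrow> DG (\<lambda>e. \<not> P e)"
proof -
  assume "DG P"
  then obtain F Q where "FT F" "D (\<lambda>e. Q (\<lambda>i. e (Suc i)) (e 0))" "\<And>e. P e \<longleftrightarrow> Q e (gam (F e))"
    unfolding DG_def by blast
  then show ?thesis unfolding DG_def
    by (intro exI[of _ F] exI[of _ "\<lambda>e y. \<not> Q e y"] conjI D_not) auto
qed

lemma D_cut:
  assumes "FT F" "D (\<lambda>e. Q (\<lambda>i. e (Suc i)) (e 0))"
  shows "D (\<lambda>e. Q (\<lambda>i. e (Suc i)) (cut (e 0) (F (\<lambda>i. e (Suc i)))))"
  by (rule D_subst[where P = "\<lambda>e z. Q (\<lambda>i. e (Suc i)) z"])
    (intro FT_cut FT_var FT_shift assms D_shift1)+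

text \<open>The sum of the two indices dominates both, so a single longer segment contains the two
  required ones, and \<open>cut\<close> recovers them inside the ground model.\<close>

lemma DG_and:
  assumes "DG P" "DG P'" shows "DG (\<lambda>e. P e \<and> P' e)"
proof -
  obtain F Q where *: "FT F" "D (\<lambda>e. Q (\<lambda>i. e (Suc i)) (e 0))" "\<And>e. P e \<longleftrightarrow> Q e (gam (F e))"
    using assms(1) unfolding DG_def by blast
  obtain F' Q' where **: "FT F'" "D (\<lambda>e. Q' (\<lambda>i. e (Suc i)) (e 0))" "\<And>e. P' e \<longleftrightarrow> Q' e (gam (F' e))"
    using assms(2) unfolding DG_def by blast
  show ?thesis unfolding DG_def
  proof (intro exI[of _ "\<lambda>e. F e \<oplus> F' e"] exI[of _ "\<lambda>e y. Q e (cut y (F e)) \<and> Q' e (cut y (F' e))"] conjI)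
    show "FT (\<lambda>e. F e \<oplus> F' e)" using *(1) **(1) by (rule FT_add)
    show "D (\<lambda>e. Q (\<lambda>i. e (Suc i)) (cut (e 0) (F (\<lambda>i. e (Suc i)))) \<and>
        Q' (\<lambda>i. e (Suc i)) (cut (e 0) (F' (\<lambda>i. e (Suc i)))))"
      by (intro D_and D_cut * **)
    show "\<forall>e. (P e \<and> P' e) \<longleftrightarrow>
        Q e (cut (gam (F e \<oplus> F' e)) (F e)) \<and> Q' e (cut (gam (F e \<oplus> F' e)) (F' e))"
      using cut_gam[OF le_add(1)] cut_gam[OF le_add(2)] by (simp add: *(3) **(3))
  qed
qed

lemma DG_imp: "DG P \<Longrightarrow> DG Q \<Longrightarrow> DG (\<lambda>e. P e \<longrightarrow> Q e)"
  using DG_not[OF DG_and[OF _ DG_not], of P Q] by simp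

lemma DG_or: "DG P \<Longrightarrow> DG Q \<Longrightarrow> DG (\<lambda>e. P e \<or> Q e)"
  using DG_not[OF DG_and[OF DG_not DG_not], of P Q] by simp

text \<open>The indices required for all \<open>y\<close> below \<open>f e\<close> have the common
  bound \<open>bnd\<close>, and the one segment at this bound decides the whole quantifier. Here the
  bounding principle carries bounded formulas over to the extension.\<close>

lemma DG_all:
  assumes "FT f" "DG (\<lambda>e. P (\<lambda>i. e (Suc i)) (e 0))"
  shows "DG (\<lambda>e. \<forall>y. y \<lless> f e \<longrightarrow> P e y)"
proof -
  obtain F Q where *: "FT F" "D (\<lambda>e. Q (\<lambda>i. e (Suc i)) (e 0))"
    "\<And>e. P (\<lambda>i. e (Suc i)) (e 0) \<longleftrightarrow> Q e (gam (F e))"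
    using assms(2) unfolding DG_def by blast
  have P: "P e y \<longleftrightarrow> Q (case_nat y e) (gam (F (case_nat y e)))" for e y
    using *(3)[of "case_nat y e"] by simp
  define F' where "F' e y = F (case_nat y e)" for e y
  have id: "case_nat (e 0) (\<lambda>i. e (Suc i)) = e" for e :: "nat \<Rightarrow> 'm"
    by (auto split: nat.split)
  have F': "FT (\<lambda>e. F' (\<lambda>i. e (Suc i)) (e 0))" unfolding F'_def id by (rule *(1))
  show ?thesis unfolding DG_def
  proof (intro exI[of _ "\<lambda>e. bnd (f e) (F' e)"]
      exI[of _ "\<lambda>e z. \<forall>y. y \<lless> f e \<longrightarrow> Q (case_nat y e) (cut z (F' e y))"] conjI)
    show "FT (\<lambda>e. bnd (f e) (F' e))" using assms(1) F' by (rule FT_bnd)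
    have app: "(\<lambda>i. case_nat a b i e) = case_nat (a e) (\<lambda>i. b i e)"
      for a and b :: "nat \<Rightarrow> (nat \<Rightarrow> 'm) \<Rightarrow> 'm" and e
      by (auto split: nat.split)
    show "D (\<lambda>e. \<forall>y. y \<lless> f (\<lambda>i. e (Suc i)) \<longrightarrow>
        Q (case_nat y (\<lambda>i. e (Suc i))) (cut (e 0) (F' (\<lambda>i. e (Suc i)) y)))"
    proof (rule D_all[OF FT_shift[OF assms(1)]],
        rule D_subst[where P = "\<lambda>e z. Q (case_nat (e 0) (\<lambda>i. e (Suc (Suc i)))) z"])
      have "FT (\<lambda>e. F' (\<lambda>i. e (Suc (Suc i))) (e 0))"
        using FT_comp[OF F', of "case_nat (\<lambda>e. e 0) (\<lambda>i e. e (Suc (Suc i)))"]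
        by (simp add: Tm_case_nat Tm_var)
      then show "FT (\<lambda>e. cut (e (Suc 0)) (F' (\<lambda>i. e (Suc (Suc i))) (e 0)))"
        by (intro FT_cut FT_var)
      show "D (\<lambda>e. Q (case_nat (e (Suc 0)) (\<lambda>i. e (Suc (Suc (Suc i))))) (e 0))"
        using D_comp[OF *(2), of "case_nat (\<lambda>e. e 0) (case_nat (\<lambda>e. e (Suc 0)) (\<lambda>i e. e (Suc (Suc (Suc i)))))"]
        by (simp add: Tm_case_nat Tm_var app)
    qed
    show "\<forall>e. (\<forall>y. y \<lless> f e \<longrightarrow> P e y) \<longleftrightarrow>
        (\<forall>y. y \<lless> f e \<longrightarrow> Q (case_nat y e) (cut (gam (bnd (f e) (F' e))) (F' e y)))"
    proof
      fix e
      have "cut (gam (bnd (f e) (F' e))) (F' e y) = gam (F' e y)" if "y \<lless> f e" for y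
        using le_bnd[OF FT_fix[OF F', of e], of y "f e"] that by (intro cut_gam) blast
      then show "(\<forall>y. y \<lless> f e \<longrightarrow> P e y) \<longleftrightarrow>
          (\<forall>y. y \<lless> f e \<longrightarrow> Q (case_nat y e) (cut (gam (bnd (f e) (F' e))) (F' e y)))"
        by (simp add: P F'_def)
    qed
  qed
qed

lemma DG_ex:
  assumes "FT f" "DG (\<lambda>e. P (\<lambda>i. e (Suc i)) (e 0))"
  shows "DG (\<lambda>e. \<exists>y. y \<lless> f e \<and> P e y)"
proof -
  have "DG (\<lambda>e. \<not> (\<forall>y. y \<lless> f e \<longrightarrow> \<not> P e y))" by (intro DG_not DG_all assms)
  then show ?thesis by simp
qed

lemma ext_if_DG:
  assumes "DG (\<lambda>e. P (e 0))" shows "{x. P x} \<in> ext"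
proof -
  obtain F Q where *: "FT F" "D (\<lambda>e. Q (\<lambda>i. e (Suc i)) (e 0))" "\<And>e. P (e 0) \<longleftrightarrow> Q e (gam (F e))"
    using assms unfolding DG_def by blast
  have "FT (\<lambda>e. F (\<lambda>_. e 0))" by (intro FT_comp[OF *(1)] Tm_var)
  moreover have "{w. Q (\<lambda>_. head w) (tail w)} \<in> S"
    using D_comp[OF *(2), of "case_nat (\<lambda>e. tail (e 0)) (\<lambda>_ e. head (e 0))"]
    by (intro set_if_D) (simp add: Tm_case_nat Tm_rules)
  moreover have "{x. P x} = {x. \<langle>x, gam (F (\<lambda>_. x))\<rangle> \<in> {w. Q (\<lambda>_. head w) (tail w)}}"
    using *(3)[of "\<lambda>_. x" for x] by auto
  ultimately show ?thesis unfolding ext_def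
    by (intro CollectI exI[of _ "\<lambda>x. F (\<lambda>_. x)"] exI[of _ "{w. Q (\<lambda>_. head w) (tail w)}"]) simp
qed

section \<open>The extension as a model of \<open>RCA0m\<close>\<close>

lemma S_subset_ext: "S \<subseteq> ext"
proof
  fix A assume "A \<in> S"
  then have "D (\<lambda>e. e 0 \<in> A)" by (intro D_rules)
  then show "A \<in> ext" using ext_if_DG[of "\<lambda>x. x \<in> A"] DG_D by simp
qed

lemma G_in_ext: "G \<in> ext"
proof -
  have "DG (\<lambda>e. e 0 \<in> G)" unfolding DG_def mem_G
    by (intro exI[of _ "\<lambda>e. e 0"] exI[of _ "\<lambda>e y. e 0 \<sqsubseteq> y"] conjI D_pre FT_var) simp
  then show ?thesis using ext_if_DG[of "\<lambda>x. x \<in> G"] by simp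
qed

text \<open>A set of the extension is determined by \<open>A\<close> and the graph of
  \<open>f\<close>, and both belong to \<open>S\<close>.\<close>

lemma countable_ext: "countable ext"
proof (rule countable_subset)
  let ?h = "\<lambda>(g, A). {x. \<exists>y. \<langle>x, y\<rangle> \<in> g \<and> \<langle>x, gam y\<rangle> \<in> A}"
  show "ext \<subseteq> ?h ` (S \<times> S)"
  proof
    fix B assume "B \<in> ext"
    then obtain f A where *: "FT (\<lambda>e. f (e 0))" "A \<in> S" "B = {x. \<langle>x, gam (f x)\<rangle> \<in> A}"
      unfolding ext_def by blast
    have "{w. tail w = f (head w)} \<in> S" by (intro set_if_D D_rules FT_app1[OF *(1)])
    moreover have "B = ?h ({w. tail w = f (head w)}, A)" using *(3) by simp
    ultimately show "B \<in> ?h ` (S \<times> S)" using *(2) by blast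
  qed
  show "countable (?h ` (S \<times> S))" using countable_S by blast
qed

lemma FT_tval: "(\<And>i. FT (\<lambda>e. \<eta> e i)) \<Longrightarrow> FT (\<lambda>e. tval M (\<eta> e) t)"
  by (induction t) (simp_all add: FT_const FT_suc FT_hd FT_tl FT_add FT_mul FT_pair)

text \<open>The environment \<open>\<eta>\<close> consists of ground-model functions, so that a
  bounded quantifier can put its variable in front and the induction hypothesis still
  applies.\<close>

lemma DG_sat:
  assumes "delta00 \<phi>" "range s \<subseteq> ext" "\<And>i. FT (\<lambda>e. \<eta> e i)"
  shows "DG (\<lambda>e. sat M U (\<eta> e) s \<phi>)"
  using assms(1,3)
proof (induction arbitrary: \<eta> rule: delta00.induct)
  case (3 t X)
  have "s X \<in> ext" using assms(2) by blast
  then show ?case using 3 by (simp add: DG_mem FT_tval)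
next
  case (8 \<phi> t)
  have "FT (\<lambda>e. case_nat (e 0) (\<eta> (\<lambda>i. e (Suc i))) i)" for i
    by (cases i) (simp_all add: FT_var FT_shift[OF 8(3)])
  from 8(2)[OF this] show ?case by (simp add: DG_all FT_tval[OF 8(3)])
next
  case (9 \<phi> t)
  have "FT (\<lambda>e. case_nat (e 0) (\<eta> (\<lambda>i. e (Suc i))) i)" for i
    by (cases i) (simp_all add: FT_var FT_shift[OF 9(3)])
  from 9(2)[OF this] show ?case by (simp add: DG_ex FT_tval[OF 9(3)])
next
  case (10 \<phi> t)
  have "FT (\<lambda>e. case_nat (e 0) (\<eta> (\<lambda>i. e (Suc i))) i)" for i
    by (cases i) (simp_all add: FT_var FT_shift[OF 10(3)])
  note IH = 10(2)[OF this]
  have "DG (\<lambda>e. \<forall>y. y \<lless> suc (tval M (\<eta> e) t) \<longrightarrow> sat M U (case_nat y (\<eta> e)) s \<phi>)"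
    by (intro DG_all FT_suc FT_tval 10(3)) (rule IH)
  then show ?case by simp
next
  case (11 \<phi> t)
  have "FT (\<lambda>e. case_nat (e 0) (\<eta> (\<lambda>i. e (Suc i))) i)" for i
    by (cases i) (simp_all add: FT_var FT_shift[OF 11(3)])
  note IH = 11(2)[OF this]
  have "DG (\<lambda>e. \<exists>y. y \<lless> suc (tval M (\<eta> e) t) \<and> sat M U (case_nat y (\<eta> e)) s \<phi>)"
    by (intro DG_ex FT_suc FT_tval 11(3)) (rule IH)
  then show ?case by simp
qed (simp_all add: DG_imp DG_and DG_or DG_D D_bool D_eq D_less FT_tval)

lemma ext_compr:
  assumes "delta00 \<phi>" "range s \<subseteq> ext" shows "{x. sat M U (case_nat x e) s \<phi>} \<in> ext"
proof (rule ext_if_DG, rule DG_sat[OF assms])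
  show "FT (\<lambda>e'. case_nat (e' 0) e i)" for i by (cases i) (simp_all add: FT_var FT_const)
qed

text \<open>Up to \<open>x\<close>, all membership questions for \<open>X\<close> are answered by
  the single segment \<open>t\<close>, which is a number of the ground model. This part of
  \<open>X\<close> is therefore definable there, and ground-model induction applies.\<close>

lemma ext_induct:
  assumes "X \<in> ext" "\<zero> \<in> X" "\<And>x. x \<in> X \<Longrightarrow> suc x \<in> X" shows "x \<in> X"
proof -
  obtain f A where *: "FT (\<lambda>e. f (e 0))" "A \<in> S" "X = {x. \<langle>x, gam (f x)\<rangle> \<in> A}"
    using assms(1) unfolding ext_def by blast
  define t where "t = gam (bnd x f)"
  have cut: "\<langle>y, cut t (f y)\<rangle> \<in> A \<longleftrightarrow> y \<in> X" if "y \<lesssim> x" for y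
    using cut_gam[OF le_bnd[OF *(1) that]] *(3) unfolding t_def by simp
  have "x \<lesssim> x \<longrightarrow> \<langle>x, cut t (f x)\<rangle> \<in> A"
  proof (rule induct_D[where P = "\<lambda>y. y \<lesssim> x \<longrightarrow> \<langle>y, cut t (f y)\<rangle> \<in> A"])
    show "D (\<lambda>e. e 0 \<lesssim> x \<longrightarrow> \<langle>e 0, cut t (f (e 0))\<rangle> \<in> A)"
      by (intro D_rules FT_cut *(1,2))
    show "\<zero> \<lesssim> x \<longrightarrow> \<langle>\<zero>, cut t (f \<zero>)\<rangle> \<in> A" using cut assms(2) by blast
  next
    fix y assume IH: "y \<lesssim> x \<longrightarrow> \<langle>y, cut t (f y)\<rangle> \<in> A"
    show "suc y \<lesssim> x \<longrightarrow> \<langle>suc y, cut t (f (suc y))\<rangle> \<in> A"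
    proof
      assume "suc y \<lesssim> x"
      moreover from this have "y \<lesssim> x" using suc_lessD[of y x] by auto
      ultimately show "\<langle>suc y, cut t (f (suc y))\<rangle> \<in> A" using IH cut assms(3) by blast
    qed
  qed
  then show ?thesis using cut by blast
qed

text \<open>The pairs of \<open>x\<close> and a segment that already reveals a value of
  \<open>h\<close> at \<open>x\<close> form a set \<open>B\<close> in \<open>S\<close>. Totality of
  \<open>h\<close> excludes the first alternative of \<open>decides\<close>, and the second bounds
  the revealing segment.\<close>

lemma ext_func_bounded:
  assumes "h \<in> ext" "func M h"
  shows "\<exists>U. FT (\<lambda>e. U (e 0)) \<and> (\<forall>x y. \<langle>x, y\<rangle> \<in> h \<longrightarrow> y \<lless> U x)"
proof -
  obtain f A where *: "FT (\<lambda>e. f (e 0))" "A \<in> S" "h = {x. \<langle>x, gam (f x)\<rangle> \<in> A}"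
    using assms(1) unfolding ext_def by blast
  \<comment> \<open>The condition on \<open>f \<langle>x, y\<rangle>\<close> guarantees that
    \<open>cut\<close> yields the segment from which membership in \<open>h\<close> is read; the
    condition \<open>y \<lless> s\<close> turns a bound on segments into a bound on values.\<close>
  let ?R = "\<lambda>x s. \<exists>y. y \<lless> s \<and> f \<langle>x, y\<rangle> \<lless> s \<and> \<langle>\<langle>x, y\<rangle>, cut s (f \<langle>x, y\<rangle>)\<rangle> \<in> A"
  define B where "B = {w. ?R (head w) (tail w)}"
  have "B \<in> S" unfolding B_def by (intro set_if_D D_rules FT_cut FT_app1[OF *(1)] *(2))
  have "\<exists>s\<in>G. \<langle>x, s\<rangle> \<in> B" for x
  proof -
    obtain y where y: "\<langle>x, y\<rangle> \<in> h" using assms(2) unfolding func_def by blast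
    let ?s = "gam (y \<oplus> f \<langle>x, y\<rangle>)"
    have "y \<lless> ?s" "f \<langle>x, y\<rangle> \<lless> ?s"
      using gam[of "y \<oplus> f \<langle>x, y\<rangle>"] le_less_trans[OF le_add(1)] le_less_trans[OF le_add(2)]
      unfolding lev_def by blast+
    moreover have "cut ?s (f \<langle>x, y\<rangle>) = gam (f \<langle>x, y\<rangle>)" by (intro cut_gam le_add)
    ultimately have "\<langle>x, ?s\<rangle> \<in> B" using y *(3) unfolding B_def by auto
    then show ?thesis using gam by blast
  qed
  then obtain u where u: "FT (\<lambda>e. u (e 0))"
    "\<And>x. \<exists>s\<in>G. s \<lesssim> suc (u x \<oplus> u x) \<and> \<langle>x, s\<rangle> \<in> B"
    using decides_G[OF \<open>B \<in> S\<close>] unfolding decides_def by blast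
  have "y \<lless> suc (u x \<oplus> u x)" if "\<langle>x, y\<rangle> \<in> h" for x y
  proof -
    obtain s where s: "s \<in> G" "s \<lesssim> suc (u x \<oplus> u x)" "\<langle>x, s\<rangle> \<in> B" using u(2) by blast
    then obtain z where z: "z \<lless> s" "f \<langle>x, z\<rangle> \<lless> s" "\<langle>\<langle>x, z\<rangle>, cut s (f \<langle>x, z\<rangle>)\<rangle> \<in> A"
      unfolding B_def by auto
    then have "\<langle>x, z\<rangle> \<in> h" using cut_G[OF s(1) z(2)] *(3) by simp
    then have "z = y" using that assms(2) unfolding func_def by blast
    then show ?thesis using less_le_trans[OF z(1) s(2)] by simp
  qed
  moreover have "FT (\<lambda>e. suc (u (e 0) \<oplus> u (e 0)))" by (intro D_rules u(1))
  ultimately show ?thesis by (intro exI[of _ "\<lambda>x. suc (u x \<oplus> u x)"]) blast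
qed

text \<open>The intermediate value \<open>z\<close> lies below a ground-model function of
  \<open>x\<close>, so the composite has a bounded definition from \<open>g\<close> and
  \<open>h\<close>.\<close>

lemma ext_comp:
  assumes "g \<in> ext" "h \<in> ext" "func M g" "func M h"
  shows "\<exists>f\<in>ext. func M f \<and> (\<forall>x y z. \<langle>x, z\<rangle> \<in> h \<and> \<langle>z, y\<rangle> \<in> g \<longrightarrow> \<langle>x, y\<rangle> \<in> f)"
proof -
  obtain U where U: "FT (\<lambda>e. U (e 0))" "\<And>x y. \<langle>x, y\<rangle> \<in> h \<Longrightarrow> y \<lless> U x"
    using ext_func_bounded[OF assms(2,4)] by blast
  let ?f = "{w. w \<noteq> \<zero> \<and> (\<exists>z. z \<lless> U (head w) \<and> \<langle>head w, z\<rangle> \<in> h \<and> \<langle>z, tail w\<rangle> \<in> g)}"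
  have mem: "\<langle>x, y\<rangle> \<in> ?f \<longleftrightarrow> (\<exists>z. \<langle>x, z\<rangle> \<in> h \<and> \<langle>z, y\<rangle> \<in> g)" for x y
    using U(2) by auto
  have "D (\<lambda>e. e 0 \<noteq> \<zero>)" by (intro D_rules)
  then have "?f \<in> ext"
    by (intro ext_if_DG DG_and DG_ex DG_mem assms D_rules FT_app1[OF U(1)]) (rule DG_D)
  moreover have "func M ?f" unfolding func_def mem
  proof (intro conjI allI impI)
    show "\<exists>y z. \<langle>x, z\<rangle> \<in> h \<and> \<langle>z, y\<rangle> \<in> g" for x using assms(3,4) unfolding func_def by blast
    show "y = y'" if "(\<exists>z. \<langle>x, z\<rangle> \<in> h \<and> \<langle>z, y\<rangle> \<in> g) \<and> (\<exists>z. \<langle>x, z\<rangle> \<in> h \<and> \<langle>z, y'\<rangle> \<in> g)" for x y y'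
      using that assms(3,4) unfolding func_def by metis
  qed simp
  ultimately show ?thesis using mem by blast
qed

lemma rca_ext: "rca M ext"
proof (rule rca.intro)
  show "ext \<noteq> {}" using G_in_ext by blast
qed (fact countable_M countable_ext arith ext_induct ext_compr ext_comp)+

end


lemma (in rca_exp) ex_branch_ext:
  assumes "T \<in> S" "tree T"
  shows "\<exists>S' P. rca_exp M S' expo \<and> S \<subseteq> S' \<and> P \<in> S' \<and> P \<subseteq> T \<and> tree P \<and> chain P"
proof -
  obtain G where G: "G \<subseteq> T" "tree G" "chain G" "\<forall>A\<in>S. decides G A"
    using ex_generic[OF assms] by blast
  interpret generic M S expo G using G by unfold_locales auto
  have "rca_exp M ext expo"
    using rca_ext S_subset_ext expo_set expo_zero expo_suc
    by (intro rca_exp.intro rca_exp_axioms.intro) blast+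
  then show ?thesis using G S_subset_ext G_in_ext by blast
qed


section \<open>Iterating the extension\<close>

lemma no_set_quant_delta00: "delta00 \<phi> \<Longrightarrow> no_set_quant \<phi>"
  by (induction rule: delta00.induct) auto

lemma sat_no_set_quant: "no_set_quant \<phi> \<Longrightarrow> sat M S e s \<phi> \<longleftrightarrow> sat M U e s \<phi>"
  by (induction \<phi> arbitrary: e) auto

text \<open>An instance of comprehension or composition involves finitely many sets, all of which
  lie in one member of the increasing sequence, and a bounded formula has the same truth value in
  all of them.\<close>

lemma rca_Union:
  fixes F :: "nat \<Rightarrow> 'm set set"
  assumes rca: "\<And>n. rca M (F n)" and mono: "mono F"
  shows "rca M (\<Union>n. F n)"
proof (rule rca.intro)
  show "countable (UNIV :: 'm set)" "arith M"
    using rca.countable_M[OF rca] rca.arith[OF rca] by blast+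
  show "countable (\<Union>n. F n)" using rca.countable_S[OF rca] by blast
  show "(\<Union>n. F n) \<noteq> {}" using rca.nonempty[OF rca] by blast
  show "x \<in> X" if "X \<in> (\<Union>n. F n)" "iZ M \<in> X" "\<And>x. x \<in> X \<Longrightarrow> iS M x \<in> X" for X x
    using that rca.set_induct[OF rca] by blast
  show "{x. sat M (\<Union>n. F n) (case_nat x e) s \<phi>} \<in> (\<Union>n. F n)"
    if \<phi>: "delta00 \<phi>" and s: "range s \<subseteq> (\<Union>n. F n)" for \<phi> s e
  proof -
    have "s ` {..sbound \<phi>} \<subseteq> (\<Union>n. F n)" using s by blast
    then obtain n where n: "s ` {..sbound \<phi>} \<subseteq> F n"
      using subset_UN_chain[of "s ` {..sbound \<phi>}" F] mono by blast
    \<comment> \<open>Variables beyond the free ones are redirected to one fixed set, because the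
      assignment must take all its values in \<open>F n\<close>.\<close>
    define s' where "s' i = s (min i (sbound \<phi>))" for i
    have "range s' \<subseteq> F n" using n by (auto simp: s'_def)
    then have "{x. sat M (F n) (case_nat x e) s' \<phi>} \<in> F n" by (rule rca.compr[OF rca \<phi>])
    moreover have "sat M (F n) (case_nat x e) s' \<phi> \<longleftrightarrow> sat M (\<Union>n. F n) (case_nat x e) s \<phi>" for x
    proof -
      have "sat M (F n) (case_nat x e) s' \<phi> \<longleftrightarrow> sat M (F n) (case_nat x e) s \<phi>"
        by (intro sat_cong) (auto simp: s'_def)
      also have "\<dots> \<longleftrightarrow> sat M (\<Union>n. F n) (case_nat x e) s \<phi>"
        using no_set_quant_delta00[OF \<phi>] by (rule sat_no_set_quant)
      finally show ?thesis .
    qed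
    ultimately show ?thesis by auto
  qed
  show "\<exists>f\<in>\<Union>n. F n. func M f \<and> (\<forall>x y z. iP M x z \<in> h \<and> iP M z y \<in> g \<longrightarrow> iP M x y \<in> f)"
    if gh: "g \<in> (\<Union>n. F n)" "h \<in> (\<Union>n. F n)" "func M g" "func M h" for g h
  proof -
    obtain n where "{g, h} \<subseteq> F n" using subset_UN_chain[of "{g, h}" F] mono gh(1,2) by auto
    then have "g \<in> F n" "h \<in> F n" by auto
    from rca.comp[OF rca this gh(3,4)] show ?thesis by blast
  qed
qed

lemma rca_exp_Union:
  assumes "\<And>n. rca_exp M (F n) expo" "mono (F :: nat \<Rightarrow> _)"
  shows "rca_exp M (\<Union>n. F n) expo"
proof (rule rca_exp.intro[OF rca_Union])
  show "rca M (F n)" for n using assms(1) by (rule rca_exp.axioms)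
  show "rca_exp_axioms M (\<Union>n. F n) expo"
    using rca_exp.expo_set[OF assms(1)] rca_exp.expo_zero[OF assms(1)] rca_exp.expo_suc[OF assms(1)]
    by (intro rca_exp_axioms.intro) blast+
qed (fact assms(2))

abbreviation has_branch :: "'m interp \<Rightarrow> ('m \<Rightarrow> 'm \<Rightarrow> bool) \<Rightarrow> 'm set set \<Rightarrow> 'm set \<Rightarrow> bool" where
  "has_branch M expo S T \<equiv> (\<exists>P\<in>S. P \<subseteq> T \<and> rca_exp.tree M expo P \<and> rca_exp.chain M expo P)"

text \<open>This inner iteration serves the trees of \<open>S\<close> only; those that appear on the
  way wait for the next round in \<open>ex_WKL_ext\<close>.\<close>

lemma ex_all_branches_ext:
  assumes "rca_exp M S expo"
  shows "\<exists>S'. rca_exp M S' expo \<and> S \<subseteq> S' \<and> (\<forall>T\<in>S. rca_exp.tree M expo T \<longrightarrow> has_branch M expo S' T)"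
proof -
  let ?T = "from_nat_into S"
  have S: "countable S" "S \<noteq> {}"
    using rca.countable_S rca.nonempty rca_exp.axioms(1)[OF assms] by blast+
  have "\<exists>F. \<forall>n. (rca_exp M (F n) expo \<and> S \<subseteq> F n) \<and>
    (F n \<subseteq> F (Suc n) \<and> (rca_exp.tree M expo (?T n) \<longrightarrow> has_branch M expo (F (Suc n)) (?T n)))"
  proof (rule dependent_nat_choice)
    show "\<exists>X. rca_exp M X expo \<and> S \<subseteq> X" using assms by blast
    fix X n assume X: "rca_exp M X expo \<and> S \<subseteq> X"
    show "\<exists>Y. (rca_exp M Y expo \<and> S \<subseteq> Y) \<and>
      (X \<subseteq> Y \<and> (rca_exp.tree M expo (?T n) \<longrightarrow> has_branch M expo Y (?T n)))"
    proof (cases "rca_exp.tree M expo (?T n)")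
      case True
      have "?T n \<in> X" using from_nat_into[OF S(2)] X by blast
      from rca_exp.ex_branch_ext[OF conjunct1[OF X] this True] show ?thesis using X by blast
    qed (use X in blast)
  qed
  then obtain F where F: "\<And>n. rca_exp M (F n) expo" "\<And>n. S \<subseteq> F n" "\<And>n. F n \<subseteq> F (Suc n)"
    "\<And>n. rca_exp.tree M expo (?T n) \<Longrightarrow> has_branch M expo (F (Suc n)) (?T n)"
    by blast
  have "rca_exp M (\<Union>n. F n) expo" using F(1,3) by (intro rca_exp_Union) (auto simp: mono_iff_le_Suc)
  moreover have "has_branch M expo (\<Union>n. F n) T" if T: "T \<in> S" "rca_exp.tree M expo T" for T
  proof -
    obtain n where "?T n = T" using from_nat_into_surj[OF S(1) T(1)] by blast
    then show ?thesis using F(4)[of n] T(2) by blast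
  qed
  ultimately show ?thesis using F(2) by blast
qed

lemma ex_WKL_ext:
  assumes "rca_exp M S expo"
  shows "\<exists>S'. rca_exp M S' expo \<and> S \<subseteq> S' \<and> (\<forall>T\<in>S'. rca_exp.tree M expo T \<longrightarrow> has_branch M expo S' T)"
proof -
  have "\<exists>F. \<forall>n. (rca_exp M (F n) expo \<and> S \<subseteq> F n) \<and> (F n \<subseteq> F (Suc n) \<and>
    (\<forall>T\<in>F n. rca_exp.tree M expo T \<longrightarrow> has_branch M expo (F (Suc n)) T))"
  proof (rule dependent_nat_choice)
    show "\<exists>X. rca_exp M X expo \<and> S \<subseteq> X" using assms by blast
    fix X and n :: nat assume X: "rca_exp M X expo \<and> S \<subseteq> X"
    obtain Y where "rca_exp M Y expo" "X \<subseteq> Y" "\<forall>T\<in>X. rca_exp.tree M expo T \<longrightarrow> has_branch M expo Y T"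
      using ex_all_branches_ext[OF conjunct1[OF X]] by blast
    then show "\<exists>Y. (rca_exp M Y expo \<and> S \<subseteq> Y) \<and>
      (X \<subseteq> Y \<and> (\<forall>T\<in>X. rca_exp.tree M expo T \<longrightarrow> has_branch M expo Y T))"
      using X by (intro exI[of _ Y]) auto
  qed
  then obtain F where F: "\<And>n. rca_exp M (F n) expo" "\<And>n. S \<subseteq> F n" "\<And>n. F n \<subseteq> F (Suc n)"
    "\<And>n T. T \<in> F n \<Longrightarrow> rca_exp.tree M expo T \<Longrightarrow> has_branch M expo (F (Suc n)) T"
    by blast
  have "rca_exp M (\<Union>n. F n) expo" using F(1,3) by (intro rca_exp_Union) (auto simp: mono_iff_le_Suc)
  moreover have "has_branch M expo (\<Union>n. F n) T" if "T \<in> (\<Union>n. F n)" "rca_exp.tree M expo T" for T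
  proof -
    obtain n where "T \<in> F n" using \<open>T \<in> (\<Union>n. F n)\<close> by blast
    from F(4)[OF this] that(2) obtain P where "P \<in> F (Suc n)" "P \<subseteq> T"
      "rca_exp.tree M expo P" "rca_exp.chain M expo P" by blast
    then show ?thesis by blast
  qed
  ultimately show ?thesis using F(2) by blast
qed


section \<open>Conservativity\<close>

text \<open>An \<open>exp_formula\<close> is bounded and has no free set variables, so evaluating it
  with the empty family and empty sets does not change its truth. The relation refers to
  \<open>M\<close> alone and is thus the same before and after an extension.\<close>

definition exp_rel :: "'m interp \<Rightarrow> fm \<Rightarrow> 'm \<Rightarrow> 'm \<Rightarrow> bool" where
  "exp_rel M E x y \<longleftrightarrow> sat M {} (case_nat x (\<lambda>_. y)) (\<lambda>_. {}) E"

lemma sat_expf: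
  assumes "exp_formula E"
  shows "sat M S e s (expf E t u) \<longleftrightarrow> exp_rel M E (tval M e t) (tval M e u)"
proof -
  have "(\<lambda>i. tval M e (case_nat t (\<lambda>_. u) i)) = case_nat (tval M e t) (\<lambda>_. tval M e u)"
    by (auto split: nat.split)
  then have "sat M S e s (expf E t u) \<longleftrightarrow> sat M S (case_nat (tval M e t) (\<lambda>_. tval M e u)) s E"
    by (simp add: expf_def sat_subst)
  also have "\<dots> \<longleftrightarrow> sat M S (case_nat (tval M e t) (\<lambda>_. tval M e u)) (\<lambda>_. {}) E"
    using assms by (intro sat_cong) (auto simp: exp_formula_def)
  also have "\<dots> \<longleftrightarrow> exp_rel M E (tval M e t) (tval M e u)"
    unfolding exp_rel_def using assms
    by (intro sat_no_set_quant no_set_quant_delta00) (simp add: exp_formula_def)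
  finally show ?thesis .
qed

text \<open>The recurrences are theorems of \<open>CDelta00\<close> and hold in \<open>M\<close> by
  soundness; the graph is a set by comprehension for the instance of \<open>E\<close> at
  \<open>Head\<close> and \<open>Tail\<close>.\<close>

lemma rca_exp_rel:
  assumes "rca M S" "exp_formula E" shows "rca_exp M S (exp_rel M E)"
proof (intro rca_exp.intro rca_exp_axioms.intro assms(1))
  note E = assms(2)
  have valid: "valid M S \<phi>" if "CDelta00 \<turnstile> \<phi>" for \<phi>
    using that assms(1) by (intro soundness_valid[of CDelta00 \<phi>]) (auto simp: rca_iff RCA0m_def)
  obtain X where "X \<in> S" using assms(1) by (auto simp: rca_iff)
  then have s: "range (\<lambda>_::nat. X) \<subseteq> S" by auto
  show "{w. exp_rel M E (iH M w) (iT M w)} \<in> S"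
  proof -
    have "delta00 (expf E (Head (Var 0)) (Tail (Var 0)))"
      using E unfolding expf_def exp_formula_def by (intro delta00_subst) blast
    from rca.compr[OF assms(1) this s, of undefined] show ?thesis by (simp add: sat_expf[OF E])
  qed
  have "valid M S (expf E \<^bold>0 (Var 0) \<^bold>\<longleftrightarrow> Var 0 \<^bold>= \<^bold>1)"
    using valid E unfolding exp_formula_def by (metis valid_AllN)
  then have "sat M S (\<lambda>_. y) (\<lambda>_. X) (expf E \<^bold>0 (Var 0) \<^bold>\<longleftrightarrow> Var 0 \<^bold>= \<^bold>1)" for y
    using s unfolding valid_def by blast
  from this[of y for y] show "exp_rel M E (iZ M) y \<longleftrightarrow> y = iS M (iZ M)" for y
    unfolding sat.simps sat_expf[OF E] tval.simps by blast
  have "valid M S (expf E (Succ (Var 1)) (Var 0) \<^bold>\<longleftrightarrow>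
        ExLe (Var 0) (expf E (Var 2) (Var 0) \<^bold>\<and> Var 1 \<^bold>= \<^bold>2 \<^bold>* Var 0))"
    using valid E unfolding exp_formula_def by (metis valid_AllN)
  then have "sat M S (case_nat y (\<lambda>_. x)) (\<lambda>_. X) (expf E (Succ (Var 1)) (Var 0) \<^bold>\<longleftrightarrow>
        ExLe (Var 0) (expf E (Var 2) (Var 0) \<^bold>\<and> Var 1 \<^bold>= \<^bold>2 \<^bold>* Var 0))" for x y
    using s unfolding valid_def by blast
  then show "exp_rel M E (iS M x) y \<longleftrightarrow>
      (\<exists>z. (iL M z y \<or> z = y) \<and> exp_rel M E x z \<and> y = iM M (iS M (iS M (iZ M))) z)" for x y
    unfolding sat.simps sat_expf[OF E] tval.simps iff_conv_conj_imp[symmetric]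
    by (simp add: numeral_2_eq_2)
qed

context rca_exp
begin

lemma sat_init_seg:
  assumes "expo = exp_rel M E" "exp_formula E"
  shows "sat M U e s (init_seg E t u) \<longleftrightarrow> tval M e t \<sqsubseteq> tval M e u"
  unfolding pre_def
  by (simp add: init_seg_def sat_expf[OF assms(2)] assms(1) numeral_2_eq_2)

lemma sat_is_tree_unbounded:
  assumes "expo = exp_rel M E" "exp_formula E"
  shows "sat M U e s (is_tree E T) \<and> sat M U e s (unbounded T) \<longleftrightarrow> tree (s T)"
proof -
  have "sat M U e s (is_tree E T) \<longleftrightarrow> \<zero> \<notin> s T \<and> (\<forall>t\<in>s T. \<forall>r. r \<sqsubseteq> t \<and> r \<lless> t \<longrightarrow> r \<in> s T)"
    by (auto simp: is_tree_def proper_init_seg_def sat_init_seg[OF assms])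
  also have "\<dots> \<longleftrightarrow> \<zero> \<notin> s T \<and> (\<forall>t\<in>s T. \<forall>r. r \<sqsubseteq> t \<longrightarrow> r \<in> s T)"
    using pre_le by blast
  finally have "sat M U e s (is_tree E T) \<longleftrightarrow> \<dots>" .
  moreover have "sat M U e s (unbounded T) \<longleftrightarrow> (\<forall>b. \<exists>t\<in>s T. b \<lless> t)"
  proof -
    have "sat M U e s (unbounded T) \<longleftrightarrow> (\<forall>b. \<exists>t\<in>s T. \<not> t \<lless> b)"
      by (auto simp: unbounded_def)
    also have "\<dots> \<longleftrightarrow> (\<forall>b. \<exists>t\<in>s T. b \<lless> t)"
    proof (intro iffI allI)
      fix b assume "\<forall>b. \<exists>t\<in>s T. \<not> t \<lless> b"
      \<comment> \<open>The formula \<open>unbounded\<close> only supplies a node that is not less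
        than the chosen number; choosing \<open>suc b\<close> makes it strictly larger than
        \<open>b\<close>.\<close>
      then obtain t where "t \<in> s T" "\<not> t \<lless> suc b" by blast
      then show "\<exists>t\<in>s T. b \<lless> t" using linear[of b t] by auto
    next
      fix b assume "\<forall>b. \<exists>t\<in>s T. b \<lless> t"
      then show "\<exists>t\<in>s T. \<not> t \<lless> b" using not_less by blast
    qed
    finally show ?thesis .
  qed
  ultimately show ?thesis unfolding tree_def by blast
qed

lemma valid_WKL:
  assumes "expo = exp_rel M E" "exp_formula E"
    "\<And>T. T \<in> S \<Longrightarrow> tree T \<Longrightarrow> \<exists>P\<in>S. P \<subseteq> T \<and> tree P \<and> chain P"
  shows "valid M S (WKL E)"
proof -
  note tree = sat_is_tree_unbounded[OF assms(1,2)]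
  have "sat M S e (case_nat T s) (ExS (is_tree E 0 \<^bold>\<and> unbounded 0 \<^bold>\<and> is_branch E 0 \<^bold>\<and> subset_fm 0 1))"
    if T: "T \<in> S" "sat M S e (case_nat T s) (is_tree E 0 \<^bold>\<and> unbounded 0)" for e s T
  proof -
    have "tree T" using T(2) tree[of S e "case_nat T s" 0] by simp
    then obtain P where P: "P \<in> S" "P \<subseteq> T" "tree P" "chain P" using assms(3)[OF T(1)] by blast
    let ?s = "case_nat P (case_nat T s)"
    have "sat M S e ?s (is_tree E 0)" "sat M S e ?s (unbounded 0)"
      using P(3) tree[of S e ?s 0] by simp_all
    moreover have "sat M S e ?s (is_branch E 0)"
      using P(4) \<open>sat M S e ?s (is_tree E 0)\<close>
      by (simp add: is_branch_def sat_init_seg[OF assms(1,2)] chain_def)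
    moreover have "sat M S e ?s (subset_fm 0 1)" using P(2) by (auto simp: subset_fm_def)
    ultimately show ?thesis using P(1) by auto
  qed
  then show ?thesis unfolding valid_def WKL_def by auto
qed

end

theorem theorem5p9:
  fixes E :: fm
  assumes "exp_formula E"
  shows "Pi11_conservative (WKL0m E) RCA0m"
  unfolding Pi11_conservative_def
proof (intro allI impI, rule ccontr)
  fix \<psi> assume "Pi11_sentence \<psi>" and proves: "WKL0m E \<turnstile> \<psi>" and not: "\<not> RCA0m \<turnstile> \<psi>"
  then obtain \<phi> where \<phi>: "no_set_quant \<phi>" "\<psi> = AllS \<phi>" "sentence \<psi>"
    unfolding Pi11_sentence_def by blast
  have "BASIC \<subseteq> RCA0m" by (auto simp: RCA0m_def CDelta00_def)
  from completeness[OF sentence_RCA0m this \<phi>(3) not]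
  obtain M :: "nat interp" and S where M: "countable S" "S \<noteq> {}" "\<forall>\<gamma>\<in>RCA0m. valid M S \<gamma>" "\<not> valid M S \<psi>"
    by blast
  then have "rca M S" by (simp add: rca_iff)
  from ex_WKL_ext[OF rca_exp_rel[OF this assms]] obtain S' where S': "rca_exp M S' (exp_rel M E)" "S \<subseteq> S'"
    "\<And>T. T \<in> S' \<Longrightarrow> rca_exp.tree M (exp_rel M E) T \<Longrightarrow> has_branch M (exp_rel M E) S' T"
    by auto
  have "valid M S' (WKL E)" using rca_exp.valid_WKL[OF S'(1) refl assms S'(3)] .
  moreover have "\<forall>\<gamma>\<in>RCA0m. valid M S' \<gamma>" using rca_exp.axioms(1)[OF S'(1)] by (simp add: rca_iff)
  ultimately have "\<forall>\<gamma>\<in>WKL0m E. valid M S' \<gamma>" by (simp add: WKL0m_def)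
  then have "valid M S' \<psi>" using soundness_valid[OF proves] by blast
  then have "valid M S' \<phi>" by (simp add: \<phi>(2))
  \<comment> \<open>The leading set quantifier of \<open>\<psi>\<close> is universal, so its truth
    over \<open>S'\<close> may be restricted to assignments in the smaller family
    \<open>S\<close>.\<close>
  then have "sat M S' e s \<phi>" if "range s \<subseteq> S" for e s
    using that S'(2) by (auto simp: valid_def)
  then have "valid M S \<phi>"
    using sat_no_set_quant[OF \<phi>(1), of M S _ _ S'] by (simp add: valid_def)
  then show False using M(4) by (simp add: \<phi>(2))
qed

end
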